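(* Let $\mathcal A=\{1,\dots,M\}$ be a finite alphabet and $B$ an irreducible and aperiodic $M\times M$ matrix of $0$'s and $1$'s. Let $\mu$ be a $g$-measure on $\Sigma_B$ with $g$-function $g$, and let $x\in\Sigma_B$ be a point of prime period $m\ge1$. (a) If $g$ is continuous at the set of points $\{\sigma^i(x): i=0,\dots,m-1\}$, then the limit $$p=\lim_{n\to\infty}\frac{\mu(A_{n+m}(x))}{\mu(A_n(x))}$$ exists and is given by $\prod_{i=0}^{m-1}g(\sigma^i(x))$. So in particular, if $\mathrm{var}_k\,g\to0$ as $k\to\infty$, this limit exists for any periodic point. (b) If moreover $\sum_k\mathrm{var}_k\,g<\infty$ and $g>0$, then for every $t>0$ the limiting distribution (under $\mu$), as $n\to\infty$, of the number of visits around $x$, $W_n=\sum_{i=0}^{t/\mu(A_n(x))}\mathbf 1_{A_n(x)}\circ\sigma^i$, is the Pólya–Aeppli distribution with parameter $t(1-p)$.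
   Context: $\Sigma_B=\{x\in\mathcal A^{\mathbb N}: B_{x_i,x_{i+1}}=1\ \forall i\ge1\}$ with the product topology and left shift $(\sigma(x))_i=x_{i+1}$. $A_n(x)=\{y\in\Sigma_B:y_i=x_i,\ i=1,\dots,n\}$ is the $n$-cylinder containing $x$. A $g$-function on $\Sigma_B$ is a measurable $g:\Sigma_B\to[0,1]$ with $\sum_{y:\sigma(y)=x}g(y)=1$ for all $x\in\Sigma_B$. A $g$-measure is a probability measure $\mu$ with $\mathcal L_g^*\mu=\mu$, where $\mathcal L_g^*$ is the dual of the transfer operator $\mathcal L_gf(x)=\sum_{y:\sigma(y)=x}g(y)f(y)$; such a $\mu$ is $\sigma$-invariant. $\mathrm{var}_k\,g=\sup\{|g(x)-g(y)|:x_1^k=y_1^k\}$, where $x_1^k=(x_1,\dots,x_k)$. Pólya–Aeppli distribution with parameter $t(1-p)$: the compound Poisson distribution on $\mathbb N_0$ with moment generating function $\exp\left(\sum_{\ell\ge1}t\tilde\lambda_\ell(e^{z\ell}-1)\right)$, $\tilde\lambda_\ell=(1-p)^2p^{\ell-1}$. Summation up to $t/\mu(A_n(x))$ means up to its integer part.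
   Formalization: In (a), including the "in particular", all cylinders around the periodic point are assumed to have positive measure, as otherwise the ratios are 0/0; in (b), M is at least 2, since for M=1 one has p=1 and W_n = floor(t)+1, so the claim fails. *)

theory Defs
  imports "HOL-Probability.Probability" "Jordan_Normal_Form.Matrix"
begin

text \<open>
  Following the indexing of matrices in the library, the alphabet of an \<open>M \<times> M\<close> matrix
  is \<open>{0..<M}\<close>, and a sequence \<open>(x\<^sub>1, x\<^sub>2, \<dots>)\<close> is a function with
  \<open>x i\<close> the letter \<open>x\<^sub>i\<^sub>+\<^sub>1\<close>.
\<close>

definition irreducible_mat :: "nat mat \<Rightarrow> bool" where
  "irreducible_mat B \<longleftrightarrow>
     (\<forall>i<dim_row B. \<forall>j<dim_row B. \<exists>n\<ge>1. (B ^\<^sub>m n) $$ (i, j) > 0)"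

definition aperiodic_mat :: "nat mat \<Rightarrow> bool" where
  "aperiodic_mat B \<longleftrightarrow>
     (\<forall>i<dim_row B. Gcd {n. n \<ge> 1 \<and> (B ^\<^sub>m n) $$ (i, i) > 0} = 1)"

definition subshift :: "nat mat \<Rightarrow> (nat \<Rightarrow> nat) set" where
  "subshift B = {x. (\<forall>i. x i < dim_row B) \<and> (\<forall>i. B $$ (x i, x (Suc i)) = 1)}"

text \<open>
  The topology of type \<^typ>\<open>nat \<Rightarrow> nat\<close> is the product of the discrete topologies, so
  this is the Borel \<open>\<sigma>\<close>-algebra of the subspace topology on the subshift.
\<close>

definition subshift_borel :: "nat mat \<Rightarrow> (nat \<Rightarrow> nat) measure" where
  "subshift_borel B = restrict_space borel (subshift B)"

definition left_shift :: "(nat \<Rightarrow> nat) \<Rightarrow> (nat \<Rightarrow> nat)" where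
  "left_shift x = (\<lambda>i. x (Suc i))"

definition cylinder :: "nat mat \<Rightarrow> nat \<Rightarrow> (nat \<Rightarrow> nat) \<Rightarrow> (nat \<Rightarrow> nat) set" where
  "cylinder B n x = {y \<in> subshift B. \<forall>i<n. y i = x i}"

definition prime_period :: "(nat \<Rightarrow> nat) \<Rightarrow> nat \<Rightarrow> bool" where
  "prime_period x m \<longleftrightarrow>
     m \<ge> 1 \<and> (left_shift ^^ m) x = x \<and> (\<forall>k. 1 \<le> k \<and> k < m \<longrightarrow> (left_shift ^^ k) x \<noteq> x)"

definition g_function :: "nat mat \<Rightarrow> ((nat \<Rightarrow> nat) \<Rightarrow> real) \<Rightarrow> bool" where
  "g_function B g \<longleftrightarrow>
     g \<in> borel_measurable (subshift_borel B) \<and>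
     (\<forall>x\<in>subshift B. 0 \<le> g x \<and> g x \<le> 1) \<and>
     (\<forall>x\<in>subshift B. (\<Sum>y | y \<in> subshift B \<and> left_shift y = x. g y) = 1)"

definition transfer_op ::
  "nat mat \<Rightarrow> ((nat \<Rightarrow> nat) \<Rightarrow> real) \<Rightarrow> ((nat \<Rightarrow> nat) \<Rightarrow> real) \<Rightarrow> (nat \<Rightarrow> nat) \<Rightarrow> real" where
  "transfer_op B g f x = (\<Sum>y | y \<in> subshift B \<and> left_shift y = x. g y * f y)"

text \<open>
  As \<open>g\<close> is only assumed to be measurable, the transfer operator acts on bounded measurable
  functions rather than on continuous ones, and its dual is tested against the former.
\<close>

definition g_measure ::
  "nat mat \<Rightarrow> ((nat \<Rightarrow> nat) \<Rightarrow> real) \<Rightarrow> (nat \<Rightarrow> nat) measure \<Rightarrow> bool" where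
  "g_measure B g \<mu> \<longleftrightarrow>
     prob_space \<mu> \<and> sets \<mu> = sets (subshift_borel B) \<and>
     (\<forall>f \<in> borel_measurable (subshift_borel B). bounded (f ` subshift B) \<longrightarrow>
        (\<integral>x. transfer_op B g f x \<partial>\<mu>) = (\<integral>x. f x \<partial>\<mu>))"

definition variation :: "nat mat \<Rightarrow> ((nat \<Rightarrow> nat) \<Rightarrow> real) \<Rightarrow> nat \<Rightarrow> real" where
  "variation B g k =
     Sup {\<bar>g x - g y\<bar> | x y. x \<in> subshift B \<and> y \<in> subshift B \<and> (\<forall>i<k. x i = y i)}"

definition cylinder_ratio ::
  "nat mat \<Rightarrow> (nat \<Rightarrow> nat) measure \<Rightarrow> (nat \<Rightarrow> nat) \<Rightarrow> nat \<Rightarrow> nat \<Rightarrow> real" where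
  "cylinder_ratio B \<mu> x m n =
     measure \<mu> (cylinder B (n + m) x) / measure \<mu> (cylinder B n x)"

definition visits ::
  "nat mat \<Rightarrow> (nat \<Rightarrow> nat) measure \<Rightarrow> (nat \<Rightarrow> nat) \<Rightarrow> real \<Rightarrow> nat \<Rightarrow> (nat \<Rightarrow> nat) \<Rightarrow> real" where
  "visits B \<mu> x t n y =
     (\<Sum>i = 0..nat \<lfloor>t / measure \<mu> (cylinder B n x)\<rfloor>. indicator (cylinder B n x) ((left_shift ^^ i) y))"

definition compound_poisson_pmf :: "real \<Rightarrow> nat pmf \<Rightarrow> nat pmf" where
  "compound_poisson_pmf r J =
     bind_pmf (poisson_pmf r) (\<lambda>n. map_pmf sum_list (replicate_pmf n J))"

text \<open>
  The rates \<open>t (1 - p)\<^sup>2 p\<^bsup>l-1\<^esup>\<close> (\<open>l \<ge> 1\<close>) have total mass \<open>t (1 - p)\<close>; normalised, they are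
  the law on \<open>{1, 2, \<dots>}\<close> of one plus a geometric variable with success probability \<open>1 - p\<close>.
  The definition is meaningful only for \<open>0 \<le> p < 1\<close> and \<open>t > 0\<close>.
  The moment generating function is computed in \<open>polya_aeppli_mgf\<close>.
\<close>

definition polya_aeppli_pmf :: "real \<Rightarrow> real \<Rightarrow> nat pmf" where
  "polya_aeppli_pmf t p = compound_poisson_pmf (t * (1 - p)) (map_pmf Suc (geometric_pmf (1 - p)))"

lemma nn_integral_replicate_pmf_exp:
  fixes J :: "nat pmf"
  shows "(\<integral>\<^sup>+xs. ennreal (exp (z * real (sum_list xs))) \<partial>replicate_pmf n J)
           = (\<integral>\<^sup>+k. ennreal (exp (z * real k)) \<partial>J) ^ n"
proof (induction n)
  case (Suc n)
  have "(\<integral>\<^sup>+xs. ennreal (exp (z * real (sum_list xs))) \<partial>replicate_pmf (Suc n) J)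
          = (\<integral>\<^sup>+k. \<integral>\<^sup>+xs. ennreal (exp (z * real k)) * ennreal (exp (z * real (sum_list xs)))
              \<partial>replicate_pmf n J \<partial>J)"
    by (simp add: ring_distribs exp_add ennreal_mult)
  then show ?case
    by (simp add: nn_integral_cmult nn_integral_multc Suc)
qed simp

lemma nn_integral_nat_sums:
  fixes f :: "nat \<Rightarrow> real"
  assumes "\<And>n. pmf P n * f n \<ge> 0" "\<And>n. f n \<ge> 0" "(\<lambda>n. pmf P n * f n) sums s"
  shows "(\<integral>\<^sup>+n. ennreal (f n) \<partial>measure_pmf P) = ennreal s"
proof -
  have "(\<integral>\<^sup>+n. ennreal (f n) \<partial>measure_pmf P) = (\<Sum>n. ennreal (pmf P n * f n))"
    by (simp add: nn_integral_measure_pmf nn_integral_count_space_nat ennreal_mult'[symmetric] assms)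
  also have "\<dots> = ennreal s"
    using suminf_ennreal2[OF assms(1) sums_summable[OF assms(3)]] sums_unique[OF assms(3)] by simp
  finally show ?thesis .
qed

lemma polya_aeppli_mgf:
  fixes t p z :: real
  assumes t: "t > 0" and p: "0 \<le> p" "p < 1" and z: "p * exp z < 1"
  shows "integrable (measure_pmf (polya_aeppli_pmf t p)) (\<lambda>k. exp (z * real k))"
    and "measure_pmf.expectation (polya_aeppli_pmf t p) (\<lambda>k. exp (z * real k))
           = exp (\<Sum>l. t * ((1 - p)\<^sup>2 * p ^ l) * (exp (z * real (Suc l)) - 1))"
proof -
  define r where "r = t * (1 - p)"
  define G where "G = (1 - p) * exp z / (1 - p * exp z)"
  have r: "r > 0" and G: "G \<ge> 0"
    using assms by (auto simp: r_def G_def)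
  have exp_Suc: "exp (z * real (Suc l)) = exp z * exp z ^ l" for l
    by (metis exp_of_nat2_mult power_Suc)
  have geo: "(\<lambda>l. (p * exp z) ^ l) sums (1 / (1 - p * exp z))"
    using p z by (intro geometric_sums) auto
  have "(\<lambda>l. (1 - p) * exp z * (p * exp z) ^ l) sums G"
    using sums_mult[OF geo, of "(1 - p) * exp z"] by (simp add: G_def)
  then have "(\<lambda>l. pmf (geometric_pmf (1 - p)) l * exp (z * real (Suc l))) sums G"
    using p by (simp add: exp_Suc power_mult_distrib mult_ac del: of_nat_Suc)
  then have nnJ: "(\<integral>\<^sup>+k. ennreal (exp (z * real k)) \<partial>map_pmf Suc (geometric_pmf (1 - p))) = ennreal G"
    using p by (subst nn_integral_map_pmf, intro nn_integral_nat_sums) auto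
  have "(\<lambda>n. exp (- r) * ((r * G) ^ n /\<^sub>R fact n)) sums (exp (- r) * exp (r * G))"
    by (intro sums_mult exp_converges)
  moreover have "exp (- r) * ((r * G) ^ n /\<^sub>R fact n) = pmf (poisson_pmf r) n * G ^ n" for n
    using r by (simp add: power_mult_distrib divide_inverse mult_ac)
  moreover have "exp (- r) * exp (r * G) = exp (r * (G - 1))"
    by (simp add: exp_add[symmetric] right_diff_distrib)
  ultimately have poi: "(\<lambda>n. pmf (poisson_pmf r) n * G ^ n) sums exp (r * (G - 1))"
    by simp
  have "(\<integral>\<^sup>+k. ennreal (exp (z * real k)) \<partial>polya_aeppli_pmf t p)
          = (\<integral>\<^sup>+n. ennreal (G ^ n) \<partial>poisson_pmf r)"
    using G by (simp add: polya_aeppli_pmf_def compound_poisson_pmf_def nn_integral_replicate_pmf_exp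
        nnJ[simplified] r_def ennreal_power)
  also have "\<dots> = ennreal (exp (r * (G - 1)))"
    using poi G r by (intro nn_integral_nat_sums) auto
  finally have nn: "(\<integral>\<^sup>+k. ennreal (exp (z * real k)) \<partial>polya_aeppli_pmf t p)
                      = ennreal (exp (r * (G - 1)))" .
  show "integrable (measure_pmf (polya_aeppli_pmf t p)) (\<lambda>k. exp (z * real k))"
    by (rule integrableI_nonneg) (auto simp: nn)
  have E: "measure_pmf.expectation (polya_aeppli_pmf t p) (\<lambda>k. exp (z * real k)) = exp (r * (G - 1))"
    by (subst integral_eq_nn_integral) (auto simp: nn)
  have factor: "t * d\<^sup>2 * E * u - t * d\<^sup>2 * (1 / d) = t * d * (d * E * u - 1)" if "d \<noteq> 0" for d E u :: real
    using that by (simp add: power2_eq_square right_diff_distrib)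
  have "(\<lambda>l. t * (1 - p)\<^sup>2 * exp z * (p * exp z) ^ l - t * (1 - p)\<^sup>2 * p ^ l)
          sums (t * (1 - p)\<^sup>2 * exp z * (1 / (1 - p * exp z)) - t * (1 - p)\<^sup>2 * (1 / (1 - p)))"
    using p by (intro sums_diff sums_mult geo geometric_sums) auto
  also have "(\<lambda>l. t * (1 - p)\<^sup>2 * exp z * (p * exp z) ^ l - t * (1 - p)\<^sup>2 * p ^ l)
          = (\<lambda>l. t * ((1 - p)\<^sup>2 * p ^ l) * (exp (z * real (Suc l)) - 1))"
    by (simp add: fun_eq_iff exp_Suc power_mult_distrib right_diff_distrib mult_ac del: of_nat_Suc)
  also have "t * (1 - p)\<^sup>2 * exp z * (1 / (1 - p * exp z)) - t * (1 - p)\<^sup>2 * (1 / (1 - p)) = r * (G - 1)"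
    using p factor[of "1 - p" "exp z" "1 / (1 - p * exp z)"] by (simp add: r_def G_def)
  finally show "measure_pmf.expectation (polya_aeppli_pmf t p) (\<lambda>k. exp (z * real k))
           = exp (\<Sum>l. t * ((1 - p)\<^sup>2 * p ^ l) * (exp (z * real (Suc l)) - 1))"
    using E by (simp add: sums_iff)
qed

end

theory Submission
  imports Defs
begin

text \<open>
  (a) By duality \<open>\<mu>(A\<^bsub>n+m\<^esub>(x))\<close> is the integral of \<open>L\<^sup>m\<close> applied to the indicator of \<open>A\<^bsub>n+m\<^esub>(x)\<close>. Only one
  inverse branch contributes, and along it the product of the \<open>g\<close>-values converges to
  \<open>\<Prod>i<m. g (\<sigma>\<^sup>i x)\<close>, so the integrand is close to this product times the indicator of \<open>A\<^sub>n(x)\<close>.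

  (b) Summable variations and primitivity of \<open>B\<close> make \<open>L\<^sup>k f\<close> converge to \<open>\<integral> f d\<mu>\<close> uniformly over a cone
  of functions of bounded distortion. This yields mixing for cylinders with an error relative to
  their measure. For \<open>s = exp(i \<theta>)\<close> let \<open>\<phi>(r)\<close> be the expectation of \<open>s\<close> to the number of visits
  to \<open>A = A\<^sub>n(x)\<close> before time \<open>r\<close>, and \<open>\<psi>(r)\<close> that of the same power restricted to \<open>A\<close>, counting the
  visits at times \<open>1, \<dots>, r\<close>. Then \<open>\<phi>(r) - \<phi>(r+1) = (1 - s) \<psi>(r)\<close>. A point of \<open>A\<close> either returns at
  time \<open>m\<close>, which renews the situation with relative probability close to \<open>p\<close>, or it stays away from
  \<open>A\<close> for so long that it decorrelates. Hence \<open>\<psi>(r) \<approx> (1 - p) \<mu>(A) \<phi>(r) + s p \<psi>(r)\<close>, and solving the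
  resulting recursion up to time \<open>t / \<mu>(A)\<close> gives \<open>\<phi> \<rightarrow> exp(- t (1 - s) (1 - p) / (1 - s p))\<close>, which is the
  characteristic function of the limit law. Levy's continuity theorem concludes.
\<close>

subsection \<open>Shift spaces\<close>

lemma left_shift_case_nat [simp]: "left_shift (case_nat a z) = z"
  by (simp add: left_shift_def)

lemma case_nat_left_shift [simp]: "case_nat (y 0) (left_shift y) = y"
  by (auto simp: left_shift_def split: nat.split)

lemma funpow_left_shift: "(left_shift ^^ n) y = (\<lambda>i. y (i + n))"
  by (induction n) (auto simp: left_shift_def)

lemma left_shift_funpow_add: "(left_shift ^^ i) ((left_shift ^^ j) y) = (left_shift ^^ (i + j)) y"
  by (simp add: funpow_add)

lemma left_shift_in_subshift: "y \<in> subshift B \<Longrightarrow> left_shift y \<in> subshift B"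
  by (simp add: subshift_def left_shift_def)

lemma funpow_left_shift_in_subshift: "y \<in> subshift B \<Longrightarrow> (left_shift ^^ n) y \<in> subshift B"
  by (simp add: subshift_def funpow_left_shift)

lemma case_nat_in_subshift_iff:
  "case_nat a z \<in> subshift B \<longleftrightarrow> a < dim_row B \<and> B $$ (a, z 0) = 1 \<and> z \<in> subshift B"
proof -
  have "(\<forall>i. P i) \<longleftrightarrow> P 0 \<and> (\<forall>i. P (Suc i))" for P
    using not0_implies_Suc by metis
  from this[of "\<lambda>i. case_nat a z i < dim_row B"] this[of "\<lambda>i. B $$ (case_nat a z i, z i) = 1"]
  show ?thesis
    by (auto simp: subshift_def)
qed

text \<open>Prepending a letter enumerates the inverse branches of the shift, so sums over a fibre
  become finite sums over the alphabet.\<close>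

lemma preimage_subshift:
  "{y \<in> subshift B. left_shift y = z} =
     (\<lambda>a. case_nat a z) ` {a. a < dim_row B \<and> case_nat a z \<in> subshift B}"
  by (auto simp: left_shift_in_subshift image_iff)
     (metis case_nat_left_shift case_nat_in_subshift_iff)

lemma finite_preimage_subshift: "finite {y. y \<in> subshift B \<and> left_shift y = z}"
  by (simp add: preimage_subshift)

lemma mem_cylinder_iff: "y \<in> cylinder B n x \<longleftrightarrow> y \<in> subshift B \<and> (\<forall>i<n. y i = x i)"
  by (simp add: cylinder_def)

lemma cylinder_antimono: "n \<le> k \<Longrightarrow> cylinder B k x \<subseteq> cylinder B n x"
  by (auto simp: cylinder_def)

lemma left_shift_mem_cylinder:
  "y \<in> cylinder B (j + n) x \<Longrightarrow> (left_shift ^^ j) y \<in> cylinder B n ((left_shift ^^ j) x)"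
  by (simp add: cylinder_def funpow_left_shift_in_subshift) (simp add: funpow_left_shift)

section \<open>Measurability and compactness of the subshift\<close>

lemma coordinate_measurable [measurable]:
  "(\<lambda>x::nat \<Rightarrow> nat. x i) \<in> borel \<rightarrow>\<^sub>M count_space UNIV"
proof -
  have "(\<lambda>x::nat \<Rightarrow> nat. x i) \<in> borel \<rightarrow>\<^sub>M borel"
    by (intro borel_measurable_continuous_onI) simp
  then show ?thesis
    using measurable_cong_sets[OF refl sets_borel_eq_count_space] by blast
qed

lemma continuous_on_case_nat: "continuous_on UNIV (\<lambda>z::nat \<Rightarrow> nat. case_nat a z)"
proof (rule continuous_on_coordinatewise_then_product)
  show "continuous_on UNIV (\<lambda>z::nat \<Rightarrow> nat. case_nat a z i)" for i
    by (cases i) auto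
qed

lemma continuous_on_left_shift: "continuous_on UNIV left_shift"
  unfolding left_shift_def by (intro continuous_on_coordinatewise_then_product) simp

lemma case_nat_measurable [measurable]: "(\<lambda>z::nat \<Rightarrow> nat. case_nat a z) \<in> borel \<rightarrow>\<^sub>M borel"
  by (rule borel_measurable_continuous_onI[OF continuous_on_case_nat])

lemma left_shift_measurable_borel: "left_shift \<in> borel \<rightarrow>\<^sub>M borel"
  by (rule borel_measurable_continuous_onI[OF continuous_on_left_shift])

lemma sets_borel_subshift [measurable]: "subshift B \<in> sets borel"
proof -
  have "Measurable.pred borel (\<lambda>x::nat \<Rightarrow> nat. (\<forall>i. x i < dim_row B) \<and> (\<forall>i. B $$ (x i, x (Suc i)) = 1))"
    by measurable
  then show ?thesis
    by (simp add: subshift_def pred_def)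
qed

lemma space_subshift_borel [simp]: "space (subshift_borel B) = subshift B"
  by (simp add: subshift_borel_def space_restrict_space)

lemma sets_cylinder [measurable]: "cylinder B n x \<in> sets (subshift_borel B)"
proof -
  have "Measurable.pred borel (\<lambda>y::nat \<Rightarrow> nat. \<forall>i<n. y i = x i)"
    by measurable
  then have "{y::nat \<Rightarrow> nat. \<forall>i<n. y i = x i} \<in> sets borel"
    by (simp add: pred_def)
  then have "{y::nat \<Rightarrow> nat. \<forall>i<n. y i = x i} \<inter> subshift B \<in> sets (subshift_borel B)"
    by (auto simp: subshift_borel_def sets_restrict_space)
  also have "{y::nat \<Rightarrow> nat. \<forall>i<n. y i = x i} \<inter> subshift B = cylinder B n x"
    by (auto simp: cylinder_def)
  finally show ?thesis .
qed

lemma left_shift_measurable [measurable]: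
  "left_shift \<in> subshift_borel B \<rightarrow>\<^sub>M subshift_borel B"
  unfolding subshift_borel_def
  by (intro measurable_restrict_space3 left_shift_measurable_borel) (auto simp: left_shift_in_subshift)

text \<open>A closed subset of a product of finite sets, compact by Tychonoff. Compactness later
  yields a positive lower bound of \<open>g\<close>.\<close>

lemma compact_subshift: "compact (subshift B)"
proof -
  have "compactin (product_topology (\<lambda>i. euclidean) UNIV) (Pi\<^sub>E UNIV (\<lambda>i::nat. {..<dim_row B}))"
    by (subst compactin_PiE) (auto simp: finite_imp_compact)
  then have "compact (Pi\<^sub>E UNIV (\<lambda>i::nat. {..<dim_row B}))"
    by (simp add: euclidean_product_topology)
  moreover have "open {x::nat \<Rightarrow> nat. B $$ (x i, x (Suc i)) \<noteq> 1}" for i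
  proof -
    have "open ((\<lambda>x::nat \<Rightarrow> nat. x j) -` A)" for j A
      by (intro open_vimage discrete_topology_class.open_discrete continuous_on_product_coordinates)
    then have "open (\<Union>a. (\<lambda>x::nat \<Rightarrow> nat. x i) -` {a} \<inter> (\<lambda>x. x (Suc i)) -` {b. B $$ (a, b) \<noteq> 1})"
      by blast
    also have "(\<Union>a. (\<lambda>x::nat \<Rightarrow> nat. x i) -` {a} \<inter> (\<lambda>x. x (Suc i)) -` {b. B $$ (a, b) \<noteq> 1})
        = {x::nat \<Rightarrow> nat. B $$ (x i, x (Suc i)) \<noteq> 1}"
      by auto
    finally show ?thesis .
  qed
  then have "closed {x::nat \<Rightarrow> nat. \<forall>i. B $$ (x i, x (Suc i)) = 1}"
    by (intro closed_Collect_all) (simp add: closed_def Collect_neg_eq[symmetric])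
  ultimately have "compact (Pi\<^sub>E UNIV (\<lambda>i::nat. {..<dim_row B})
                     \<inter> {x. \<forall>i. B $$ (x i, x (Suc i)) = 1})"
    by (rule compact_Int_closed)
  also have "Pi\<^sub>E UNIV (\<lambda>i::nat. {..<dim_row B}) \<inter> {x. \<forall>i. B $$ (x i, x (Suc i)) = 1} = subshift B"
    by (auto simp: subshift_def PiE_UNIV_domain)
  finally show ?thesis .
qed

section \<open>Continuity, cylinders and variations\<close>

lemma eventually_at_within_subshift_agree:
  "eventually (\<lambda>y. \<forall>i<n. y i = x i) (at x within subshift B)"
proof -
  have "open {y::nat \<Rightarrow> nat. \<forall>i\<in>{..<n}. y i \<in> {x i}}"
    using product_topology_basis'[of "{..<n}" "\<lambda>i. {x i}" "\<lambda>i. i"]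
    by (simp add: discrete_topology_class.open_discrete lessThan_def)
  then have "eventually (\<lambda>y. y \<in> {y::nat \<Rightarrow> nat. \<forall>i\<in>{..<n}. y i \<in> {x i}}) (nhds x)"
    by (intro eventually_nhds_in_open) auto
  then show ?thesis
    unfolding eventually_at_filter by (rule eventually_mono) auto
qed

text \<open>At an isolated point the hypothesis is void, but then a long cylinder around it is a singleton.\<close>

lemma continuous_imp_cylinder:
  fixes g :: "(nat \<Rightarrow> nat) \<Rightarrow> real"
  assumes "(g \<longlongrightarrow> g x) (at x within subshift B)" and e: "e > 0"
  shows "\<exists>n. \<forall>y\<in>cylinder B n x. \<bar>g y - g x\<bar> < e"
proof -
  have "eventually (\<lambda>y. dist (g y) (g x) < e) (at x within subshift B)"
    using assms by (auto simp: tendsto_iff)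
  then obtain U where U: "open U" "x \<in> U" "\<And>y. y \<in> U \<Longrightarrow> y \<noteq> x \<Longrightarrow> y \<in> subshift B \<Longrightarrow> dist (g y) (g x) < e"
    unfolding eventually_at_topological by blast
  have "openin (product_topology (\<lambda>i::nat. euclidean) UNIV) U"
    using U(1) by (simp add: euclidean_product_topology)
  from product_topology_open_contains_basis[OF this U(2)]
  obtain X where X: "x \<in> Pi\<^sub>E UNIV X" "finite {i. X i \<noteq> UNIV}" "Pi\<^sub>E UNIV X \<subseteq> U"
    by auto
  obtain n where n: "\<And>i. X i \<noteq> UNIV \<Longrightarrow> i < n"
    using finite_nat_set_iff_bounded[of "{i. X i \<noteq> UNIV}"] X(2) by auto
  have "\<bar>g y - g x\<bar> < e" if y: "y \<in> cylinder B n x" for y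
  proof (cases "y = x")
    case False
    have "y i \<in> X i" for i
    proof (cases "i < n")
      case True
      then show ?thesis using X(1) y by (auto simp: mem_cylinder_iff PiE_UNIV_domain)
    qed (use n in auto)
    then have "y \<in> U" using X(3) by (auto simp: PiE_UNIV_domain)
    then show ?thesis using U(3)[OF _ False] y by (auto simp: mem_cylinder_iff dist_real_def)
  qed (use e in simp)
  then show ?thesis by blast
qed

lemma abs_diff_le_variation:
  assumes g: "g_function B g" and "y \<in> subshift B" "z \<in> subshift B" "\<And>i. i < k \<Longrightarrow> y i = z i"
  shows "\<bar>g y - g z\<bar> \<le> variation B g k"
  unfolding variation_def
proof (rule cSup_upper)
  \<comment> \<open>The real supremum is informative only for bounded sets; \<open>g\<close> takes
    values in \<open>[0,1]\<close>.\<close>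
  have "\<bar>g y - g z\<bar> \<le> 1" if "y \<in> subshift B" "z \<in> subshift B" for y z
  proof -
    have "0 \<le> g y" "g y \<le> 1" "0 \<le> g z" "g z \<le> 1"
      using g that unfolding g_function_def by blast+
    then show ?thesis by linarith
  qed
  then show "bdd_above {\<bar>g x - g y\<bar> | x y. x \<in> subshift B \<and> y \<in> subshift B \<and> (\<forall>i<k. x i = y i)}"
    by (auto simp: bdd_above_def)
qed (use assms in blast)

lemma variation_null_imp_continuous:
  assumes g: "g_function B g" and v: "variation B g \<longlonglongrightarrow> 0" and x: "x \<in> subshift B"
  shows "(g \<longlongrightarrow> g x) (at x within subshift B)"
proof (rule tendstoI)
  fix e :: real assume "e > 0"
  then obtain k where k: "variation B g k < e"
    using order_tendstoD(2)[OF v, of e] by (auto simp: eventually_sequentially)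
  have "eventually (\<lambda>y. y \<in> subshift B) (at x within subshift B)"
    by (simp add: eventually_at_topological) blast
  with eventually_at_within_subshift_agree[of k x B]
  show "eventually (\<lambda>y. dist (g y) (g x) < e) (at x within subshift B)"
  proof eventually_elim
    case (elim y)
    then show ?case
      using abs_diff_le_variation[OF g _ x, of y k] k by (auto simp: dist_real_def)
  qed
qed

lemma variation_nonneg:
  assumes g: "g_function B g" and x: "x \<in> subshift B"
  shows "variation B g k \<ge> 0"
  using abs_diff_le_variation[OF g x x, of k] by simp

subsection \<open>Primitive matrices\<close>

text \<open>A numerical semigroup of gcd 1 is cofinite: the least positive difference
  \<open>d\<close> of two elements divides every element, hence is 1, and two consecutive elements
  \<open>u\<close>, \<open>u + 1\<close> generate all numbers from \<open>u * u\<close> on.\<close>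

lemma eventually_in_additive_set:
  fixes R :: "nat set"
  assumes add: "\<And>a b. a \<in> R \<Longrightarrow> b \<in> R \<Longrightarrow> a + b \<in> R" and Gcd: "Gcd R = 1"
  shows "\<exists>n0. \<forall>n\<ge>n0. n \<in> R"
proof -
  define P where "P = insert 0 R"
  have addP: "a + b \<in> P" if "a \<in> P" "b \<in> P" for a b
    using that add by (auto simp: P_def)
  have multP: "k * a \<in> P" if "a \<in> P" for k a
    by (induction k) (use that addP in \<open>auto simp: P_def\<close>)
  have "R \<noteq> {}" "R \<noteq> {0}"
    using Gcd by auto
  then obtain c where c: "c \<in> R" "c > 0"
    by (metis bot_nat_0.not_eq_extremum insertI1 is_singletonI is_singletonI' is_singleton_the_elem singletonD)
  define D where "D = {d. d > 0 \<and> (\<exists>u\<in>P. u + d \<in> P)}"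
  have "c \<in> D"
    using c by (auto simp: D_def P_def)
  define d where "d = (LEAST d. d \<in> D)"
  have d: "d \<in> D" and least: "\<And>e. e \<in> D \<Longrightarrow> d \<le> e"
    unfolding d_def using \<open>c \<in> D\<close> by (auto intro: LeastI Least_le)
  then obtain u where u: "d > 0" "u \<in> P" "u + d \<in> P"
    by (auto simp: D_def)
  have "d dvd s" if s: "s \<in> R" for s
  proof (rule ccontr)
    assume "\<not> d dvd s"
    define k r where "k = s div d" and "r = s mod d"
    have r: "r > 0" "r < d" "s = k * d + r"
      using \<open>\<not> d dvd s\<close> u(1) by (auto simp: k_def r_def dvd_eq_mod_eq_0)
    have "s \<in> P"
      using s by (simp add: P_def)
    then have "k * (u + d) \<in> P" "k * u + s \<in> P"
      by (intro multP addP u; assumption)+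
    \<comment> \<open>Both \<open>k * u + s\<close> and \<open>k * (u + d)\<close> are elements, so
      the remainder \<open>r\<close> would be a difference smaller than \<open>d\<close>.\<close>
    moreover have "k * u + s = k * (u + d) + r"
      using r(3) by (simp add: algebra_simps)
    ultimately have "r \<in> D"
      unfolding D_def using r(1) by (auto intro!: bexI[of _ "k * (u + d)"])
    then show False
      using least[of r] r by simp
  qed
  then have "d dvd Gcd R"
    by (rule Gcd_greatest)
  then have "d = 1"
    using Gcd by simp
  show ?thesis
  proof (intro exI allI impI)
    \<comment> \<open>The bound gives a quotient \<open>q \<ge> u > r\<close> on division by
      \<open>u\<close>; the extra 1 makes \<open>n\<close> nonzero, so that membership in
      \<open>P\<close> means membership in \<open>R\<close>.\<close>
    fix n assume n: "u * u + 1 \<le> n"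
    have "n \<in> P"
    proof (cases "u = 0")
      case True
      then show ?thesis
        using multP[of 1 n] u \<open>d = 1\<close> by simp
    next
      case False
      define q r where "q = n div u" and "r = n mod u"
      have "n = q * u + r" "r < u"
        using False by (auto simp: q_def r_def)
      have "u \<le> q"
        using div_le_mono[of "u * u" n u] n False by (simp add: q_def)
      then have "n = (q - r) * u + r * (u + 1)"
        using \<open>n = q * u + r\<close> \<open>r < u\<close> by (simp add: algebra_simps)
      then show ?thesis
        using multP addP u \<open>d = 1\<close> by metis
    qed
    then show "n \<in> R"
      using n by (auto simp: P_def)
  qed
qed

text \<open>Entries are natural numbers, so nothing cancels: an entry of a power is positive exactly
  when some path leads from \<open>i\<close> to \<open>j\<close>.\<close>

lemma pow_mat_Suc_pos_iff:
  fixes B :: "nat mat"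
  assumes "B \<in> carrier_mat M M" "i < M" "j < M"
  shows "(B ^\<^sub>m Suc n) $$ (i, j) > 0 \<longleftrightarrow> (\<exists>c<M. (B ^\<^sub>m n) $$ (i, c) > 0 \<and> B $$ (c, j) > 0)"
proof -
  have "B ^\<^sub>m n \<in> carrier_mat M M"
    using assms by simp
  then have "(B ^\<^sub>m Suc n) $$ (i, j) = (\<Sum>c = 0..<M. (B ^\<^sub>m n) $$ (i, c) * B $$ (c, j))"
    using assms by (auto simp: scalar_prod_def)
  then show ?thesis
    by (auto simp: sum_eq_0_iff simp flip: neq0_conv)
qed

lemma pow_mat_add_pos:
  fixes B :: "nat mat"
  assumes B: "B \<in> carrier_mat M M" and "i < M" "j < M" "k < M"
    and "(B ^\<^sub>m a) $$ (i, j) > 0" "(B ^\<^sub>m b) $$ (j, k) > 0"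
  shows "(B ^\<^sub>m (a + b)) $$ (i, k) > 0"
  using assms(4,6)
proof (induction b arbitrary: k)
  case 0
  then show ?case
    using assms by (auto simp: one_mat_def split: if_splits)
next
  case (Suc b)
  then obtain c where "c < M" "(B ^\<^sub>m b) $$ (j, c) > 0" "B $$ (c, k) > 0"
    using pow_mat_Suc_pos_iff[OF B \<open>j < M\<close> \<open>k < M\<close>] by blast
  then show ?case
    using Suc.IH pow_mat_Suc_pos_iff[OF B \<open>i < M\<close> \<open>k < M\<close>] unfolding add_Suc_right by blast
qed

text \<open>Aperiodicity gives loops at \<open>i\<close> of every large length, irreducibility a
  path from \<open>i\<close> to \<open>j\<close>; loops pad all these paths to one common
  length.\<close>

lemma primitive_mat:
  assumes B: "B \<in> carrier_mat M M" and irr: "irreducible_mat B" and ape: "aperiodic_mat B"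
  shows "\<exists>N. \<forall>i<M. \<forall>j<M. (B ^\<^sub>m N) $$ (i, j) > 0"
proof -
  have dim: "dim_row B = M"
    using B by simp
  have "\<exists>n0. \<forall>n\<ge>n0. (B ^\<^sub>m n) $$ (i, i) > 0" if "i < M" for i
  proof -
    have "\<exists>n0. \<forall>n\<ge>n0. n \<in> {n. n \<ge> 1 \<and> (B ^\<^sub>m n) $$ (i, i) > 0}"
      using ape that dim by (intro eventually_in_additive_set)
        (auto simp: aperiodic_mat_def intro: pow_mat_add_pos[OF B])
    then show ?thesis by auto
  qed
  then obtain l where l: "\<And>i n. i < M \<Longrightarrow> n \<ge> l i \<Longrightarrow> (B ^\<^sub>m n) $$ (i, i) > 0"
    by metis
  obtain k where k: "\<And>i j. i < M \<Longrightarrow> j < M \<Longrightarrow> (B ^\<^sub>m k i j) $$ (i, j) > 0"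
    using irr dim unfolding irreducible_mat_def by metis
  \<comment> \<open>At least \<open>l i + k i j\<close> for every pair, so the
    \<open>N - k i j\<close> steps left over can be spent on a loop at \<open>i\<close>.\<close>
  define N where "N = (\<Sum>i<M. l i) + (\<Sum>i<M. \<Sum>j<M. k i j)"
  have "(B ^\<^sub>m N) $$ (i, j) > 0" if ij: "i < M" "j < M" for i j
  proof -
    have "l i \<le> (\<Sum>i<M. l i)"
      using ij by (intro member_le_sum) auto
    moreover have "k i j \<le> (\<Sum>j<M. k i j)"
      using ij by (intro member_le_sum) auto
    moreover have "(\<Sum>j<M. k i j) \<le> (\<Sum>i<M. \<Sum>j<M. k i j)"
      using ij by (intro member_le_sum[of i "{..<M}" "\<lambda>i. \<Sum>j<M. k i j"]) auto
    ultimately have "l i \<le> N - k i j" "k i j \<le> N"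
      unfolding N_def by linarith+
    then show ?thesis
      using pow_mat_add_pos[OF B ij(1) ij(1) ij(2) l[OF ij(1)] k[OF ij], of "N - k i j"] by simp
  qed
  then show ?thesis by blast
qed

text \<open>The letters of a path from \<open>a\<close> to \<open>z 0\<close> are prepended to
  \<open>z\<close>, the last one first.\<close>

lemma connecting_point:
  assumes B: "B \<in> carrier_mat M M" and B01: "\<forall>i<M. \<forall>j<M. B $$ (i, j) \<in> {0, 1}"
    and "a < M" and z: "z \<in> subshift B" and pos: "(B ^\<^sub>m N) $$ (a, z 0) > 0"
  shows "\<exists>y\<in>subshift B. y 0 = a \<and> (left_shift ^^ N) y = z"
  using z pos
proof (induction N arbitrary: z)
  case 0
  then show ?case
    using \<open>a < M\<close> B by (intro bexI[of _ z]) (auto simp: one_mat_def subshift_def split: if_splits)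
next
  case (Suc N)
  have z0: "z 0 < M"
    using Suc.prems B by (auto simp: subshift_def)
  then obtain c where c: "c < M" "(B ^\<^sub>m N) $$ (a, c) > 0" "B $$ (c, z 0) > 0"
    using Suc.prems pow_mat_Suc_pos_iff[OF B \<open>a < M\<close> z0] by auto
  \<comment> \<open>The subshift asks for the entry 1, which positivity gives only for a matrix of
    zeros and ones.\<close>
  have "B $$ (c, z 0) \<in> {0, 1}"
    using B01 c(1) z0 by blast
  then have "case_nat c z \<in> subshift B"
    using c Suc.prems(1) B by (simp add: case_nat_in_subshift_iff)
  from Suc.IH[OF this] c obtain y where y: "y \<in> subshift B" "y 0 = a" "(left_shift ^^ N) y = case_nat c z"
    by auto
  then show ?case
    by (intro bexI[of _ y]) auto
qed

subsection \<open>The transfer operator\<close>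

locale g_measure_system =
  fixes B :: "nat mat" and g :: "(nat \<Rightarrow> nat) \<Rightarrow> real" and \<mu> :: "(nat \<Rightarrow> nat) measure"
  assumes g_function: "g_function B g" and g_measure: "g_measure B g \<mu>"
begin

abbreviation S :: "(nat \<Rightarrow> nat) set" where "S \<equiv> subshift B"
abbreviation L :: "((nat \<Rightarrow> nat) \<Rightarrow> real) \<Rightarrow> (nat \<Rightarrow> nat) \<Rightarrow> real" where "L \<equiv> transfer_op B g"
abbreviation T :: "(nat \<Rightarrow> nat) \<Rightarrow> nat \<Rightarrow> nat" where "T \<equiv> left_shift"
abbreviation cyl :: "nat \<Rightarrow> (nat \<Rightarrow> nat) \<Rightarrow> (nat \<Rightarrow> nat) set" where "cyl \<equiv> cylinder B"

sublocale prob_space \<mu>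
  using g_measure by (simp add: g_measure_def)

lemma sets_eq [measurable_cong]: "sets \<mu> = sets (subshift_borel B)"
  using g_measure by (simp add: g_measure_def)

lemma space_eq [simp]: "space \<mu> = S"
  using sets_eq_imp_space_eq[OF sets_eq] by simp

lemma measurable_eq: "measurable \<mu> N = measurable (subshift_borel B) N"
  by (rule measurable_cong_sets[OF sets_eq refl])

lemma g_measurable [measurable]: "g \<in> borel_measurable \<mu>"
  using g_function by (simp add: measurable_eq g_function_def)

lemma g_bounds: "y \<in> S \<Longrightarrow> 0 \<le> g y" "y \<in> S \<Longrightarrow> g y \<le> 1"
  using g_function by (auto simp: g_function_def)

lemma g_sum: "z \<in> S \<Longrightarrow> (\<Sum>y | y \<in> S \<and> T y = z. g y) = 1"
  using g_function by (auto simp: g_function_def)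

lemma sets_cyl [measurable]: "cyl n x \<in> sets \<mu>"
  by (simp add: sets_eq sets_cylinder)

lemma T_measurable [measurable]: "T \<in> \<mu> \<rightarrow>\<^sub>M \<mu>"
  by measurable

lemma funpow_T_measurable [measurable]: "(T ^^ n) \<in> \<mu> \<rightarrow>\<^sub>M \<mu>"
  by (induction n) auto

text \<open>An index set independent of \<open>z\<close> gives access to measurability and allows a
  term-by-term comparison at two points.\<close>

lemma transfer_op_eq_sum:
  "L f z = (\<Sum>a<dim_row B. if case_nat a z \<in> S then g (case_nat a z) * f (case_nat a z) else 0)"
proof -
  have "inj_on (\<lambda>a. case_nat a z) X" for X :: "nat set"
    by (rule inj_onI) (metis old.nat.simps(4))
  then have "L f z = (\<Sum>a | a < dim_row B \<and> case_nat a z \<in> S. g (case_nat a z) * f (case_nat a z))"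
    by (simp add: transfer_op_def preimage_subshift sum.reindex)
  also have "\<dots> = (\<Sum>a | a \<in> {..<dim_row B} \<and> case_nat a z \<in> S. g (case_nat a z) * f (case_nat a z))"
    by simp
  also have "\<dots> = (\<Sum>a<dim_row B. if case_nat a z \<in> S then g (case_nat a z) * f (case_nat a z) else 0)"
    by (rule sum.inter_filter) simp
  finally show ?thesis .
qed

lemma transfer_op_measurable [measurable]:
  assumes [measurable]: "f \<in> borel_measurable \<mu>"
  shows "L f \<in> borel_measurable \<mu>"
proof -
  have "(\<lambda>y. g y * f y) \<in> borel_measurable \<mu>"
    by measurable
  then have "(\<lambda>y. g y * f y) \<in> borel_measurable (restrict_space borel S)"
    unfolding measurable_eq subshift_borel_def .
  \<comment> \<open>Extension by zero outside \<open>S\<close> allows composition with the branch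
    \<open>case_nat a\<close>, which is defined on all sequences.\<close>
  then have [measurable]: "(\<lambda>y. indicator S y *\<^sub>R (g y * f y)) \<in> borel_measurable borel"
    by (subst (asm) borel_measurable_restrict_space_iff) simp_all
  have "(\<lambda>z. \<Sum>a<dim_row B. indicator S (case_nat a z) *\<^sub>R (g (case_nat a z) * f (case_nat a z)))
          \<in> borel_measurable borel"
    by (intro borel_measurable_sum measurable_compose[OF case_nat_measurable]) measurable
  also have "(\<lambda>z. \<Sum>a<dim_row B. indicator S (case_nat a z) *\<^sub>R (g (case_nat a z) * f (case_nat a z))) = L f"
    unfolding transfer_op_eq_sum by (intro ext sum.cong) auto
  finally have "L f \<in> borel_measurable (restrict_space borel S)"
    by (rule measurable_restrict_space1)
  then show ?thesis
    unfolding measurable_eq subshift_borel_def .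
qed

lemma funpow_transfer_op_measurable [measurable]:
  "f \<in> borel_measurable \<mu> \<Longrightarrow> (L ^^ n) f \<in> borel_measurable \<mu>"
  by (induction n) auto

section \<open>Positivity and product rule of the transfer operator\<close>

lemma transfer_op_const: "z \<in> S \<Longrightarrow> L (\<lambda>_. c) z = c"
  using g_sum[of z] by (simp add: transfer_op_def flip: sum_distrib_right)

lemma transfer_op_mono:
  assumes "\<And>y. y \<in> S \<Longrightarrow> f y \<le> h y"
  shows "L f z \<le> L h z"
  unfolding transfer_op_def by (intro sum_mono mult_left_mono) (auto simp: assms g_bounds)

lemma transfer_op_cong:
  assumes "\<And>y. y \<in> S \<Longrightarrow> f y = h y"
  shows "L f = L h"
  unfolding transfer_op_def by (intro ext sum.cong) (auto simp: assms)

lemma transfer_op_diff: "L (\<lambda>y. f y - h y) = (\<lambda>z. L f z - L h z)"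
  by (rule ext) (simp add: transfer_op_def right_diff_distrib sum_subtractf)

text \<open>\<open>F (T y)\<close> is constant on the fibres of \<open>T\<close> and leaves the sum.
  Integrated against \<mu>, this is the source of the duality formulas.\<close>

lemma transfer_op_mult: "L (\<lambda>y. f y * F (T y)) = (\<lambda>z. L f z * F z)"
  by (rule ext) (simp add: transfer_op_def sum_distrib_right mult.assoc)

lemma transfer_op_mono_point:
  assumes "y \<in> S" "\<And>y. y \<in> S \<Longrightarrow> f y \<ge> 0"
  shows "g y * f y \<le> L f (T y)"
  unfolding transfer_op_def
  by (rule member_le_sum[of y _ "\<lambda>y. g y * f y"])
     (use assms in \<open>auto simp: finite_preimage_subshift g_bounds\<close>)

lemma funpow_transfer_op_const: "z \<in> S \<Longrightarrow> (L ^^ n) (\<lambda>_. c) z = c"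
proof (induction n arbitrary: z)
  case (Suc n)
  have "L ((L ^^ n) (\<lambda>_. c)) = L (\<lambda>_. c)"
    by (rule transfer_op_cong) (simp add: Suc)
  then show ?case by (simp add: transfer_op_const Suc)
qed simp

lemma funpow_transfer_op_mono:
  assumes "\<And>y. y \<in> S \<Longrightarrow> f y \<le> h y" "z \<in> S"
  shows "(L ^^ n) f z \<le> (L ^^ n) h z"
  using assms(2) by (induction n arbitrary: z) (auto simp: assms intro!: transfer_op_mono)

lemma funpow_transfer_op_diff: "(L ^^ n) (\<lambda>y. f y - h y) = (\<lambda>z. (L ^^ n) f z - (L ^^ n) h z)"
  by (induction n) (auto simp: transfer_op_diff)

lemma funpow_transfer_op_bounds:
  assumes "\<And>y. y \<in> S \<Longrightarrow> c \<le> f y" "\<And>y. y \<in> S \<Longrightarrow> f y \<le> d" "z \<in> S"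
  shows "c \<le> (L ^^ n) f z" "(L ^^ n) f z \<le> d"
  using funpow_transfer_op_mono[of "\<lambda>_. c" f z n] funpow_transfer_op_mono[of f "\<lambda>_. d" z n] assms
  by (simp_all add: funpow_transfer_op_const)

lemma funpow_transfer_op_mult:
  "(L ^^ n) (\<lambda>y. f y * F ((T ^^ n) y)) = (\<lambda>z. (L ^^ n) f z * F z)"
proof (induction n arbitrary: f)
  case (Suc n)
  have "(L ^^ Suc n) (\<lambda>y. f y * F ((T ^^ Suc n) y)) = (L ^^ n) (L (\<lambda>y. f y * (F ((T ^^ n) (T y)))))"
    by (simp add: funpow_swap1)
  also have "L (\<lambda>y. f y * (F ((T ^^ n) (T y)))) = (\<lambda>z. L f z * F ((T ^^ n) z))"
    by (rule transfer_op_mult)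
  also have "(L ^^ n) \<dots> = (\<lambda>z. (L ^^ n) (L f) z * F z)"
    by (rule Suc)
  finally show ?case by (simp add: funpow_swap1)
qed simp

section \<open>Duality and invariance\<close>

lemma integral_transfer_op:
  assumes "f \<in> borel_measurable \<mu>" "\<And>y. y \<in> S \<Longrightarrow> \<bar>f y\<bar> \<le> C"
  shows "(\<integral>z. L f z \<partial>\<mu>) = (\<integral>y. f y \<partial>\<mu>)"
proof -
  have "f \<in> borel_measurable (subshift_borel B)"
    using assms(1) by (simp add: measurable_eq)
  moreover have "bounded (f ` S)"
    using assms(2) by (auto simp: bounded_iff)
  ultimately show ?thesis
    using g_measure by (auto simp: g_measure_def)
qed

lemma integral_funpow_transfer_op:
  assumes [measurable]: "f \<in> borel_measurable \<mu>" and C: "\<And>y. y \<in> S \<Longrightarrow> \<bar>f y\<bar> \<le> C"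
  shows "(\<integral>z. (L ^^ n) f z \<partial>\<mu>) = (\<integral>y. f y \<partial>\<mu>)"
proof (induction n)
  case (Suc n)
  have "\<bar>(L ^^ n) f y\<bar> \<le> C" if "y \<in> S" for y
    using funpow_transfer_op_bounds[of "- C" f C y n] C that by (force simp: abs_le_iff)
  then show ?case
    using Suc by (simp add: integral_transfer_op[of _ C])
qed simp

lemma integrable_bounded:
  fixes f :: "(nat \<Rightarrow> nat) \<Rightarrow> 'b::{banach, second_countable_topology}"
  assumes "f \<in> borel_measurable \<mu>" "\<And>y. y \<in> S \<Longrightarrow> norm (f y) \<le> C"
  shows "integrable \<mu> f"
  by (rule integrable_const_bound[of _ C]) (use assms in auto)

lemma integral_duality:
  fixes f F :: "(nat \<Rightarrow> nat) \<Rightarrow> real"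
  assumes [measurable]: "f \<in> borel_measurable \<mu>" "F \<in> borel_measurable \<mu>"
    and C: "\<And>y. y \<in> S \<Longrightarrow> \<bar>f y\<bar> \<le> C" and D: "\<And>y. y \<in> S \<Longrightarrow> \<bar>F y\<bar> \<le> D"
  shows "(\<integral>y. f y * F ((T ^^ n) y) \<partial>\<mu>) = (\<integral>z. (L ^^ n) f z * F z \<partial>\<mu>)"
proof -
  have "\<bar>f y * F ((T ^^ n) y)\<bar> \<le> C * D" if "y \<in> S" for y
    unfolding abs_mult using C[OF that] D[OF funpow_left_shift_in_subshift[OF that, of n]]
    by (intro mult_mono) auto
  then show ?thesis
    using integral_funpow_transfer_op[of "\<lambda>y. f y * F ((T ^^ n) y)" "C * D" n]
    by (simp add: funpow_transfer_op_mult)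
qed

text \<open>Real and imaginary parts of \<open>F\<close> reduce this to the real formula;
  \<open>f\<close> stays real since \<open>L\<close> acts on real functions.\<close>

lemma integral_duality_complex:
  fixes f :: "(nat \<Rightarrow> nat) \<Rightarrow> real" and F :: "(nat \<Rightarrow> nat) \<Rightarrow> complex"
  assumes [measurable]: "f \<in> borel_measurable \<mu>" "F \<in> borel_measurable \<mu>"
    and C: "\<And>y. y \<in> S \<Longrightarrow> \<bar>f y\<bar> \<le> C" and D: "\<And>y. y \<in> S \<Longrightarrow> norm (F y) \<le> D"
  shows "(\<integral>y. of_real (f y) * F ((T ^^ n) y) \<partial>\<mu>) = (\<integral>z. of_real ((L ^^ n) f z) * F z \<partial>\<mu>)"
proof -
  have Ln: "\<bar>(L ^^ n) f y\<bar> \<le> C" if "y \<in> S" for y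
    using funpow_transfer_op_bounds[of "- C" f C y n] C that by (force simp: abs_le_iff)
  have "norm (of_real (f y) * F ((T ^^ n) y)) \<le> C * D" if "y \<in> S" for y
    unfolding norm_mult norm_of_real using C[OF that] D[OF funpow_left_shift_in_subshift[OF that, of n]]
    by (intro mult_mono) auto
  then have i1: "integrable \<mu> (\<lambda>y. of_real (f y) * F ((T ^^ n) y))"
    by (rule integrable_bounded[rotated]) measurable
  have "norm (of_real ((L ^^ n) f y) * F y) \<le> C * D" if "y \<in> S" for y
    unfolding norm_mult norm_of_real using Ln[OF that] D[OF that] by (intro mult_mono) auto
  then have i2: "integrable \<mu> (\<lambda>z. of_real ((L ^^ n) f z) * F z)"
    by (rule integrable_bounded[rotated]) measurable
  have "\<bar>Re (F y)\<bar> \<le> D" "\<bar>Im (F y)\<bar> \<le> D" if "y \<in> S" for y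
    using abs_Re_le_cmod[of "F y"] abs_Im_le_cmod[of "F y"] D[OF that] by linarith+
  then have "(\<integral>y. f y * Re (F ((T ^^ n) y)) \<partial>\<mu>) = (\<integral>z. (L ^^ n) f z * Re (F z) \<partial>\<mu>)"
    "(\<integral>y. f y * Im (F ((T ^^ n) y)) \<partial>\<mu>) = (\<integral>z. (L ^^ n) f z * Im (F z) \<partial>\<mu>)"
    using C by (intro integral_duality[where C = C and D = D]; simp)+
  then show ?thesis
    using i1 i2 by (intro complex_eqI) (simp_all flip: integral_Re integral_Im)
qed

text \<open>Invariance of \<mu> is duality against the constant 1, which \<open>L\<close>
  fixes.\<close>

lemma integral_shift_complex:
  fixes F :: "(nat \<Rightarrow> nat) \<Rightarrow> complex"
  assumes "F \<in> borel_measurable \<mu>" "\<And>y. y \<in> S \<Longrightarrow> norm (F y) \<le> D"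
  shows "(\<integral>y. F ((T ^^ n) y) \<partial>\<mu>) = (\<integral>y. F y \<partial>\<mu>)"
proof -
  have "(\<integral>z. of_real ((L ^^ n) (\<lambda>_. 1) z) * F z \<partial>\<mu>) = (\<integral>z. F z \<partial>\<mu>)"
    by (rule Bochner_Integration.integral_cong) (auto simp: funpow_transfer_op_const)
  then show ?thesis
    using integral_duality_complex[of "\<lambda>_. 1" F 1 D n] assms by simp
qed

end

subsection \<open>Cylinder ratios at periodic points\<close>

context g_measure_system begin

text \<open>A preimage in the support of \<open>f\<close> must start with \<open>y 0\<close>, so one
  term survives; \<open>n \<ge> 1\<close> fixes the first letter of \<open>z\<close> and makes
  \<open>y 0\<close> admissible before it.\<close>

lemma transfer_op_cylinder:
  assumes y: "y \<in> S" and n: "n \<ge> 1" and supp: "\<And>w. w \<in> S \<Longrightarrow> w \<notin> cyl (Suc n) y \<Longrightarrow> f w = 0"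
    and z: "z \<in> S"
  shows "L f z = (if z \<in> cyl n (T y) then g (case_nat (y 0) z) * f (case_nat (y 0) z) else 0)"
proof (cases "z \<in> cyl n (T y)")
  case True
  have "z 0 = y 1"
    using True n by (auto simp: mem_cylinder_iff left_shift_def)
  then have *: "case_nat (y 0) z \<in> S" "y 0 < dim_row B"
    using y z by (auto simp: case_nat_in_subshift_iff) (auto simp: subshift_def)
  have "L f z = (\<Sum>a<dim_row B. if a = y 0 then g (case_nat (y 0) z) * f (case_nat (y 0) z) else 0)"
    unfolding transfer_op_eq_sum
  proof (intro sum.cong refl)
    fix a
    have "f (case_nat a z) = 0" if "a \<noteq> y 0" "case_nat a z \<in> S"
      using that by (intro supp) (auto simp: mem_cylinder_iff)
    then show "(if case_nat a z \<in> S then g (case_nat a z) * f (case_nat a z) else 0)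
        = (if a = y 0 then g (case_nat (y 0) z) * f (case_nat (y 0) z) else 0)"
      using * by auto
  qed
  then show ?thesis
    using True * by simp
next
  case False
  then have "case_nat a z \<notin> cyl (Suc n) y" for a
    using z by (auto simp: mem_cylinder_iff left_shift_def)
  then show ?thesis
    using False supp by (auto simp: transfer_op_eq_sum intro!: sum.neutral)
qed

lemma case_nat_mem_cylinder:
  assumes y: "y \<in> S" and n: "n \<ge> 1" and z: "z \<in> cyl n (T y)"
  shows "case_nat (y 0) z \<in> cyl (Suc n) y"
proof -
  have "z 0 = y 1"
    using z n by (auto simp: mem_cylinder_iff left_shift_def)
  then show ?thesis
    using y z by (auto simp: case_nat_in_subshift_iff mem_cylinder_iff subshift_def left_shift_def
        split: nat.split)
qed

text \<open>Only one inverse branch of \<open>T ^^ i\<close> contributes to the left-hand side, and \<open>g\<close> is almost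
  constant along it by continuity.\<close>

lemma funpow_transfer_op_cylinder:
  assumes y: "y \<in> S" and cont: "\<And>j. j < i \<Longrightarrow> (g \<longlongrightarrow> g ((T ^^ j) y)) (at ((T ^^ j) y) within S)"
    and e: "e > 0"
  shows "\<exists>n0. \<forall>n\<ge>n0. \<forall>z\<in>S.
    \<bar>(L ^^ i) (indicator (cyl (n + i) y)) z - (\<Prod>j<i. g ((T ^^ j) y)) * indicator (cyl n ((T ^^ i) y)) z\<bar>
      \<le> e * indicator (cyl n ((T ^^ i) y)) z"
  using cont e
proof (induction i arbitrary: e)
  case 0
  then show ?case by simp
next
  case (Suc i)
  define P w where "P = (\<Prod>j<i. g ((T ^^ j) y))" and "w = (T ^^ i) y"
  have w: "w \<in> S"
    using y by (simp add: w_def funpow_left_shift_in_subshift)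
  have P: "0 \<le> P" "P \<le> 1"
    unfolding P_def using y
    by (auto intro!: prod_nonneg prod_le_1 simp: g_bounds funpow_left_shift_in_subshift)
  \<comment> \<open>Half of the tolerance goes to the induction hypothesis, half to the oscillation
    of \<open>g\<close> near \<open>w\<close>.\<close>
  obtain n1 where n1: "\<And>n z. n \<ge> n1 \<Longrightarrow> z \<in> S \<Longrightarrow>
      \<bar>(L ^^ i) (indicator (cyl (n + i) y)) z - P * indicator (cyl n w) z\<bar> \<le> e / 2 * indicator (cyl n w) z"
    using Suc.IH[of "e / 2"] Suc.prems unfolding P_def w_def by auto
  obtain n2 where n2: "\<And>z. z \<in> cyl n2 w \<Longrightarrow> \<bar>g z - g w\<bar> < e / 2"
    using continuous_imp_cylinder[of g w B "e / 2"] Suc.prems by (auto simp: w_def)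
  show ?case
  proof (intro exI allI impI ballI)
    fix n z assume n: "max 1 (max n1 n2) \<le> n" and z: "z \<in> S"
    \<comment> \<open>The hypothesis is used at level \<open>Suc n\<close>, because the last
      application of \<open>L\<close> shortens the cylinder by one letter.\<close>
    define h where "h = (L ^^ i) (indicator (cyl (Suc n + i) y))"
    have h: "\<bar>h v - P * indicator (cyl (Suc n) w) v\<bar> \<le> e / 2 * indicator (cyl (Suc n) w) v"
      if "v \<in> S" for v
      unfolding h_def using n1[of "Suc n" v] n that by simp
    have "h v = 0" if "v \<in> S" "v \<notin> cyl (Suc n) w" for v
      using h[OF that(1)] that(2) by simp
    then have Lh: "L h z = (if z \<in> cyl n (T w) then g (case_nat (w 0) z) * h (case_nat (w 0) z) else 0)"
      using n w z by (intro transfer_op_cylinder) auto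
    have "\<bar>L h z - (P * g w) * indicator (cyl n (T w)) z\<bar> \<le> e * indicator (cyl n (T w)) z"
    proof (cases "z \<in> cyl n (T w)")
      case True
      define v where "v = case_nat (w 0) z"
      have v: "v \<in> cyl (Suc n) w"
        unfolding v_def using True n w by (intro case_nat_mem_cylinder) auto
      then have "v \<in> S" by (simp add: mem_cylinder_iff)
      have 1: "\<bar>h v - P\<bar> \<le> e / 2"
        using h[OF \<open>v \<in> S\<close>] v by simp
      have 2: "\<bar>g v - g w\<bar> \<le> e / 2"
        using n2[of v] v cylinder_antimono[of n2 "Suc n" B w] n by fastforce
      have "\<bar>g v * h v - P * g w\<bar> = \<bar>g v * (h v - P) + P * (g v - g w)\<bar>"
        by (simp add: algebra_simps)
      also have "\<dots> \<le> g v * \<bar>h v - P\<bar> + P * \<bar>g v - g w\<bar>"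
        using abs_triangle_ineq[of "g v * (h v - P)" "P * (g v - g w)"] g_bounds[OF \<open>v \<in> S\<close>] P
        by (simp add: abs_mult)
      also have "\<dots> \<le> 1 * (e / 2) + 1 * (e / 2)"
        using 1 2 P g_bounds[OF \<open>v \<in> S\<close>] by (intro add_mono mult_mono) auto
      finally show ?thesis
        using True Lh by (simp add: v_def)
    qed (use Lh in simp)
    then show "\<bar>(L ^^ Suc i) (indicator (cyl (n + Suc i) y)) z
          - (\<Prod>j<Suc i. g ((T ^^ j) y)) * indicator (cyl n ((T ^^ Suc i) y)) z\<bar>
      \<le> e * indicator (cyl n ((T ^^ Suc i) y)) z"
      by (simp add: h_def P_def w_def)
  qed
qed

lemma cyl_Int_S [simp]: "cyl n x \<inter> S = cyl n x"
  by (auto simp: mem_cylinder_iff)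

lemma integral_funpow_transfer_op_cyl:
  "(\<integral>z. (L ^^ i) (indicator (cyl n x)) z \<partial>\<mu>) = prob (cyl n x)"
  by (subst integral_funpow_transfer_op[of _ 1]) (auto simp: indicator_def)

text \<open>Integration of the pointwise estimate. Its error is a multiple of the indicator of the
  shifted cylinder, so the error here is relative to the measure of that cylinder.\<close>

lemma prob_cylinder_add:
  assumes y: "y \<in> S" and cont: "\<And>j. j < i \<Longrightarrow> (g \<longlongrightarrow> g ((T ^^ j) y)) (at ((T ^^ j) y) within S)"
    and e: "e > 0"
  shows "\<exists>n0. \<forall>n\<ge>n0.
    \<bar>prob (cyl (n + i) y) - (\<Prod>j<i. g ((T ^^ j) y)) * prob (cyl n ((T ^^ i) y))\<bar>
      \<le> e * prob (cyl n ((T ^^ i) y))"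
proof -
  define P where "P = (\<Prod>j<i. g ((T ^^ j) y))"
  obtain n0 where n0: "\<And>n z. n \<ge> n0 \<Longrightarrow> z \<in> S \<Longrightarrow>
     \<bar>(L ^^ i) (indicator (cyl (n + i) y)) z - P * indicator (cyl n ((T ^^ i) y)) z\<bar>
      \<le> e * indicator (cyl n ((T ^^ i) y)) z"
    using funpow_transfer_op_cylinder[OF assms] unfolding P_def by blast
  have "\<bar>prob (cyl (n + i) y) - P * prob (cyl n ((T ^^ i) y))\<bar> \<le> e * prob (cyl n ((T ^^ i) y))"
    if n: "n \<ge> n0" for n
  proof -
    define f :: "(nat \<Rightarrow> nat) \<Rightarrow> real" where "f = (L ^^ i) (indicator (cyl (n + i) y))"
    define h :: "(nat \<Rightarrow> nat) \<Rightarrow> real" where "h = indicator (cyl n ((T ^^ i) y))"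
    have [measurable]: "f \<in> borel_measurable \<mu>" "h \<in> borel_measurable \<mu>"
      unfolding f_def h_def by measurable
    have "\<bar>f z\<bar> \<le> 1" if "z \<in> S" for z
      using funpow_transfer_op_bounds[of 0 "indicator (cyl (n + i) y)" 1 z i] that
      unfolding f_def by (force simp: indicator_def)
    then have [simp]: "integrable \<mu> f"
      by (intro integrable_bounded[of f 1]) auto
    have [simp]: "integrable \<mu> h"
      by (intro integrable_bounded[of h 1]) (auto simp: h_def indicator_def)
    have "\<bar>\<integral>z. f z - P * h z \<partial>\<mu>\<bar> \<le> (\<integral>z. \<bar>f z - P * h z\<bar> \<partial>\<mu>)"
      using integral_norm_bound[of \<mu> "\<lambda>z. f z - P * h z"] by simp
    also have "\<dots> \<le> (\<integral>z. e * h z \<partial>\<mu>)"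
    proof (rule integral_mono)
      show "\<bar>f z - P * h z\<bar> \<le> e * h z" if "z \<in> space \<mu>" for z
        using n0[OF n, of z] that by (simp add: f_def h_def)
    qed simp_all
    finally have "\<bar>(\<integral>z. f z \<partial>\<mu>) - P * (\<integral>z. h z \<partial>\<mu>)\<bar> \<le> e * (\<integral>z. h z \<partial>\<mu>)"
      by simp
    then show ?thesis
      by (simp add: f_def h_def integral_funpow_transfer_op_cyl)
  qed
  then show ?thesis
    unfolding P_def by blast
qed

text \<open>After a full period the shifted cylinder is again one around \<open>x\<close>, so the
  relative estimate can be divided by its positive measure.\<close>

theorem cylinder_ratio_tendsto:
  assumes x: "x \<in> S" and per: "(T ^^ m) x = x" and pos: "\<And>n. prob (cyl n x) > 0"
    and cont: "\<And>j. j < m \<Longrightarrow> (g \<longlongrightarrow> g ((T ^^ j) x)) (at ((T ^^ j) x) within S)"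
  shows "cylinder_ratio B \<mu> x m \<longlonglongrightarrow> (\<Prod>j<m. g ((T ^^ j) x))"
proof (rule LIMSEQ_I)
  fix e :: real assume e: "e > 0"
  define P where "P = (\<Prod>j<m. g ((T ^^ j) x))"
  obtain n0 where n0: "\<And>n. n \<ge> n0 \<Longrightarrow> \<bar>prob (cyl (n + m) x) - P * prob (cyl n x)\<bar> \<le> e / 2 * prob (cyl n x)"
    using prob_cylinder_add[OF x cont, of m "e / 2"] e per unfolding P_def by auto
  show "\<exists>no. \<forall>n\<ge>no. norm (cylinder_ratio B \<mu> x m n - (\<Prod>j<m. g ((T ^^ j) x))) < e"
  proof (intro exI allI impI)
    fix n assume "n \<ge> n0"
    have "cylinder_ratio B \<mu> x m n - P = (prob (cyl (n + m) x) - P * prob (cyl n x)) / prob (cyl n x)"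
      using pos[of n] by (simp add: cylinder_ratio_def field_simps)
    then have "\<bar>cylinder_ratio B \<mu> x m n - P\<bar> \<le> e / 2"
      using n0[OF \<open>n \<ge> n0\<close>] pos[of n] by (simp add: abs_divide divide_le_eq)
    then show "norm (cylinder_ratio B \<mu> x m n - (\<Prod>j<m. g ((T ^^ j) x))) < e"
      using e by (simp add: P_def)
  qed
qed

end

subsection \<open>Bounded distortion and mixing\<close>

text \<open>The form in which (b) uses its assumptions: \<delta> comes from compactness and
  \<open>g > 0\<close>, the connecting time \<open>N\<close> from primitivity of
  \<open>B\<close>.\<close>

locale mixing_g_system = g_measure_system +
  fixes \<delta> :: real and N :: nat
  assumes \<delta>_pos: "\<delta> > 0" and g_ge: "\<And>y. y \<in> S \<Longrightarrow> \<delta> \<le> g y"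
    and summable_variation: "summable (variation B g)"
    and connecting: "\<And>a z. a < dim_row B \<Longrightarrow> z \<in> S \<Longrightarrow> \<exists>y\<in>S. y 0 = a \<and> (T ^^ N) y = z"
begin

text \<open>Bounds the logarithmic change of products of \<open>g\<close> along two parallel inverse
  branches ending in points that agree on \<open>k\<close> letters. The first prepended letter
  already yields agreement on \<open>Suc k\<close> letters; dividing by \<delta> turns differences
  of \<open>g\<close> into differences of logarithms.\<close>

definition distortion :: "nat \<Rightarrow> real" where
  "distortion k = (\<Sum>i. variation B g (i + Suc k)) / \<delta>"

text \<open>The functions in \<open>cone 0\<close> have locally bounded distortion; they form a cone that is
  preserved by the transfer operator. Indicators of \<open>n\<close>-cylinders enter it after \<open>n\<close> steps.\<close>

definition cone :: "nat \<Rightarrow> ((nat \<Rightarrow> nat) \<Rightarrow> real) \<Rightarrow> bool" where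
  "cone n f \<longleftrightarrow> (\<forall>z\<in>S. 0 \<le> f z) \<and>
     (\<forall>k>n. \<forall>z\<in>S. \<forall>z'\<in>S. (\<forall>i<k. z i = z' i) \<longrightarrow> f z \<le> exp (distortion k) * f z')"

lemma funpow_add_apply: "(L ^^ (a + b)) f = (L ^^ a) ((L ^^ b) f)"
  by (simp add: funpow_add)

lemma prob_S [simp]: "prob S = 1"
  using prob_space by simp

lemma S_nonempty: "\<exists>z. z \<in> S"
  using not_empty by auto

lemma \<delta>_le_1: "\<delta> \<le> 1"
  using S_nonempty g_ge g_bounds by fastforce

lemma variation_ge_0: "variation B g k \<ge> 0"
  using S_nonempty variation_nonneg[OF g_function] by blast

lemma distortion_Suc: "distortion k = variation B g (Suc k) / \<delta> + distortion (Suc k)"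
proof -
  have "summable (\<lambda>i. variation B g (i + Suc k))"
    using summable_variation by (rule summable_ignore_initial_segment)
  from suminf_split_head[OF this] show ?thesis
    by (simp add: distortion_def add_divide_distrib[symmetric])
qed

lemma distortion_nonneg: "distortion k \<ge> 0"
  unfolding distortion_def using \<delta>_pos
  by (intro divide_nonneg_pos suminf_nonneg summable_ignore_initial_segment summable_variation variation_ge_0)

lemma distortion_tendsto_0: "distortion \<longlonglongrightarrow> 0"
proof (rule LIMSEQ_I)
  fix r :: real assume "r > 0"
  then obtain k0 where k0: "\<And>k. k \<ge> k0 \<Longrightarrow> norm (\<Sum>i. variation B g (i + k)) < r * \<delta>"
    using suminf_exist_split[OF _ summable_variation, of "r * \<delta>"] \<delta>_pos by auto
  show "\<exists>no. \<forall>k\<ge>no. norm (distortion k - 0) < r"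
  proof (intro exI allI impI)
    fix k assume "k \<ge> k0"
    then show "norm (distortion k - 0) < r"
      using k0[of "Suc k"] \<delta>_pos by (simp add: distortion_def divide_less_eq)
  qed
qed

text \<open>Since \<open>g y' \<ge> \<delta>\<close>, the additive error is at most
  \<open>variation B g k / \<delta>\<close> times \<open>g y'\<close>, and
  \<open>1 + c \<le> exp c\<close>.\<close>

lemma g_distortion:
  assumes "y \<in> S" "y' \<in> S" "\<And>i. i < k \<Longrightarrow> y i = y' i"
  shows "g y \<le> exp (variation B g k / \<delta>) * g y'"
proof -
  have "g y \<le> g y' + variation B g k"
    using abs_diff_le_variation[OF g_function assms, of k] by simp
  also have "variation B g k \<le> variation B g k / \<delta> * g y'"
    using mult_left_mono[OF g_ge[OF assms(2)] variation_ge_0[of k]] \<delta>_pos by (simp add: field_simps)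
  also have "g y' + variation B g k / \<delta> * g y' = (1 + variation B g k / \<delta>) * g y'"
    by (simp add: algebra_simps)
  also have "\<dots> \<le> exp (variation B g k / \<delta>) * g y'"
    using assms(2) by (intro mult_right_mono exp_ge_add_one_self) (simp add: g_bounds)
  finally show ?thesis by simp
qed

lemma cone_nonneg: "cone n f \<Longrightarrow> z \<in> S \<Longrightarrow> 0 \<le> f z"
  by (simp add: cone_def)

lemma coneD:
  "cone n f \<Longrightarrow> n < k \<Longrightarrow> z \<in> S \<Longrightarrow> z' \<in> S \<Longrightarrow> (\<And>i. i < k \<Longrightarrow> z i = z' i) \<Longrightarrow>
     f z \<le> exp (distortion k) * f z'"
  by (simp add: cone_def)

lemma cone_mono: "cone n f \<Longrightarrow> n \<le> n' \<Longrightarrow> cone n' f"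
  by (auto simp: cone_def)

text \<open>Prepending one letter to both points lengthens their agreement by one. The exponent
  \<open>distortion (Suc k)\<close> of \<open>f\<close> and the variation of \<open>g\<close> add up
  to \<open>distortion k\<close> by \<open>distortion_Suc\<close>.\<close>

lemma cone_transfer_op:
  assumes f: "cone (Suc n) f"
  shows "cone n (L f)"
  unfolding cone_def
proof (intro conjI ballI allI impI)
  show "0 \<le> L f z" for z
    unfolding transfer_op_def using f by (intro sum_nonneg) (auto simp: cone_nonneg g_bounds)
  fix k z z' assume k: "n < k" and z: "z \<in> S" "z' \<in> S" and eq: "\<forall>i<k. z i = z' i"
  \<comment> \<open>As \<open>k > 0\<close>, the first letters agree, so the same letters may be
    prepended to both points.\<close>
  have z0: "z 0 = z' 0"
    using eq k by auto
  have "L f z = (\<Sum>a<dim_row B. if case_nat a z \<in> S then g (case_nat a z) * f (case_nat a z) else 0)"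
    by (rule transfer_op_eq_sum)
  also have "\<dots> \<le> (\<Sum>a<dim_row B. exp (distortion k) *
      (if case_nat a z' \<in> S then g (case_nat a z') * f (case_nat a z') else 0))"
  proof (rule sum_mono)
    fix a
    show "(if case_nat a z \<in> S then g (case_nat a z) * f (case_nat a z) else 0) \<le>
      exp (distortion k) * (if case_nat a z' \<in> S then g (case_nat a z') * f (case_nat a z') else 0)"
    proof (cases "case_nat a z \<in> S")
      case True
      then have S': "case_nat a z' \<in> S"
        using z z0 by (simp add: case_nat_in_subshift_iff)
      have eq': "case_nat a z i = case_nat a z' i" if "i < Suc k" for i
        using that eq by (auto split: nat.split)
      have "g (case_nat a z) * f (case_nat a z) \<le>
        (exp (variation B g (Suc k) / \<delta>) * g (case_nat a z')) * (exp (distortion (Suc k)) * f (case_nat a z'))"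
        using True S' f k eq'
        by (intro mult_mono g_distortion coneD[OF f]) (auto simp: cone_nonneg g_bounds)
      also have "\<dots> = exp (distortion k) * (g (case_nat a z') * f (case_nat a z'))"
        by (simp add: distortion_Suc[of k] exp_add)
      finally show ?thesis
        using True S' by simp
    next
      case False
      moreover have "case_nat a z' \<notin> S"
        using False z z0 by (simp add: case_nat_in_subshift_iff)
      ultimately show ?thesis by simp
    qed
  qed
  also have "\<dots> = exp (distortion k) * L f z'"
    by (simp add: transfer_op_eq_sum sum_distrib_left)
  finally show "L f z \<le> exp (distortion k) * L f z'" .
qed

lemma cone_funpow_transfer_op: "cone n f \<Longrightarrow> cone 0 ((L ^^ n) f)"
  by (induction n arbitrary: f) (simp_all add: funpow_swap1 cone_transfer_op)

lemma cone_0_funpow_transfer_op: "cone 0 f \<Longrightarrow> cone 0 ((L ^^ k) f)"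
proof (induction k)
  case (Suc k)
  then have "cone (Suc 0) ((L ^^ k) f)"
    by (auto elim: cone_mono)
  then show ?case
    by (simp add: cone_transfer_op)
qed simp

lemma cone_indicator_cyl: "cone n (indicator (cyl n x))"
  unfolding cone_def
proof (intro conjI ballI allI impI)
  fix k z z' assume k: "n < k" and z: "z \<in> S" "z' \<in> S" and eq: "\<forall>i<k. z i = z' i"
  then have "z \<in> cyl n x \<longleftrightarrow> z' \<in> cyl n x"
    by (auto simp: mem_cylinder_iff)
  then show "indicator (cyl n x) z \<le> exp (distortion k) * (indicator (cyl n x) z' :: real)"
    using distortion_nonneg[of k] by (simp add: indicator_def)
qed simp

text \<open>Only the branch through \<open>y\<close> is kept; each of its \<open>n\<close> weights
  is at least \<delta>.\<close>

lemma funpow_transfer_op_lower: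
  assumes y: "y \<in> S" and f: "\<And>z. z \<in> S \<Longrightarrow> 0 \<le> f z"
  shows "\<delta> ^ n * f y \<le> (L ^^ n) f ((T ^^ n) y)"
proof (induction n)
  case (Suc n)
  let ?y = "(T ^^ n) y"
  have y': "?y \<in> S"
    using y by (rule funpow_left_shift_in_subshift)
  have nonneg: "0 \<le> (L ^^ n) f z" if "z \<in> S" for z
    using funpow_transfer_op_mono[of "\<lambda>_. 0" f z n] f that by (simp add: funpow_transfer_op_const)
  have "\<delta> ^ Suc n * f y \<le> \<delta> * (L ^^ n) f ?y"
    using Suc \<delta>_pos by simp
  also have "\<dots> \<le> g ?y * (L ^^ n) f ?y"
    using y' by (intro mult_right_mono g_ge nonneg)
  also have "\<dots> \<le> L ((L ^^ n) f) (T ?y)"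
    using y' nonneg by (intro transfer_op_mono_point)
  finally show ?case by simp
qed simp

text \<open>Preimages of any \<open>z\<close> come arbitrarily close to any \<open>y\<close>: the
  connecting path starts only after the letters of \<open>y\<close> to be kept.\<close>

lemma connecting_prefix:
  assumes "y \<in> S" "z \<in> S"
  shows "\<exists>y'\<in>S. (\<forall>i\<le>j. y' i = y i) \<and> (T ^^ (N + j)) y' = z"
  using assms(1)
proof (induction j arbitrary: y)
  case 0
  then have "y 0 < dim_row B"
    by (simp add: subshift_def)
  then show ?case
    using connecting[of "y 0" z] assms by auto
next
  case (Suc j)
  from Suc.IH[OF left_shift_in_subshift[OF Suc.prems]] obtain y' where
    y': "y' \<in> S" "\<And>i. i \<le> j \<Longrightarrow> y' i = y (Suc i)" "(T ^^ (N + j)) y' = z"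
    unfolding left_shift_def[of y] by blast
  then have "case_nat (y 0) y' \<in> S"
    unfolding case_nat_in_subshift_iff using Suc.prems y'(2)[of 0] by (auto simp: subshift_def)
  moreover have "\<forall>i\<le>Suc j. case_nat (y 0) y' i = y i"
    using y'(2) by (auto split: nat.split)
  moreover have "(T ^^ (N + Suc j)) (case_nat (y 0) y') = z"
    using y'(3) by (simp add: funpow_swap1)
  ultimately show ?case by blast
qed

text \<open>A Harnack constant: functions in \<open>cone 0\<close> are bounded by this multiple of
  their integral.\<close>

definition sup_const :: real where "sup_const = exp (distortion 1) / \<delta> ^ N"

lemma sup_const_pos: "sup_const > 0"
  using \<delta>_pos by (simp add: sup_const_def)

text \<open>Some \<open>N\<close>-fold preimage of \<open>z\<close> shares its first letter with
  \<open>y\<close>. The cone condition compares \<open>f\<close> at these two points, and the branch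
  weighs at least \<open>\<delta> ^ N\<close>.\<close>

lemma cone_le_transfer_op:
  assumes f: "cone 0 f" and "y \<in> S" "z \<in> S"
  shows "f y \<le> sup_const * (L ^^ N) f z"
proof -
  obtain y' where y': "y' \<in> S" "y' 0 = y 0" "(T ^^ N) y' = z"
    using connecting_prefix[of y z 0] assms by auto
  have "f y \<le> exp (distortion 1) * f y'"
    using y' assms by (intro coneD[OF f]) auto
  also have "f y' \<le> (L ^^ N) f z / \<delta> ^ N"
    using funpow_transfer_op_lower[OF y'(1), of f N] cone_nonneg[OF f] y'(3) \<delta>_pos
    by (simp add: field_simps)
  finally show ?thesis
    by (simp add: sup_const_def)
qed

lemma cone_bounded:
  assumes f: "cone 0 f"
  obtains C where "\<And>y. y \<in> S \<Longrightarrow> \<bar>f y\<bar> \<le> C"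
proof -
  obtain z where "z \<in> S"
    using S_nonempty by blast
  then show thesis
    using cone_le_transfer_op[OF f] cone_nonneg[OF f] that[of "sup_const * (L ^^ N) f z"] by simp
qed

lemma cone_integrable: "cone 0 f \<Longrightarrow> f \<in> borel_measurable \<mu> \<Longrightarrow> integrable \<mu> f"
  by (erule cone_bounded) (rule integrable_bounded; simp)

lemma cone_integral_funpow:
  assumes f: "cone 0 f" and [measurable]: "f \<in> borel_measurable \<mu>"
  shows "(\<integral>z. (L ^^ n) f z \<partial>\<mu>) = (\<integral>z. f z \<partial>\<mu>)"
proof -
  obtain C where "\<And>y. y \<in> S \<Longrightarrow> \<bar>f y\<bar> \<le> C"
    by (rule cone_bounded[OF f]) blast
  then show ?thesis
    by (intro integral_funpow_transfer_op) auto
qed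

lemma cone_integral_nonneg: "cone 0 f \<Longrightarrow> 0 \<le> (\<integral>z. f z \<partial>\<mu>)"
  by (intro Bochner_Integration.integral_nonneg_AE) (auto simp: cone_nonneg)

text \<open>\<open>cone_le_transfer_op\<close> is integrated over \<open>z\<close>, and invariance
  removes \<open>L ^^ N\<close>.\<close>

lemma cone_le_integral:
  assumes f: "cone 0 f" and [measurable]: "f \<in> borel_measurable \<mu>" and y: "y \<in> S"
  shows "f y \<le> sup_const * (\<integral>z. f z \<partial>\<mu>)"
proof -
  have "(\<integral>z. f y \<partial>\<mu>) \<le> (\<integral>z. sup_const * (L ^^ N) f z \<partial>\<mu>)"
    by (intro integral_mono integrable_const integrable_mult_right cone_integrable
          cone_0_funpow_transfer_op f)
       (use cone_le_transfer_op[OF f y] in auto)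
  then show ?thesis
    using f by (simp add: cone_integral_funpow)
qed

text \<open>A Doeblin argument. If \<open>f\<close> somewhere takes a value in the lower half of its
  range, every \<open>z\<close> has a preimage of weight at least \<open>\<delta> ^ (N + j)\<close>
  where \<open>f\<close> is almost as low, which pulls the upper bound down. Otherwise the lower
  bound rises to the middle of the range.\<close>

lemma oscillation_step:
  assumes f: "cone 0 f" and fI: "\<And>y. y \<in> S \<Longrightarrow> f y \<le> sup_const * I"
    and j: "(exp (distortion (Suc j)) - 1) * sup_const \<le> \<epsilon>" and I: "I \<ge> 0"
    and osc: "\<And>y. y \<in> S \<Longrightarrow> lo \<le> f y" "\<And>y. y \<in> S \<Longrightarrow> f y \<le> lo + \<omega>"
  shows "\<exists>lo'. \<forall>z\<in>S. lo' \<le> (L ^^ (N + j)) f z \<and>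
      (L ^^ (N + j)) f z \<le> lo' + ((1 - \<delta> ^ (N + j) / 2) * \<omega> + \<delta> ^ (N + j) * \<epsilon> * I)"
proof -
  define \<eta> where "\<eta> = \<delta> ^ (N + j)"
  have \<eta>: "0 < \<eta>" "\<eta> \<le> 1"
    using \<delta>_pos \<delta>_le_1 by (auto simp: \<eta>_def power_le_one)
  have \<omega>: "\<omega> \<ge> 0"
    using S_nonempty osc by fastforce
  have "0 \<le> (exp (distortion (Suc j)) - 1) * sup_const"
    using distortion_nonneg sup_const_pos by simp
  then have \<epsilon>: "\<epsilon> \<ge> 0" using j by linarith
  show ?thesis
  proof (cases "\<exists>y\<in>S. f y \<le> lo + \<omega> / 2")
    case True
    then obtain y where y: "y \<in> S" "f y \<le> lo + \<omega> / 2" by blast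
    have "(L ^^ (N + j)) f z \<le> lo + ((1 - \<eta> / 2) * \<omega> + \<eta> * \<epsilon> * I)" if z: "z \<in> S" for z
    proof -
      obtain y' where y': "y' \<in> S" "\<And>i. i \<le> j \<Longrightarrow> y' i = y i" "(T ^^ (N + j)) y' = z"
        using connecting_prefix[OF y(1) z, of j] by blast
      have "f y' \<le> exp (distortion (Suc j)) * f y"
        using y y' by (intro coneD[OF f]) auto
      also have "\<dots> = f y + (exp (distortion (Suc j)) - 1) * f y"
        by (simp add: algebra_simps)
      \<comment> \<open>The distortion error is proportional to \<open>f y\<close>; the bound
        \<open>fI\<close> makes it a multiple of \<open>I\<close>.\<close>
      also have "\<dots> \<le> f y + (exp (distortion (Suc j)) - 1) * (sup_const * I)"
        using fI[OF y(1)] distortion_nonneg by (intro add_left_mono mult_left_mono) auto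
      also have "\<dots> \<le> lo + \<omega> / 2 + \<epsilon> * I"
        using y(2) mult_right_mono[OF j I] by (simp add: mult_ac)
      finally have 1: "\<eta> * (\<omega> / 2 - \<epsilon> * I) \<le> \<eta> * (lo + \<omega> - f y')"
        using \<eta> by (intro mult_left_mono) auto
      have "\<eta> * (lo + \<omega> - f y') \<le> (L ^^ (N + j)) (\<lambda>y. lo + \<omega> - f y) z"
        using funpow_transfer_op_lower[OF y'(1), of "\<lambda>y. lo + \<omega> - f y" "N + j"] osc y'(3)
        by (simp add: \<eta>_def)
      also have "\<dots> = lo + \<omega> - (L ^^ (N + j)) f z"
        using z funpow_transfer_op_const[OF z, of "N + j" "lo + \<omega>"]
        by (subst funpow_transfer_op_diff) simp
      finally show ?thesis
        using 1 by (simp add: algebra_simps)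
    qed
    moreover have "lo \<le> (L ^^ (N + j)) f z" if "z \<in> S" for z
      using funpow_transfer_op_bounds(1)[of lo f _ z "N + j"] osc that by blast
    ultimately show ?thesis
      by (auto simp: \<eta>_def)
  next
    case False
    have "lo + \<omega> / 2 \<le> (L ^^ (N + j)) f z \<and> (L ^^ (N + j)) f z \<le> lo + \<omega>" if "z \<in> S" for z
    proof -
      have "lo + \<omega> / 2 \<le> f y" if "y \<in> S" for y
        using False that by (meson linear)
      then show ?thesis
        using funpow_transfer_op_bounds[of "lo + \<omega> / 2" f "lo + \<omega>" z "N + j"] osc(2) that by blast
    qed
    \<comment> \<open>The range has halved here, which is at least as good as the factor
      \<open>1 - \<eta> / 2\<close> because \<open>\<eta> \<le> 1\<close>.\<close>
    moreover have "lo + \<omega> \<le> lo + \<omega> / 2 + ((1 - \<eta> / 2) * \<omega> + \<eta> * \<epsilon> * I)"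
    proof -
      have "0 \<le> (1 - \<eta>) * \<omega> / 2" "0 \<le> \<eta> * \<epsilon> * I"
        using \<eta> \<omega> \<epsilon> I by auto
      then show ?thesis
        by (simp add: field_simps)
    qed
    ultimately show ?thesis
      unfolding \<eta>_def by (intro exI[of _ "lo + \<omega> / 2"] ballI conjI) (meson order_trans)+
  qed
qed

text \<open>\<open>2 * \<epsilon> * I\<close> is the fixed point of the map \<open>\<omega>
  \<mapsto> (1 - \<eta> / 2) * \<omega> + \<eta> * \<epsilon> * I\<close> of
  \<open>oscillation_step\<close>, with \<open>\<eta> = \<delta> ^ (N + j)\<close>; the distance to
  it shrinks geometrically from the initial range \<open>[0, sup_const * I]\<close>.\<close>

lemma oscillation_iterate:
  assumes f: "cone 0 f" and [measurable]: "f \<in> borel_measurable \<mu>"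
    and j: "(exp (distortion (Suc j)) - 1) * sup_const \<le> \<epsilon>"
  defines "I \<equiv> (\<integral>z. f z \<partial>\<mu>)"
  shows "\<exists>lo. \<forall>z\<in>S. lo \<le> (L ^^ (i * (N + j))) f z \<and>
      (L ^^ (i * (N + j))) f z \<le> lo + ((1 - \<delta> ^ (N + j) / 2) ^ i * sup_const * I + 2 * \<epsilon> * I)"
proof (induction i)
  case 0
  have "0 \<le> (exp (distortion (Suc j)) - 1) * sup_const"
    using distortion_nonneg sup_const_pos by simp
  then have "\<epsilon> \<ge> 0" using j by linarith
  then have "0 \<le> \<epsilon> * I"
    using cone_integral_nonneg[OF f] by (simp add: I_def)
  then show ?case
    using cone_le_integral[OF f] cone_nonneg[OF f] by (intro exI[of _ 0]) (force simp: I_def)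
next
  case (Suc i)
  let ?h = "(L ^^ (i * (N + j))) f"
  define \<omega> where "\<omega> = (1 - \<delta> ^ (N + j) / 2) ^ i * sup_const * I + 2 * \<epsilon> * I"
  obtain lo where lo: "\<And>z. z \<in> S \<Longrightarrow> lo \<le> ?h z" "\<And>z. z \<in> S \<Longrightarrow> ?h z \<le> lo + \<omega>"
    using Suc unfolding \<omega>_def by blast
  have h: "cone 0 ?h"
    by (rule cone_0_funpow_transfer_op[OF f])
  have hI: "?h y \<le> sup_const * I" if "y \<in> S" for y
    using cone_le_integral[OF h _ that] f by (simp add: cone_integral_funpow I_def)
  obtain lo' where lo': "\<And>z. z \<in> S \<Longrightarrow> lo' \<le> (L ^^ (N + j)) ?h z \<and>
      (L ^^ (N + j)) ?h z \<le> lo' + ((1 - \<delta> ^ (N + j) / 2) * \<omega> + \<delta> ^ (N + j) * \<epsilon> * I)"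
    using oscillation_step[OF h hI j _ lo] cone_integral_nonneg[OF f] unfolding I_def by blast
  have "(L ^^ (N + j)) ?h = (L ^^ (Suc i * (N + j))) f"
    by (simp add: funpow_add)
  moreover have "(1 - \<delta> ^ (N + j) / 2) * \<omega> + \<delta> ^ (N + j) * \<epsilon> * I =
      (1 - \<delta> ^ (N + j) / 2) ^ Suc i * sup_const * I + 2 * \<epsilon> * I"
    by (simp add: \<omega>_def algebra_simps)
  ultimately show ?case
    using lo' by (intro exI[of _ lo']) auto
qed

theorem uniform_mixing:
  assumes \<epsilon>: "\<epsilon> > 0"
  shows "\<exists>K. \<forall>k\<ge>K. \<forall>f. cone 0 f \<longrightarrow> f \<in> borel_measurable \<mu> \<longrightarrow>
    (\<forall>z\<in>S. \<bar>(L ^^ k) f z - (\<integral>y. f y \<partial>\<mu>)\<bar> \<le> \<epsilon> * (\<integral>y. f y \<partial>\<mu>))"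
proof -
  have "(\<lambda>j. (exp (distortion (Suc j)) - 1) * sup_const) \<longlonglongrightarrow> (exp 0 - 1) * sup_const"
    by (intro tendsto_mult tendsto_diff tendsto_exp tendsto_const LIMSEQ_Suc[OF distortion_tendsto_0])
  then have "eventually (\<lambda>j. (exp (distortion (Suc j)) - 1) * sup_const < \<epsilon> / 4) sequentially"
    using \<epsilon> by (intro order_tendstoD(2)) auto
  \<comment> \<open>The fixed point then equals half of the target \<open>\<epsilon> * I\<close>;
    the choice of \<open>i\<close> below takes care of the other half. Neither choice depends on
    \<open>f\<close>.\<close>
  then obtain j where j: "(exp (distortion (Suc j)) - 1) * sup_const \<le> \<epsilon> / 4"
    by (auto simp: eventually_sequentially intro: less_imp_le)
  define \<eta> where "\<eta> = \<delta> ^ (N + j)"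
  have \<eta>: "0 < \<eta>" "\<eta> \<le> 1"
    using \<delta>_pos \<delta>_le_1 by (auto simp: \<eta>_def power_le_one)
  have "(\<lambda>i. (1 - \<eta> / 2) ^ i * sup_const) \<longlonglongrightarrow> 0 * sup_const"
    using \<eta> by (intro tendsto_mult LIMSEQ_realpow_zero tendsto_const) auto
  then have "eventually (\<lambda>i. (1 - \<eta> / 2) ^ i * sup_const < \<epsilon> / 2) sequentially"
    using \<epsilon> by (intro order_tendstoD(2)) auto
  then obtain i where i: "(1 - \<eta> / 2) ^ i * sup_const \<le> \<epsilon> / 2"
    by (auto simp: eventually_sequentially intro: less_imp_le)
  show ?thesis
  proof (intro exI allI impI ballI)
    fix k f z assume k: "i * (N + j) \<le> k" and f: "cone 0 f" and [measurable]: "f \<in> borel_measurable \<mu>"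
      and z: "z \<in> S"
    define I where "I = (\<integral>y. f y \<partial>\<mu>)"
    have I: "I \<ge> 0"
      using cone_integral_nonneg[OF f] by (simp add: I_def)
    define \<omega> where "\<omega> = (1 - \<eta> / 2) ^ i * sup_const * I + 2 * (\<epsilon> / 4) * I"
    obtain lo where lo: "\<And>z. z \<in> S \<Longrightarrow> lo \<le> (L ^^ (i * (N + j))) f z"
      "\<And>z. z \<in> S \<Longrightarrow> (L ^^ (i * (N + j))) f z \<le> lo + \<omega>"
      using oscillation_iterate[OF f _ j, of i] unfolding \<omega>_def I_def \<eta>_def by auto
    have "\<omega> \<le> \<epsilon> / 2 * I + 2 * (\<epsilon> / 4) * I"
      unfolding \<omega>_def using i I \<epsilon> by (intro add_mono mult_right_mono) auto
    also have "\<dots> = \<epsilon> * I"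
      by simp
    finally have \<omega>: "\<omega> \<le> \<epsilon> * I" .
    define h where "h = (L ^^ k) f"
    have h: "cone 0 h"
      unfolding h_def by (rule cone_0_funpow_transfer_op[OF f])
    have [measurable]: "h \<in> borel_measurable \<mu>"
      unfolding h_def by measurable
    have h_eq: "h = (L ^^ (k - i * (N + j))) ((L ^^ (i * (N + j))) f)"
      unfolding h_def funpow_add_apply[symmetric] using k by simp
    have hb: "lo \<le> h y" "h y \<le> lo + \<omega>" if "y \<in> S" for y
      unfolding h_eq
      using funpow_transfer_op_bounds[of lo "(L ^^ (i * (N + j))) f" "lo + \<omega>" y "k - i * (N + j)"]
        lo that by blast+
    \<comment> \<open>The integral of \<open>h\<close> is still \<open>I\<close> and lies between
      the same bounds, so the oscillation controls the distance of \<open>h\<close> to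
      \<open>I\<close>.\<close>
    have "(\<integral>y. lo \<partial>\<mu>) \<le> (\<integral>y. h y \<partial>\<mu>)" "(\<integral>y. h y \<partial>\<mu>) \<le> (\<integral>y. lo + \<omega> \<partial>\<mu>)"
      by (intro integral_mono integrable_const cone_integrable h; simp add: hb)+
    moreover have "(\<integral>y. h y \<partial>\<mu>) = I"
      unfolding h_def I_def using f by (simp add: cone_integral_funpow)
    ultimately have "lo \<le> I" "I \<le> lo + \<omega>"
      by (simp_all add: prob_space)
    then show "\<bar>(L ^^ k) f z - (\<integral>y. f y \<partial>\<mu>)\<bar> \<le> \<epsilon> * (\<integral>y. f y \<partial>\<mu>)"
      using hb[OF z] \<omega> by (simp add: h_def I_def abs_le_iff)
  qed
qed

text \<open>The first \<open>n\<close> steps bring the indicator into \<open>cone 0\<close>, the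
  next \<open>k\<close> mix. \<open>K\<close> is uniform in \<open>n\<close> and \<open>x\<close>,
  and the error is relative to the measure of the cylinder.\<close>

lemma cylinder_mixing:
  assumes \<epsilon>: "\<epsilon> > 0"
  shows "\<exists>K. \<forall>k\<ge>K. \<forall>n x. \<forall>z\<in>S.
    \<bar>(L ^^ (n + k)) (indicator (cyl n x)) z - prob (cyl n x)\<bar> \<le> \<epsilon> * prob (cyl n x)"
proof -
  obtain K where K: "\<And>k f z. k \<ge> K \<Longrightarrow> cone 0 f \<Longrightarrow> f \<in> borel_measurable \<mu> \<Longrightarrow> z \<in> S \<Longrightarrow>
    \<bar>(L ^^ k) f z - (\<integral>y. f y \<partial>\<mu>)\<bar> \<le> \<epsilon> * (\<integral>y. f y \<partial>\<mu>)"
    using uniform_mixing[OF \<epsilon>] by blast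
  show ?thesis
  proof (intro exI allI impI ballI)
    fix k n x z assume "k \<ge> K" "z \<in> S"
    then have "\<bar>(L ^^ k) ((L ^^ n) (indicator (cyl n x))) z - prob (cyl n x)\<bar> \<le> \<epsilon> * prob (cyl n x)"
      using K[of k "(L ^^ n) (indicator (cyl n x))" z] cone_funpow_transfer_op[OF cone_indicator_cyl]
      by (simp add: integral_funpow_transfer_op_cyl)
    then show "\<bar>(L ^^ (n + k)) (indicator (cyl n x)) z - prob (cyl n x)\<bar> \<le> \<epsilon> * prob (cyl n x)"
      unfolding add.commute[of n k] funpow_add_apply .
  qed
qed

lemma cylinder_transfer_op_le:
  assumes "n \<le> j" "z \<in> S"
  shows "(L ^^ j) (indicator (cyl n x)) z \<le> sup_const * prob (cyl n x)"
proof -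
  have "(L ^^ j) (indicator (cyl n x)) = (L ^^ (j - n)) ((L ^^ n) (indicator (cyl n x)))"
    unfolding funpow_add_apply[symmetric] using assms(1) by simp
  then have "cone 0 ((L ^^ j) (indicator (cyl n x)))"
    using cone_0_funpow_transfer_op[OF cone_funpow_transfer_op[OF cone_indicator_cyl]] by simp
  from cone_le_integral[OF this _ assms(2)] show ?thesis
    by (simp add: integral_funpow_transfer_op_cyl)
qed

text \<open>The branch through \<open>x\<close> has positive weight under \<open>L ^^ n\<close>,
  while \<open>L ^^ n\<close> of the indicator is at most a multiple of the measure.\<close>

lemma prob_cylinder_pos:
  assumes x: "x \<in> S"
  shows "prob (cyl n x) > 0"
proof -
  have "\<delta> ^ n * indicator (cyl n x) x \<le> (L ^^ n) (indicator (cyl n x)) ((T ^^ n) x)"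
    using x by (intro funpow_transfer_op_lower) auto
  also have "\<dots> \<le> sup_const * prob (cyl n x)"
    using x by (intro cylinder_transfer_op_le funpow_left_shift_in_subshift) auto
  finally have "0 < sup_const * prob (cyl n x)"
    using \<delta>_pos x by (auto simp: mem_cylinder_iff intro: less_le_trans[rotated])
  then show ?thesis
    using sup_const_pos by (simp add: zero_less_mult_iff)
qed

end

subsection \<open>Returns to the cylinders of a periodic point\<close>

text \<open>Geometric decay along each residue class modulo \<open>m\<close>; \<open>C\<close>
  dominates the starting values of all classes at once.\<close>

lemma ratio_le_imp_null:
  fixes f :: "nat \<Rightarrow> real"
  assumes m: "m \<ge> 1" and f: "\<And>n. 0 \<le> f n" and \<theta>: "0 \<le> \<theta>" "\<theta> < 1"
    and le: "\<And>n. n \<ge> n0 \<Longrightarrow> f (n + m) \<le> \<theta> * f n"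
  shows "f \<longlonglongrightarrow> 0"
proof -
  define C where "C = (\<Sum>r<m. f (n0 + r))"
  have bound: "f (n0 + r + k * m) \<le> \<theta> ^ k * C" if r: "r < m" for r k
  proof (induction k)
    case 0
    then show ?case
      using member_le_sum[of r "{..<m}" "\<lambda>r. f (n0 + r)"] r f by (simp add: C_def)
  next
    case (Suc k)
    have "f (n0 + r + Suc k * m) = f (n0 + r + k * m + m)"
      by (simp add: algebra_simps)
    also have "\<dots> \<le> \<theta> * f (n0 + r + k * m)"
      by (rule le) simp
    also have "\<dots> \<le> \<theta> * (\<theta> ^ k * C)"
      using Suc \<theta> by (intro mult_left_mono) auto
    finally show ?case by simp
  qed
  have "(\<lambda>n. \<theta> ^ ((n - n0) div m) * C) \<longlonglongrightarrow> 0 * C"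
  proof (intro tendsto_mult tendsto_const)
    have "filterlim (\<lambda>n::nat. (n - n0) div m) at_top at_top"
      using filterlim_compose[OF filterlim_at_top_div_const_nat filterlim_minus_const_nat_at_top] m
      by simp
    then show "(\<lambda>n. \<theta> ^ ((n - n0) div m)) \<longlonglongrightarrow> 0"
      using filterlim_compose[OF LIMSEQ_realpow_zero[OF \<theta>]] by blast
  qed
  then have lim: "(\<lambda>n. \<theta> ^ ((n - n0) div m) * C) \<longlonglongrightarrow> 0"
    by simp
  have "f n \<le> \<theta> ^ ((n - n0) div m) * C" if n: "n \<ge> n0" for n
  proof -
    have "n0 + (n - n0) mod m + (n - n0) div m * m = n"
      using n mod_div_mult_eq[of "n - n0" m] by linarith
    then show ?thesis
      using bound[of "(n - n0) mod m" "(n - n0) div m"] m by simp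
  qed
  then have "eventually (\<lambda>n. f n \<le> \<theta> ^ ((n - n0) div m) * C) sequentially"
    unfolding eventually_sequentially by blast
  then show ?thesis
    by (rule tendsto_sandwich[OF _ _ tendsto_const lim, rotated]) (simp add: f)
qed

text \<open>Two letters exclude the one-point system, for which \<open>p\<close> would be 1 and the
  limit law degenerate.\<close>

locale periodic_g_system = mixing_g_system +
  fixes x :: "nat \<Rightarrow> nat" and m :: nat
  assumes x_in_S: "x \<in> S" and prime_period: "prime_period x m" and two_letters: "dim_row B \<ge> 2"
begin

definition p :: real where "p = (\<Prod>j<m. g ((T ^^ j) x))"
abbreviation a :: "nat \<Rightarrow> real" where "a n \<equiv> prob (cyl n x)"

lemma m_pos: "m \<ge> 1" and T_m: "(T ^^ m) x = x"
  using prime_period by (auto simp: prime_period_def)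

lemma T_mod: "(T ^^ (j mod m)) x = (T ^^ j) x"
  by (rule funpow_mod_eq[OF T_m])

lemma x_mod: "x (i + j mod m) = x (i + j)"
  using fun_cong[OF T_mod[of j], of i] by (simp add: funpow_left_shift)

lemma T_x_in_S: "(T ^^ j) x \<in> S"
  using x_in_S by (rule funpow_left_shift_in_subshift)

lemma p_pos: "p > 0"
  unfolding p_def using less_le_trans[OF \<delta>_pos g_ge[OF T_x_in_S]] by (intro prod_pos) auto

lemma p_le_g:
  assumes "j < m"
  shows "p \<le> g ((T ^^ j) x)"
proof -
  have "p = g ((T ^^ j) x) * (\<Prod>i\<in>{..<m} - {j}. g ((T ^^ i) x))"
    unfolding p_def using assms by (intro prod.remove) auto
  also have "\<dots> \<le> g ((T ^^ j) x) * 1"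
    by (intro mult_left_mono prod_le_1) (auto simp: g_bounds T_x_in_S)
  finally show ?thesis by simp
qed

text \<open>If \<open>p = 1\<close> then every point of the orbit of \<open>x\<close> has a single preimage, so \<open>x\<close> is the only
  point mapped to \<open>(T ^^ N) x\<close>, whereas every letter starts such a point.\<close>

lemma p_less_1: "p < 1"
proof (rule ccontr)
  assume "\<not> p < 1"
  then have g1: "g ((T ^^ j) x) \<ge> 1" for j
    using p_le_g[of "j mod m"] m_pos by (simp add: T_mod)
  have unique: "y = (T ^^ j) x" if y: "y \<in> S" "T y = (T ^^ Suc j) x" for y j
  proof (rule ccontr)
    assume ne: "y \<noteq> (T ^^ j) x"
    have "(\<Sum>v\<in>{y, (T ^^ j) x}. g v) \<le> (\<Sum>v | v \<in> S \<and> T v = (T ^^ Suc j) x. g v)"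
      using y by (intro sum_mono2 finite_preimage_subshift) (auto simp: g_bounds T_x_in_S)
    then have "g y + g ((T ^^ j) x) \<le> 1"
      using ne g_sum[OF T_x_in_S[of "Suc j"]] by simp
    then show False
      using g1[of j] g_ge[OF y(1)] \<delta>_pos by linarith
  qed
  have inj: "y = x" if "y \<in> S" "(T ^^ n) y = (T ^^ n) x" for y n
    using that
  proof (induction n)
    case (Suc n)
    have "(T ^^ n) y = (T ^^ n) x"
      by (rule unique) (use Suc.prems in \<open>simp_all add: funpow_left_shift_in_subshift\<close>)
    then show ?case
      by (rule Suc.IH[OF Suc.prems(1)])
  qed simp
  define b where "b = (if x 0 = 0 then 1 else 0 :: nat)"
  have "b < dim_row B" "b \<noteq> x 0"
    using two_letters by (auto simp: b_def)
  then obtain y where "y \<in> S" "y 0 = b" "(T ^^ N) y = (T ^^ N) x"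
    using connecting[of b "(T ^^ N) x"] T_x_in_S by blast
  then show False
    using inj[of y N] \<open>b \<noteq> x 0\<close> by simp
qed

section \<open>Decay of the cylinder measures\<close>

lemma a_pos: "a n > 0"
  by (rule prob_cylinder_pos[OF x_in_S])

lemma a_antimono: "n \<le> k \<Longrightarrow> a k \<le> a n"
  by (intro finite_measure_mono cylinder_antimono) auto

lemma g_continuous: "y \<in> S \<Longrightarrow> (g \<longlongrightarrow> g y) (at y within S)"
  by (rule variation_null_imp_continuous[OF g_function summable_LIMSEQ_zero[OF summable_variation]])

lemma a_ratio:
  assumes "e > 0"
  shows "\<exists>n0. \<forall>n\<ge>n0. \<bar>a (n + m) - p * a n\<bar> \<le> e * a n"
  using prob_cylinder_add[OF x_in_S g_continuous[OF T_x_in_S] assms, of m] by (simp add: T_m p_def)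

text \<open>Leaving out time gaps of order \<open>n\<close> costs an error of order
  \<open>n * a n\<close>. The measures decay geometrically along steps of \<open>m\<close>, since
  \<open>p < 1\<close>.\<close>

lemma n_times_a_tendsto_0: "(\<lambda>n. real n * a n) \<longlonglongrightarrow> 0"
proof -
  define \<theta> where "\<theta> = (1 + p) / 2"
  have \<theta>: "p < \<theta>" "\<theta> < 1" "0 < \<theta>"
    using p_less_1 p_pos by (auto simp: \<theta>_def)
  obtain n0 where n0: "\<And>n. n \<ge> n0 \<Longrightarrow> \<bar>a (n + m) - p * a n\<bar> \<le> (\<theta> - p) * a n"
    using a_ratio[of "\<theta> - p"] \<theta> by auto
  obtain n1 :: nat where n1: "real m * 2 / (1 - \<theta>) \<le> real n1"
    using real_arch_simple by blast
  show ?thesis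
  \<comment> \<open>The weight \<open>n\<close> brings a factor \<open>(n + m) / n\<close>; for
    \<open>n \<ge> n1\<close> the passage from \<theta> to \<open>(1 + \<theta>) / 2\<close> absorbs
    it.\<close>
  proof (rule ratio_le_imp_null[OF m_pos, where \<theta> = "(1 + \<theta>) / 2" and ?n0.0 = "max n0 n1"])
    fix n assume n: "n \<ge> max n0 n1"
    have "a (n + m) \<le> \<theta> * a n"
      using n0[of n] n by (simp add: abs_le_iff algebra_simps)
    then have "real (n + m) * a (n + m) \<le> real (n + m) * (\<theta> * a n)"
      by (rule mult_left_mono) simp
    also have "\<dots> \<le> ((1 + \<theta>) / 2 * real n) * a n"
    proof -
      have "real m * 2 \<le> real n1 * (1 - \<theta>)"
        using n1 \<theta> by (simp add: divide_le_eq)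
      also have "\<dots> \<le> real n * (1 - \<theta>)"
        using n \<theta> by (intro mult_right_mono) auto
      finally have "real m \<le> real n * (1 - \<theta>) / 2"
        by simp
      moreover have "real m * \<theta> \<le> real m"
        using \<theta> by (simp add: mult_left_le)
      ultimately have "real (n + m) * \<theta> \<le> (1 + \<theta>) / 2 * real n"
        by (simp add: field_simps)
      then have "real (n + m) * \<theta> * a n \<le> (1 + \<theta>) / 2 * real n * a n"
        by (rule mult_right_mono) simp
      then show ?thesis by (simp add: mult_ac)
    qed
    finally show "real (n + m) * a (n + m) \<le> (1 + \<theta>) / 2 * (real n * a n)"
      by (simp add: mult.assoc)
  next
    show "0 \<le> (1 + \<theta>) / 2" "(1 + \<theta>) / 2 < 1"
      using \<theta> by simp_all
  qed simp
qed

lemma a_tendsto_0: "a \<longlonglongrightarrow> 0"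
proof (rule tendsto_sandwich[OF _ _ tendsto_const n_times_a_tendsto_0])
  have "1 * a n \<le> real n * a n" if "n \<ge> 1" for n
    using that by (intro mult_right_mono) auto
  then show "eventually (\<lambda>n. a n \<le> real n * a n) sequentially"
    by (auto simp: eventually_sequentially)
qed simp

section \<open>Possible return times\<close>

lemma ex_separation:
  "\<exists>J. \<forall>r. 1 \<le> r \<and> r < m \<longrightarrow> (\<exists>i<J * m. x (i + r) \<noteq> x i)"
proof -
  have "\<exists>i. x (i + r) \<noteq> x i" if "1 \<le> r" "r < m" for r
  proof (rule ccontr)
    assume "\<not> (\<exists>i. x (i + r) \<noteq> x i)"
    then have "(T ^^ r) x = x"
      by (auto simp: funpow_left_shift)
    then show False
      using that prime_period by (auto simp: prime_period_def)
  qed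
  then obtain i where i: "\<And>r. 1 \<le> r \<Longrightarrow> r < m \<Longrightarrow> x (i r + r) \<noteq> x (i r)"
    by metis
  define J where "J = Suc (\<Sum>r<m. i r)"
  have "i r < J * m" if "r < m" for r
  proof -
    have "i r \<le> (\<Sum>r<m. i r)"
      using that by (intro member_le_sum) auto
    also have "\<dots> < J * 1"
      by (simp add: J_def)
    also have "\<dots> \<le> J * m"
      using m_pos by (intro mult_le_mono2)
    finally show ?thesis .
  qed
  then show ?thesis
    using i by (intro exI[of _ J]) blast
qed

text \<open>A window in which every shift of \<open>x\<close> by less than a period is detected; it
  exists because \<open>m\<close> is the prime period. Being a multiple of \<open>m\<close>, it
  satisfies \<open>(T ^^ sep) x = x\<close>.\<close>

definition sep :: nat where
  "sep = (SOME J. \<forall>r. 1 \<le> r \<and> r < m \<longrightarrow> (\<exists>i<J * m. x (i + r) \<noteq> x i)) * m"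

lemma sep: "1 \<le> r \<Longrightarrow> r < m \<Longrightarrow> \<exists>i<sep. x (i + r) \<noteq> x i"
  using someI_ex[OF ex_separation] by (simp add: sep_def)

lemma T_sep: "(T ^^ sep) x = x"
  using T_mod[of sep] by (simp add: sep_def)

text \<open>Such a return would force \<open>x\<close> to agree with its shift by
  \<open>j mod m\<close> on an overlap of at least \<open>sep\<close> letters.\<close>

lemma no_return_off_period:
  assumes y: "y \<in> cyl n x" and j: "j mod m \<noteq> 0" "j + sep \<le> n"
  shows "(T ^^ j) y \<notin> cyl n x"
proof
  assume *: "(T ^^ j) y \<in> cyl n x"
  obtain i where i: "i < sep" "x (i + j mod m) \<noteq> x i"
    using sep[of "j mod m"] j m_pos by (auto simp: Suc_le_eq)
  have "y (i + j) = x i"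
    using * i j by (auto simp: mem_cylinder_iff funpow_left_shift)
  moreover have "y (i + j) = x (i + j)"
    using y i j by (auto simp: mem_cylinder_iff)
  ultimately show False
    using i by (simp add: x_mod)
qed

text \<open>As \<open>m \<le> j \<le> n\<close>, the letters of \<open>y\<close> at places
  \<open>n\<close> to \<open>n + m - 1\<close> lie among those prescribed by the return, and by
  periodicity they continue \<open>x\<close>.\<close>

lemma return_at_period:
  assumes y: "y \<in> cyl n x" and Ty: "(T ^^ j) y \<in> cyl n x" and j: "j mod m = 0" "j > 0" "j \<le> n"
  shows "y \<in> cyl (n + m) x"
proof -
  have "m \<le> j"
    using j by (meson dvd_imp_le mod_0_imp_dvd)
  have "y i = x i" if i: "i < n + m" for i
  proof (cases "i < n")
    case True
    then show ?thesis using y by (simp add: mem_cylinder_iff)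
  next
    case False
    define i' where "i' = i - j"
    have i': "i = i' + j" "i' < n"
      using False i j \<open>m \<le> j\<close> by (auto simp: i'_def)
    then have "y i = x i'"
      using Ty by (auto simp: mem_cylinder_iff funpow_left_shift)
    then show ?thesis
      using x_mod[of i' j] j i' by simp
  qed
  then show ?thesis
    using y by (simp add: mem_cylinder_iff)
qed

lemma no_early_return:
  assumes "y \<in> cyl n x" "y \<notin> cyl (n + m) x" "1 \<le> j" "j + sep \<le> n"
  shows "(T ^^ j) y \<notin> cyl n x"
  using assms no_return_off_period[of y n j] return_at_period[of y n j] by (cases "j mod m = 0") auto

text \<open>Ignoring the first \<open>sep\<close> letters of the second visit widens the time gap to
  at least \<open>n\<close>, where the uniform bound on \<open>L ^^ (j + sep)\<close> of the
  indicator holds. The price is \<open>a (n - sep)\<close> in place of \<open>a n\<close>.\<close>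

lemma integral_return_le:
  assumes j: "n \<le> j + sep"
  shows "(\<integral>y. indicator (cyl n x) y * indicator (cyl n x) ((T ^^ j) y) \<partial>\<mu>)
           \<le> sup_const * a n * a (n - sep)"
proof -
  define F :: "(nat \<Rightarrow> nat) \<Rightarrow> real" where "F = indicator (cyl (n - sep) x)"
  have [measurable]: "F \<in> borel_measurable \<mu>"
    unfolding F_def by measurable
  have F: "0 \<le> F y" "F y \<le> 1" for y
    by (auto simp: F_def indicator_def)
  let ?A = "indicator (cyl n x) :: (nat \<Rightarrow> nat) \<Rightarrow> real"
  have "(\<integral>y. ?A y * ?A ((T ^^ j) y) \<partial>\<mu>) \<le> (\<integral>y. ?A y * F ((T ^^ (j + sep)) y) \<partial>\<mu>)"
  proof (intro integral_mono)
    fix y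
    have "F ((T ^^ (j + sep)) y) = 1" if "(T ^^ j) y \<in> cyl n x"
    proof (cases "sep \<le> n")
      case True
      have "(T ^^ sep) ((T ^^ j) y) \<in> cyl (n - sep) ((T ^^ sep) x)"
        using that True by (intro left_shift_mem_cylinder) simp
      then show ?thesis
        by (simp add: F_def T_sep left_shift_funpow_add add.commute)
    next
      \<comment> \<open>Here \<open>n - sep = 0\<close> and the cylinder is all of
        \<open>S\<close>.\<close>
      case False
      then show ?thesis
        using that by (simp add: F_def mem_cylinder_iff funpow_left_shift_in_subshift
            flip: left_shift_funpow_add[of sep j, unfolded add.commute[of sep j]])
    qed
    then show "?A y * ?A ((T ^^ j) y) \<le> ?A y * F ((T ^^ (j + sep)) y)"
      using F by (auto simp: indicator_def)
  qed (auto intro!: integrable_bounded[of _ 1] simp: indicator_def F_def)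
  also have "\<dots> = (\<integral>z. (L ^^ (j + sep)) ?A z * F z \<partial>\<mu>)"
    by (rule integral_duality[where C = 1 and D = 1]) (auto simp: F_def indicator_def)
  also have "\<dots> \<le> (\<integral>z. (sup_const * a n) * F z \<partial>\<mu>)"
  proof (rule integral_mono)
    fix z assume z: "z \<in> space \<mu>"
    then show "(L ^^ (j + sep)) ?A z * F z \<le> (sup_const * a n) * F z"
      using j F by (intro mult_right_mono cylinder_transfer_op_le) auto
  next
    show "integrable \<mu> (\<lambda>z. (L ^^ (j + sep)) ?A z * F z)"
    proof (rule integrable_bounded[of _ 1])
      fix z assume "z \<in> S"
      then have "0 \<le> (L ^^ (j + sep)) ?A z" "(L ^^ (j + sep)) ?A z \<le> 1"
        using funpow_transfer_op_bounds[of 0 ?A 1 z "j + sep"] by auto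
      then show "norm ((L ^^ (j + sep)) ?A z * F z) \<le> 1"
        by (simp add: F_def indicator_def)
    qed simp
    show "integrable \<mu> (\<lambda>z. (sup_const * a n) * F z)"
      by (intro integrable_mult_right integrable_bounded[of _ 1]) (auto simp: F_def indicator_def)
  qed
  also have "\<dots> = sup_const * a n * a (n - sep)"
    by (simp add: F_def)
  finally show ?thesis .
qed

end

subsection \<open>The characteristic function of the number of visits\<close>

context mixing_g_system begin

text \<open>Duality moves \<open>n + k\<close> steps onto the indicator, which
  \<open>cylinder_mixing\<close> makes nearly constant, uniformly in \<open>F\<close>.\<close>

lemma cylinder_decorrelation:
  assumes \<epsilon>: "\<epsilon> > 0"
  shows "\<exists>K. \<forall>k\<ge>K. \<forall>n y. \<forall>F :: (nat \<Rightarrow> nat) \<Rightarrow> complex. F \<in> borel_measurable \<mu> \<longrightarrow> (\<forall>z\<in>S. norm (F z) \<le> 1) \<longrightarrow>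
    norm ((\<integral>z. of_real (indicator (cyl n y) z) * F ((T ^^ (n + k)) z) \<partial>\<mu>)
          - of_real (prob (cyl n y)) * (\<integral>z. F z \<partial>\<mu>)) \<le> \<epsilon> * prob (cyl n y)"
proof -
  obtain K where K: "\<And>k n y z. k \<ge> K \<Longrightarrow> z \<in> S \<Longrightarrow>
    \<bar>(L ^^ (n + k)) (indicator (cyl n y)) z - prob (cyl n y)\<bar> \<le> \<epsilon> * prob (cyl n y)"
    using cylinder_mixing[OF \<epsilon>] by blast
  show ?thesis
  proof (intro exI allI impI)
    fix k n y and F :: "(nat \<Rightarrow> nat) \<Rightarrow> complex"
    assume k: "k \<ge> K" and [measurable]: "F \<in> borel_measurable \<mu>" and "\<forall>z\<in>S. norm (F z) \<le> 1"
    then have F: "norm (F z) \<le> 1" if "z \<in> S" for z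
      using that by blast
    define h where "h = (L ^^ (n + k)) (indicator (cyl n y))"
    have [measurable]: "h \<in> borel_measurable \<mu>"
      unfolding h_def by measurable
    have h: "\<bar>h z\<bar> \<le> 1" if "z \<in> S" for z
      using funpow_transfer_op_bounds[of 0 "indicator (cyl n y)" 1 z "n + k"] that
      unfolding h_def by (simp add: indicator_le_1)
    have [simp]: "integrable \<mu> (\<lambda>z. of_real (h z) * F z)"
    proof (rule integrable_bounded)
      fix z assume "z \<in> S"
      then show "norm (of_real (h z) * F z) \<le> 1 * 1"
        unfolding norm_mult norm_of_real using h F by (intro mult_mono) auto
    qed measurable
    have [simp]: "integrable \<mu> F"
      using F by (intro integrable_bounded[of F 1]) auto
    have "(\<integral>z. of_real (indicator (cyl n y) z) * F ((T ^^ (n + k)) z) \<partial>\<mu>) = (\<integral>z. of_real (h z) * F z \<partial>\<mu>)"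
      unfolding h_def using F by (intro integral_duality_complex[where C = 1 and D = 1]) (auto simp: indicator_def)
    then have "(\<integral>z. of_real (indicator (cyl n y) z) * F ((T ^^ (n + k)) z) \<partial>\<mu>) - of_real (prob (cyl n y)) * (\<integral>z. F z \<partial>\<mu>)
        = (\<integral>z. of_real (h z) * F z - of_real (prob (cyl n y)) * F z \<partial>\<mu>)"
      by simp
    also have "norm \<dots> \<le> (\<integral>z. norm (of_real (h z) * F z - of_real (prob (cyl n y)) * F z) \<partial>\<mu>)"
      by (rule integral_norm_bound)
    also have "\<dots> \<le> (\<integral>z. \<epsilon> * prob (cyl n y) \<partial>\<mu>)"
    proof (rule integral_mono)
      fix z assume z: "z \<in> space \<mu>"
      have "norm (of_real (h z) * F z - of_real (prob (cyl n y)) * F z) = \<bar>h z - prob (cyl n y)\<bar> * norm (F z)"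
        by (simp flip: norm_mult norm_of_real[where 'a = complex] add: left_diff_distrib)
      also have "\<dots> \<le> \<epsilon> * prob (cyl n y) * 1"
        unfolding h_def using z K[OF k, of z n y] F[of z] \<epsilon> by (intro mult_mono) auto
      finally show "norm (of_real (h z) * F z - of_real (prob (cyl n y)) * F z) \<le> \<epsilon> * prob (cyl n y)"
        by simp
    qed simp_all
    finally show "norm ((\<integral>z. of_real (indicator (cyl n y) z) * F ((T ^^ (n + k)) z) \<partial>\<mu>)
          - of_real (prob (cyl n y)) * (\<integral>z. F z \<partial>\<mu>)) \<le> \<epsilon> * prob (cyl n y)"
      by simp
  qed
qed

end

locale visit_char = periodic_g_system +
  fixes s :: complex
  assumes norm_s: "norm s = 1"
begin

definition u :: "nat \<Rightarrow> (nat \<Rightarrow> nat) \<Rightarrow> complex" where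
  "u n y = (if y \<in> cyl n x then s else 1)"

text \<open>The power of \<open>s\<close> counting visits at times \<open>0, ..., r - 1\<close>,
  written as a product so that it splits along time.\<close>

definition V :: "nat \<Rightarrow> nat \<Rightarrow> (nat \<Rightarrow> nat) \<Rightarrow> complex" where
  "V n r y = (\<Prod>i<r. u n ((T ^^ i) y))"

definition \<phi> :: "nat \<Rightarrow> nat \<Rightarrow> complex" where "\<phi> n r = (\<integral>y. V n r y \<partial>\<mu>)"

definition \<psi> :: "nat \<Rightarrow> nat \<Rightarrow> complex" where
  "\<psi> n r = (\<integral>y. of_real (indicator (cyl n x) y) * V n r (T y) \<partial>\<mu>)"

section \<open>Elementary estimates for the visit weights\<close>

lemma u_measurable [measurable]: "u n \<in> borel_measurable \<mu>"
  unfolding u_def by measurable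

lemma V_measurable [measurable]: "V n r \<in> borel_measurable \<mu>"
  unfolding V_def by measurable

lemma norm_u [simp]: "norm (u n y) = 1"
  by (simp add: u_def norm_s)

lemma norm_V [simp]: "norm (V n r y) = 1"
  by (simp add: V_def flip: prod_norm)

lemma V_0 [simp]: "V n 0 y = 1"
  by (simp add: V_def)

lemma V_add: "V n (i + r) y = V n i y * V n r ((T ^^ i) y)"
proof (induction r)
  case (Suc r)
  then show ?case
    unfolding add_Suc_right by (simp add: V_def left_shift_funpow_add add.commute[of r i])
qed (simp add: V_def)

lemma V_Suc: "V n (Suc r) y = u n y * V n r (T y)"
  using V_add[of n 1 r y] by (simp add: V_def)

lemma funpow_T: "(T ^^ i) (T y) = (T ^^ Suc i) y"
  by (simp add: funpow_swap1)

text \<open>The weight is 1 without visits and otherwise at distance at most 2 from 1. The sum over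
  times can then be integrated term by term.\<close>

lemma norm_V_minus_1: "norm (V n r y - 1) \<le> 2 * (\<Sum>i<r. indicator (cyl n x) ((T ^^ i) y))"
proof (cases "\<exists>i<r. (T ^^ i) y \<in> cyl n x")
  case True
  then obtain i where i: "i < r" "(T ^^ i) y \<in> cyl n x" by blast
  have "norm (V n r y - 1) \<le> norm (V n r y) + norm (1::complex)"
    by (rule norm_triangle_ineq4)
  moreover have "1 \<le> (\<Sum>i<r. indicator (cyl n x) ((T ^^ i) y) :: real)"
    using member_le_sum[of i "{..<r}" "\<lambda>i. indicator (cyl n x) ((T ^^ i) y) :: real"] i by simp
  ultimately show ?thesis by simp
next
  case False
  then have "V n r y = 1"
    by (simp add: V_def u_def)
  then show ?thesis by (simp add: sum_nonneg)
qed

lemma integrable_V: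
  fixes h :: "(nat \<Rightarrow> nat) \<Rightarrow> real"
  assumes [measurable]: "h \<in> borel_measurable \<mu>" and "\<And>y. y \<in> S \<Longrightarrow> \<bar>h y\<bar> \<le> C"
  shows "integrable \<mu> (\<lambda>y. of_real (h y) * V n r ((T ^^ i) y))"
proof (rule integrable_bounded[of _ C])
  show "norm (of_real (h y) * V n r ((T ^^ i) y)) \<le> C" if "y \<in> S" for y
    using assms(2)[OF that] by (simp add: norm_mult)
qed measurable

text \<open>By invariance \<open>\<phi> n r\<close> may be computed with \<open>V n r (T y)\<close>,
  which differs from \<open>V n (Suc r) y\<close> by the factor \<open>u n y\<close> only.\<close>

lemma \<phi>_diff: "\<phi> n r - \<phi> n (Suc r) = (1 - s) * \<psi> n r"
proof -
  have i1: "integrable \<mu> (V n r)" for r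
    by (rule integrable_bounded[of _ 1]) auto
  have i2: "integrable \<mu> (\<lambda>y. V n r (T y))"
    by (rule integrable_bounded[of _ 1]) auto
  have "\<phi> n r = (\<integral>y. V n r (T y) \<partial>\<mu>)"
    unfolding \<phi>_def using integral_shift_complex[of "V n r" 1 1] by simp
  then have "\<phi> n r - \<phi> n (Suc r) = (\<integral>y. V n r (T y) - V n (Suc r) y \<partial>\<mu>)"
    using i1 i2 by (simp add: \<phi>_def)
  also have "\<dots> = (\<integral>y. (1 - s) * (of_real (indicator (cyl n x) y) * V n r (T y)) \<partial>\<mu>)"
    by (rule Bochner_Integration.integral_cong) (auto simp: V_Suc u_def indicator_def algebra_simps)
  also have "\<dots> = (1 - s) * \<psi> n r"
    by (simp add: \<psi>_def)
  finally show ?thesis .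
qed

lemma norm_integral_le:
  fixes F :: "(nat \<Rightarrow> nat) \<Rightarrow> complex"
  assumes "\<And>y. y \<in> S \<Longrightarrow> norm (F y) \<le> h y" "integrable \<mu> h"
  shows "norm (\<integral>y. F y \<partial>\<mu>) \<le> (\<integral>y. h y \<partial>\<mu>)"
proof (cases "integrable \<mu> F")
  case True
  have "norm (\<integral>y. F y \<partial>\<mu>) \<le> (\<integral>y. norm (F y) \<partial>\<mu>)"
    by (rule integral_norm_bound)
  also have "\<dots> \<le> (\<integral>y. h y \<partial>\<mu>)"
    using True assms by (intro integral_mono integrable_norm) auto
  finally show ?thesis .
next
  \<comment> \<open>The Bochner integral of a non-integrable function is 0 by convention.\<close>
  case False
  have "0 \<le> (\<integral>y. h y \<partial>\<mu>)"
    using order_trans[OF norm_ge_zero assms(1)] by (intro Bochner_Integration.integral_nonneg_AE) auto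
  then show ?thesis
    using False by (simp add: not_integrable_integral_eq)
qed

lemma norm_\<psi>: "norm (\<psi> n r) \<le> a n"
proof -
  have "norm (\<psi> n r) \<le> (\<integral>y. norm (of_real (indicator (cyl n x) y) * V n r (T y)) \<partial>\<mu>)"
    unfolding \<psi>_def by (rule integral_norm_bound)
  then show ?thesis by (simp add: norm_mult)
qed

lemma norm_1_minus_s: "norm (1 - s) \<le> 2"
  using norm_triangle_ineq4[of 1 s] norm_s by simp

lemma norm_\<phi>_le_1: "norm (\<phi> n r) \<le> 1"
proof -
  have "norm (\<phi> n r) \<le> (\<integral>y. norm (V n r y) \<partial>\<mu>)"
    unfolding \<phi>_def by (rule integral_norm_bound)
  then show ?thesis by simp
qed

lemma norm_\<phi>_diff: "norm (\<phi> n (r + i) - \<phi> n r) \<le> real i * (2 * a n)"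
proof (induction i)
  case (Suc i)
  have "norm (\<phi> n (r + i) - \<phi> n (Suc (r + i))) \<le> 2 * a n"
    unfolding \<phi>_diff norm_mult by (intro mult_mono norm_1_minus_s norm_\<psi>) auto
  then have "norm (\<phi> n (Suc (r + i)) - \<phi> n (r + i)) \<le> 2 * a n"
    by (simp add: norm_minus_commute)
  moreover have "norm (\<phi> n (Suc (r + i)) - \<phi> n r)
      \<le> norm (\<phi> n (Suc (r + i)) - \<phi> n (r + i)) + norm (\<phi> n (r + i) - \<phi> n r)"
    using norm_triangle_ineq[of "\<phi> n (Suc (r + i)) - \<phi> n (r + i)" "\<phi> n (r + i) - \<phi> n r"] by simp
  ultimately show ?case
    using Suc by (simp add: algebra_simps)
qed simp

lemma integral_window_le:
  assumes n: "n \<le> i + sep"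
  shows "(\<integral>y. indicator (cyl n x) y * (2 * (\<Sum>j<k. indicator (cyl n x) ((T ^^ (i + j)) y))) \<partial>\<mu>)
     \<le> real k * (2 * sup_const * a n * a (n - sep))"
proof -
  have int: "integrable \<mu> (\<lambda>y. indicator (cyl n x) y * indicator (cyl n x) ((T ^^ j) y) :: real)" for j
    by (rule integrable_bounded[of _ 1]) (auto simp: indicator_def)
  have "(\<integral>y. indicator (cyl n x) y * (2 * (\<Sum>j<k. indicator (cyl n x) ((T ^^ (i + j)) y))) \<partial>\<mu>)
      = (\<integral>y. 2 * (\<Sum>j<k. indicator (cyl n x) y * indicator (cyl n x) ((T ^^ (i + j)) y) :: real) \<partial>\<mu>)"
    by (simp only: sum_distrib_left mult.left_commute)
  also have "\<dots> = 2 * (\<Sum>j<k. \<integral>y. indicator (cyl n x) y * indicator (cyl n x) ((T ^^ (i + j)) y) \<partial>\<mu>)"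
    by (simp only: integral_mult_right_zero, subst Bochner_Integration.integral_sum) (simp_all only: int)
  also have "\<dots> \<le> 2 * (\<Sum>j<k. sup_const * a n * a (n - sep))"
    using n by (intro mult_left_mono sum_mono integral_return_le) auto
  also have "\<dots> = real k * (2 * sup_const * a n * a (n - sep))"
    by simp
  finally show ?thesis .
qed

lemma integrable_window:
  "integrable \<mu> (\<lambda>y. indicator (cyl n x) y * (2 * (\<Sum>j<k. indicator (cyl n x) ((T ^^ (i + j)) y))) :: real)"
proof (rule integrable_bounded[of _ "2 * real k"])
  fix y
  have "(\<Sum>j<k. indicator (cyl n x) ((T ^^ (i + j)) y) :: real) \<le> (\<Sum>j<k. 1)"
    by (intro sum_mono) (simp add: indicator_le_1)
  moreover have "0 \<le> (\<Sum>j<k. indicator (cyl n x) ((T ^^ (i + j)) y) :: real)"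
    by (intro sum_nonneg) simp
  ultimately show "norm (indicator (cyl n x) y * (2 * (\<Sum>j<k. indicator (cyl n x) ((T ^^ (i + j)) y))) :: real) \<le> 2 * real k"
    by (simp add: indicator_def)
qed measurable

text \<open>On \<open>cyl n x - cyl (n + m) x\<close> there is no visit before time \<open>n - sep\<close>, and the visits
  up to time \<open>n + k\<close> are negligible.\<close>

lemma no_return_part:
  assumes n: "sep < n" and r: "n + k - 1 \<le> r" and k: "k \<ge> 1"
  shows "norm ((\<integral>y. of_real (indicator (cyl n x) y - indicator (cyl (n + m) x) y) * V n r (T y) \<partial>\<mu>)
      - (\<integral>y. of_real (indicator (cyl n x) y - indicator (cyl (n + m) x) y) * V n (r - (n + k - 1)) ((T ^^ (n + k)) y) \<partial>\<mu>))
     \<le> real (sep + k) * (2 * sup_const * a n * a (n - sep))"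
proof -
  define D :: "(nat \<Rightarrow> nat) \<Rightarrow> real" where
    "D y = indicator (cyl n x) y - indicator (cyl (n + m) x) y" for y
  have [measurable]: "D \<in> borel_measurable \<mu>"
    unfolding D_def by measurable
  have sub: "cyl (n + m) x \<subseteq> cyl n x"
    by (rule cylinder_antimono) simp
  have D: "D y = indicator (cyl n x - cyl (n + m) x) y" for y
    using sub by (auto simp: D_def indicator_def)
  have D1: "\<bar>D y\<bar> \<le> 1" for y
    by (simp add: D indicator_def)
  have i1: "integrable \<mu> (\<lambda>y. of_real (D y) * V n r (T y))"
    using integrable_V[of D 1 n r 1] D1 by simp
  have i2: "integrable \<mu> (\<lambda>y. of_real (D y) * V n (r - (n + k - 1)) ((T ^^ (n + k)) y))"
    using D1 by (intro integrable_V[of D 1]) auto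
  have "norm (\<integral>y. of_real (D y) * V n r (T y) - of_real (D y) * V n (r - (n + k - 1)) ((T ^^ (n + k)) y) \<partial>\<mu>)
     \<le> (\<integral>y. indicator (cyl n x) y * (2 * (\<Sum>j<sep + k. indicator (cyl n x) ((T ^^ (n - sep + j)) y))) \<partial>\<mu>)"
  proof (rule norm_integral_le[OF _ integrable_window])
    fix y
    show "norm (of_real (D y) * V n r (T y) - of_real (D y) * V n (r - (n + k - 1)) ((T ^^ (n + k)) y))
      \<le> indicator (cyl n x) y * (2 * (\<Sum>j<sep + k. indicator (cyl n x) ((T ^^ (n - sep + j)) y)))"
    proof (cases "y \<in> cyl n x - cyl (n + m) x")
      case True
      let ?w = "(T ^^ (n - sep)) y"
      \<comment> \<open>This factor covers the times \<open>1, ..., n - sep - 1\<close>.\<close>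
      have early: "V n (n - sep - 1) (T y) = 1"
        unfolding V_def
      proof (rule prod.neutral, safe)
        fix i assume i: "i < n - sep - 1"
        have "(T ^^ Suc i) y \<notin> cyl n x"
          using True i by (intro no_early_return) auto
        then show "u n ((T ^^ i) (T y)) = 1"
          by (simp add: u_def funpow_swap1)
      qed
      \<comment> \<open>\<open>V n r (T y)\<close> counts times \<open>1\<close> to
        \<open>r\<close>. After the early part, \<open>sep + k\<close> times reach
        \<open>n + k - 1\<close>, and \<open>r - (n + k - 1)\<close> remain from time
        \<open>n + k\<close> on.\<close>
      have "r = (n - sep - 1) + ((sep + k) + (r - (n + k - 1)))"
        using n r k by simp
      then have "V n r (T y) = V n (n - sep - 1) (T y) * V n ((sep + k) + (r - (n + k - 1))) ((T ^^ (n - sep - 1)) (T y))"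
        by (metis V_add)
      also have "(T ^^ (n - sep - 1)) (T y) = ?w"
        unfolding funpow_T using n by (simp add: Suc_diff_Suc)
      also have "V n ((sep + k) + (r - (n + k - 1))) ?w
          = V n (sep + k) ?w * V n (r - (n + k - 1)) ((T ^^ (n + k)) y)"
        unfolding V_add[of n "sep + k"] left_shift_funpow_add using n by (simp add: add.commute)
      finally have eq: "V n r (T y) = V n (sep + k) ?w * V n (r - (n + k - 1)) ((T ^^ (n + k)) y)"
        unfolding early by simp
      have "norm (of_real (D y) * V n r (T y) - of_real (D y) * V n (r - (n + k - 1)) ((T ^^ (n + k)) y))
          = norm ((V n (sep + k) ?w - 1) * V n (r - (n + k - 1)) ((T ^^ (n + k)) y))"
      proof -
        have "D y = 1"
          using True by (simp add: D)
        then show ?thesis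
          unfolding eq by (simp only: of_real_1 mult_1_left left_diff_distrib)
      qed
      also have "\<dots> = norm (V n (sep + k) ?w - 1)"
        by (simp add: norm_mult)
      also have "\<dots> \<le> 2 * (\<Sum>j<sep + k. indicator (cyl n x) ((T ^^ j) ?w))"
        by (rule norm_V_minus_1)
      finally have "norm (of_real (D y) * V n r (T y) - of_real (D y) * V n (r - (n + k - 1)) ((T ^^ (n + k)) y))
          \<le> 2 * (\<Sum>j<sep + k. indicator (cyl n x) ((T ^^ (n - sep + j)) y))"
        unfolding left_shift_funpow_add add.commute[of _ "n - sep"] .
      moreover have "indicator (cyl n x) y = (1 :: real)"
        using True by simp
      ultimately show ?thesis
        by (simp only: mult_1_left)
    next
      case False
      then show ?thesis
        by (simp add: D sum_nonneg)
    qed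
  qed
  also have "\<dots> \<le> real (sep + k) * (2 * sup_const * a n * a (n - sep))"
    by (rule integral_window_le) simp
  finally show ?thesis
    unfolding Bochner_Integration.integral_diff[OF i1 i2] unfolding D_def .
qed

text \<open>The \<open>i\<close> additional factors matter only after a visit at some time from
  \<open>r + 1\<close> to \<open>r + i\<close>, late enough for
  \<open>integral_return_le\<close>.\<close>

lemma \<psi>_lag:
  assumes "n \<le> r + 1 + sep"
  shows "norm (\<psi> n (r + i) - \<psi> n r) \<le> real i * (2 * sup_const * a n * a (n - sep))"
proof -
  have ind: "\<bar>indicator (cyl n x) y :: real\<bar> \<le> 1" for y
    by (simp add: indicator_def)
  have int: "integrable \<mu> (\<lambda>y. of_real (indicator (cyl n x) y) * V n r (T y))" for r
    using integrable_V[of "indicator (cyl n x)" 1 n r 1] ind by simp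
  have eq: "\<psi> n (r + i) - \<psi> n r = (\<integral>y. of_real (indicator (cyl n x) y) * V n (r + i) (T y)
      - of_real (indicator (cyl n x) y) * V n r (T y) \<partial>\<mu>)"
    using int by (simp add: \<psi>_def)
  have "norm (\<psi> n (r + i) - \<psi> n r)
      \<le> (\<integral>y. indicator (cyl n x) y * (2 * (\<Sum>j<i. indicator (cyl n x) ((T ^^ (r + 1 + j)) y))) \<partial>\<mu>)"
    unfolding eq
  proof (rule norm_integral_le[OF _ integrable_window])
    fix y
    have "V n (r + i) (T y) = V n r (T y) * V n i ((T ^^ (r + 1)) y)"
      by (simp add: V_add funpow_swap1)
    then have "norm (of_real (indicator (cyl n x) y) * V n (r + i) (T y) - of_real (indicator (cyl n x) y) * V n r (T y))
       = norm (of_real (indicator (cyl n x) y) * V n r (T y) * (V n i ((T ^^ (r + 1)) y) - 1))"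
      by (simp add: algebra_simps)
    also have "\<dots> = indicator (cyl n x) y * norm (V n i ((T ^^ (r + 1)) y) - 1)"
      by (simp add: norm_mult)
    also have "\<dots> \<le> indicator (cyl n x) y * (2 * (\<Sum>j<i. indicator (cyl n x) ((T ^^ j) ((T ^^ (r + 1)) y))))"
      by (intro mult_left_mono norm_V_minus_1) simp
    also have "\<dots> = indicator (cyl n x) y * (2 * (\<Sum>j<i. indicator (cyl n x) ((T ^^ (r + 1 + j)) y)))"
      unfolding left_shift_funpow_add by (simp add: add_ac)
    finally show "norm (of_real (indicator (cyl n x) y) * V n (r + i) (T y) - of_real (indicator (cyl n x) y) * V n r (T y))
       \<le> indicator (cyl n x) y * (2 * (\<Sum>j<i. indicator (cyl n x) ((T ^^ (r + 1 + j)) y)))" .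
  qed
  also have "\<dots> \<le> real i * (2 * sup_const * a n * a (n - sep))"
    by (rule integral_window_le[OF assms])
  finally show ?thesis .
qed

text \<open>On \<open>cyl (n + m) x\<close> the first return takes place at time \<open>m\<close>.\<close>

lemma return_part:
  assumes \<epsilon>: "\<epsilon> > 0"
  shows "\<exists>n0. \<forall>n\<ge>n0. \<forall>r.
    norm ((\<integral>y. of_real (indicator (cyl (n + m) x) y) * V n (m + r) (T y) \<partial>\<mu>) - s * of_real p * \<psi> n r) \<le> \<epsilon> * a n"
proof -
  obtain n1 where n1: "\<And>n z. n \<ge> n1 \<Longrightarrow> z \<in> S \<Longrightarrow>
     \<bar>(L ^^ m) (indicator (cyl (n + m) x)) z - p * indicator (cyl n x) z\<bar> \<le> \<epsilon> * indicator (cyl n x) z"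
    using funpow_transfer_op_cylinder[OF x_in_S g_continuous[OF T_x_in_S] \<epsilon>, of m]
    by (auto simp: T_m p_def)
  show ?thesis
  proof (intro exI allI impI)
    fix n r assume n: "max n1 (m + sep) \<le> n"
    define h where "h = (L ^^ m) (indicator (cyl (n + m) x))"
    have [measurable]: "h \<in> borel_measurable \<mu>"
      unfolding h_def by measurable
    have h1: "\<bar>h z\<bar> \<le> 1" if "z \<in> S" for z
      using funpow_transfer_op_bounds[of 0 "indicator (cyl (n + m) x)" 1 z m] that
      unfolding h_def by (simp add: indicator_le_1)
    define F where "F y = V n r (T y)" for y
    have [measurable]: "F \<in> borel_measurable \<mu>"
      unfolding F_def by measurable
    have sub: "cyl (n + m) x \<subseteq> cyl n x"
      by (rule cylinder_antimono) simp
    \<comment> \<open>Times \<open>1\<close> to \<open>m - 1\<close> are excluded as returns; the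
      visit at time \<open>m\<close> contributes the factor \<open>s\<close>.\<close>
    have Vm: "V n m (T y) = s" if y: "y \<in> cyl (n + m) x" for y
    proof -
      have "u n ((T ^^ i) (T y)) = 1" if "i < m - 1" for i
      proof -
        have "(T ^^ Suc i) y \<notin> cyl n x"
          using y sub that n by (intro no_return_off_period) auto
        then show ?thesis by (simp add: u_def funpow_swap1)
      qed
      then have "V n (m - 1) (T y) = 1"
        by (simp add: V_def)
      moreover have "(T ^^ (m - 1)) (T y) = (T ^^ m) y"
        unfolding funpow_T using m_pos by simp
      moreover have "(T ^^ m) y \<in> cyl n x"
        using left_shift_mem_cylinder[of y B m n x] y by (simp add: T_m add.commute)
      ultimately show ?thesis
        using m_pos V_add[of n "m - 1" 1 "T y"] by (simp add: V_def u_def)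
    qed
    have "(\<integral>y. of_real (indicator (cyl (n + m) x) y) * V n (m + r) (T y) \<partial>\<mu>)
       = (\<integral>y. s * (of_real (indicator (cyl (n + m) x) y) * F ((T ^^ m) y)) \<partial>\<mu>)"
      by (rule Bochner_Integration.integral_cong)
         (auto simp: V_add Vm F_def indicator_def funpow_swap1)
    also have "\<dots> = s * (\<integral>y. of_real (indicator (cyl (n + m) x) y) * F ((T ^^ m) y) \<partial>\<mu>)"
      by simp
    \<comment> \<open>Duality restarts the process at the return: \<open>h\<close> is close to
      \<open>p\<close> times the indicator of \<open>cyl n x\<close>, so the integral is close to
      \<open>p\<close> times \<open>\<psi> n r\<close>.\<close>
    also have "(\<integral>y. of_real (indicator (cyl (n + m) x) y) * F ((T ^^ m) y) \<partial>\<mu>) = (\<integral>z. of_real (h z) * F z \<partial>\<mu>)"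
      unfolding h_def by (rule integral_duality_complex[where C = 1 and D = 1]) (auto simp: F_def indicator_def)
    finally have eq: "(\<integral>y. of_real (indicator (cyl (n + m) x) y) * V n (m + r) (T y) \<partial>\<mu>) - s * of_real p * \<psi> n r
       = s * ((\<integral>z. of_real (h z) * F z \<partial>\<mu>) - of_real p * \<psi> n r)"
      by (simp add: algebra_simps)
    have i1: "integrable \<mu> (\<lambda>z. of_real (h z) * F z)"
      unfolding F_def using integrable_V[of h 1 n r 1] h1 by simp
    have i2: "integrable \<mu> (\<lambda>z. of_real (indicator (cyl n x) z) * F z)"
      unfolding F_def using integrable_V[of "indicator (cyl n x)" 1 n r 1] by (simp add: indicator_def)
    have "(\<integral>z. of_real (h z) * F z \<partial>\<mu>) - of_real p * \<psi> n r
       = (\<integral>z. of_real (h z) * F z - of_real p * (of_real (indicator (cyl n x) z) * F z) \<partial>\<mu>)"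
      using i1 i2 by (simp add: \<psi>_def F_def)
    also have "norm \<dots> \<le> (\<integral>z. \<epsilon> * indicator (cyl n x) z \<partial>\<mu>)"
    proof (rule norm_integral_le)
      fix z assume z: "z \<in> S"
      have "of_real (h z) * F z - of_real p * (of_real (indicator (cyl n x) z) * F z)
         = of_real (h z - p * indicator (cyl n x) z) * F z"
        by (simp add: algebra_simps)
      then show "norm (of_real (h z) * F z - of_real p * (of_real (indicator (cyl n x) z) * F z)) \<le> \<epsilon> * indicator (cyl n x) z"
        using n1[of n z] n z by (simp add: norm_mult F_def h_def del: of_real_diff of_real_mult)
    next
      show "integrable \<mu> (\<lambda>z. \<epsilon> * indicator (cyl n x) z)"
        by (intro integrable_mult_right integrable_bounded[of _ 1]) (auto simp: indicator_def)
    qed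
    also have "\<dots> = \<epsilon> * a n"
      by simp
    finally show "norm ((\<integral>y. of_real (indicator (cyl (n + m) x) y) * V n (m + r) (T y) \<partial>\<mu>) - s * of_real p * \<psi> n r) \<le> \<epsilon> * a n"
      unfolding eq norm_mult norm_s by simp
  qed
qed

end

context visit_char begin

definition \<kappa> :: complex where "\<kappa> = (1 - s) * (1 - of_real p) / (1 - s * of_real p)"

lemma norm_1_minus_sp: "1 - p \<le> norm (1 - s * of_real p)"
  using norm_triangle_ineq2[of 1 "s * of_real p"] p_pos by (simp add: norm_mult norm_s)

lemma sp_neq_1: "1 - s * of_real p \<noteq> 0"
  using norm_1_minus_sp p_less_1 by auto

text \<open>Ensures \<open>norm (exp (- (of_real (a n) * \<kappa>))) \<le> 1\<close>, so the
  recursion for \<open>\<phi>\<close> does not amplify errors.\<close>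

lemma Re_\<kappa>_nonneg: "Re \<kappa> \<ge> 0"
proof -
  have 1: "(Re s)\<^sup>2 + (Im s)\<^sup>2 = 1"
    using norm_s by (simp add: norm_complex_def)
  have "Re s \<le> 1"
    using complex_Re_le_cmod[of s] norm_s by simp
  have "Re ((1 - s) / (1 - s * of_real p)) =
      ((1 - Re s) * (1 - p * Re s) + Im s * (p * Im s)) / ((1 - p * Re s)\<^sup>2 + (p * Im s)\<^sup>2)"
    by (simp add: Re_divide mult.commute)
  also have "(1 - Re s) * (1 - p * Re s) + Im s * (p * Im s) = 1 - Re s - p * Re s + p * ((Re s)\<^sup>2 + (Im s)\<^sup>2)"
    by (simp add: algebra_simps power2_eq_square)
  also have "\<dots> = (1 + p) * (1 - Re s)"
    unfolding 1 by (simp add: algebra_simps)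
  finally have "Re ((1 - s) / (1 - s * of_real p)) \<ge> 0"
    using \<open>Re s \<le> 1\<close> p_pos by simp
  moreover have "\<kappa> = of_real (1 - p) * ((1 - s) / (1 - s * of_real p))"
    by (simp add: \<kappa>_def)
  moreover have "Re (of_real r * z) = r * Re z" for r z
    by simp
  ultimately show ?thesis
    using p_less_1 by (simp only: mult_nonneg_nonneg)
qed

lemma eventually_small:
  assumes "e > 0"
  shows "eventually (\<lambda>n. C * real (n + k) * a n \<le> e \<and> C * a (n - sep) \<le> e \<and> C * a n \<le> e) sequentially"
proof -
  have "(\<lambda>n. C * (real n * a n + real k * a n)) \<longlonglongrightarrow> C * (0 + real k * 0)"
    by (intro tendsto_mult tendsto_add tendsto_const n_times_a_tendsto_0 a_tendsto_0)
  then have 1: "eventually (\<lambda>n. C * (real n * a n + real k * a n) < e) sequentially"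
    using assms by (intro order_tendstoD(2)) auto
  have "(\<lambda>n. a (n - sep)) \<longlonglongrightarrow> 0"
    using filterlim_compose[OF a_tendsto_0 filterlim_minus_const_nat_at_top] by simp
  then have "(\<lambda>n. C * a (n - sep)) \<longlonglongrightarrow> C * 0"
    by (intro tendsto_mult tendsto_const)
  then have 2: "eventually (\<lambda>n. C * a (n - sep) < e) sequentially"
    using assms by (intro order_tendstoD(2)) auto
  have "(\<lambda>n. C * a n) \<longlonglongrightarrow> C * 0"
    by (intro tendsto_mult tendsto_const a_tendsto_0)
  then have 3: "eventually (\<lambda>n. C * a n < e) sequentially"
    using assms by (intro order_tendstoD(2)) auto
  show ?thesis
    using 1 2 3
  proof eventually_elim
    case (elim n)
    have "C * real (n + k) * a n = C * (real n * a n + real k * a n)"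
      by (simp add: algebra_simps)
    then show ?case
      using elim by linarith
  qed
qed

text \<open>Splitting \<open>cyl n x\<close> according to whether the point returns at time \<open>m\<close> gives
  \<open>\<psi> n r \<approx> (1 - p) a n \<phi> n r + s p \<psi> n (r - m)\<close>, and \<open>\<psi> n (r - m) \<approx> \<psi> n r\<close>.\<close>

lemma \<psi>_approx:
  assumes \<epsilon>: "\<epsilon> > 0"
  shows "\<exists>k n0. \<forall>n\<ge>n0. \<forall>r\<ge>n + k.
    norm ((1 - s * of_real p) * \<psi> n r - of_real ((1 - p) * a n) * \<phi> n r) \<le> \<epsilon> * a n"
proof -
  \<comment> \<open>Seven error terms \<open>b1\<close> to \<open>b7\<close> of size
    \<open>e * a n\<close> follow.\<close>
  define e where "e = \<epsilon> / 8"
  have e: "e > 0" using \<epsilon> by (simp add: e_def)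
  obtain K where K: "\<And>k n y F. k \<ge> K \<Longrightarrow> F \<in> borel_measurable \<mu> \<Longrightarrow> (\<forall>z\<in>S. norm (F z :: complex) \<le> 1) \<Longrightarrow>
    norm ((\<integral>z. of_real (indicator (cyl n y) z) * F ((T ^^ (n + k)) z) \<partial>\<mu>)
          - of_real (prob (cyl n y)) * (\<integral>z. F z \<partial>\<mu>)) \<le> e * prob (cyl n y)"
    using cylinder_decorrelation[OF e] by blast
  \<comment> \<open>Time \<open>n + k\<close> is then a gap of at least \<open>K\<close> beyond both
    cylinder lengths \<open>n\<close> and \<open>n + m\<close>, and
    \<open>r - m \<ge> n\<close>.\<close>
  define k where "k = m + K + 1"
  obtain n1 where n1: "\<And>n r. n \<ge> n1 \<Longrightarrow>
    norm ((\<integral>y. of_real (indicator (cyl (n + m) x) y) * V n (m + r) (T y) \<partial>\<mu>) - s * of_real p * \<psi> n r) \<le> e * a n"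
    using return_part[OF e] by blast
  obtain n2 where n2: "\<And>n. n \<ge> n2 \<Longrightarrow> \<bar>a (n + m) - p * a n\<bar> \<le> e * a n"
    using a_ratio[OF e] by blast
  \<comment> \<open>The first entry serves the drift of \<open>\<phi>\<close>, the second the
    windows of length at most \<open>sep + k + m\<close> in the return estimates.\<close>
  define C where "C = max 2 (real (sep + k + m) * (2 * sup_const))"
  have C: "C \<ge> 2" "C \<ge> real (sep + k + m) * (2 * sup_const)"
    by (simp_all add: C_def)
  obtain n3 where n3: "\<And>n. n \<ge> n3 \<Longrightarrow> C * real (n + k) * a n \<le> e" "\<And>n. n \<ge> n3 \<Longrightarrow> C * a (n - sep) \<le> e"
    using eventually_small[OF e, of C k] unfolding eventually_sequentially by blast
  show ?thesis
  proof (intro exI allI impI)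
    fix n r assume n: "Max {n1, n2, n3, Suc sep} \<le> n" and r: "n + k \<le> r"
    have n_ge: "n1 \<le> n" "n2 \<le> n" "n3 \<le> n" "sep < n"
      using n by auto
    define a1 a2 where "a1 = a n" and "a2 = a (n + m)"
    have a12: "0 \<le> a2" "a2 \<le> a1"
      unfolding a1_def a2_def by (auto intro: a_antimono)
    have return_bound: "c * (2 * sup_const * a n * a (n - sep)) \<le> e * a1" if "c \<le> real (sep + k + m)" for c
    proof -
      have "c * (2 * sup_const) \<le> C"
        using order_trans[OF mult_right_mono[OF that, of "2 * sup_const"] C(2)] sup_const_pos by simp
      then have "(c * (2 * sup_const)) * a (n - sep) * a n \<le> C * a (n - sep) * a n"
        by (intro mult_right_mono) auto
      also have "\<dots> \<le> e * a n"
        using n3(2)[OF n_ge(3)] by (intro mult_right_mono) auto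
      finally show ?thesis by (simp add: a1_def mult_ac)
    qed
    \<comment> \<open>The numbers of factors left after the gap \<open>n + k\<close> and after a
      return at time \<open>m\<close>.\<close>
    define r1 r2 where "r1 = r - (n + k - 1)" and "r2 = r - m"
    have r12: "r = r1 + (n + k - 1)" "r = m + r2" "r = r2 + m" "n \<le> r2"
      using r by (auto simp: r1_def r2_def k_def)
    define I1 where "I1 = (\<integral>y. of_real (indicator (cyl n x) y - indicator (cyl (n + m) x) y) * V n r (T y) \<partial>\<mu>)"
    define I2 where "I2 = (\<integral>y. of_real (indicator (cyl n x) y - indicator (cyl (n + m) x) y) * V n r1 ((T ^^ (n + k)) y) \<partial>\<mu>)"
    define J1 where "J1 = (\<integral>y. of_real (indicator (cyl n x) y) * V n r1 ((T ^^ (n + k)) y) \<partial>\<mu>)"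
    define J2 where "J2 = (\<integral>y. of_real (indicator (cyl (n + m) x) y) * V n r1 ((T ^^ (n + k)) y) \<partial>\<mu>)"
    define Y where "Y = (\<integral>y. of_real (indicator (cyl (n + m) x) y) * V n r (T y) \<partial>\<mu>)"
    have int: "integrable \<mu> (\<lambda>y. of_real (indicator (cyl j x) y) * V n i ((T ^^ l) y))" for i j l
      by (rule integrable_V[of _ 1]) (auto simp: indicator_def)
    have split_\<psi>: "\<psi> n r = I1 + Y"
      using int[of n r 1] int[of "n + m" r 1] by (simp add: \<psi>_def I1_def Y_def left_diff_distrib)
    have split_I2: "I2 = J1 - J2"
      using int[of n r1 "n + k"] int[of "n + m" r1 "n + k"] by (simp add: I2_def J1_def J2_def left_diff_distrib)
    have b1: "norm (I1 - I2) \<le> e * a1"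
      unfolding I1_def I2_def r1_def
      by (rule order_trans[OF no_return_part return_bound]) (use n_ge r in \<open>auto simp: k_def\<close>)
    have b2: "norm (J1 - of_real a1 * \<phi> n r1) \<le> e * a1"
      unfolding J1_def a1_def \<phi>_def by (rule K) (auto simp: k_def)
    have "n + k = (n + m) + (K + 1)"
      by (simp add: k_def)
    then have "norm (J2 - of_real a2 * \<phi> n r1) \<le> e * a2"
      unfolding J2_def a2_def \<phi>_def by (simp only:) (rule K, auto)
    then have b3: "norm (of_real a2 * \<phi> n r1 - J2) \<le> e * a1"
      using order_trans[OF _ mult_left_mono[OF a12(2), of e]] e by (simp add: norm_minus_commute)
    have "norm (\<phi> n r1 - \<phi> n r) \<le> real (n + k - 1) * (2 * a n)"
      unfolding r12(1) by (subst norm_minus_commute) (rule norm_\<phi>_diff)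
    also have "\<dots> \<le> C * real (n + k) * a n"
      using mult_mono[of "real (n + k - 1)" "real (n + k)" "2 * a n" "C * a n"] C(1)
      by (simp add: mult_right_mono mult_ac)
    also have "\<dots> \<le> e"
      by (rule n3(1)[OF n_ge(3)])
    finally have "norm (\<phi> n r1 - \<phi> n r) \<le> e" .
    then have b4: "norm (of_real (a1 - a2) * (\<phi> n r1 - \<phi> n r)) \<le> e * a1"
      unfolding norm_mult norm_of_real using a12 e mult_mono[of "a1 - a2" a1 "norm (\<phi> n r1 - \<phi> n r)" e]
      by (simp add: mult.commute)
    have b5: "norm (of_real (p * a1 - a2) * \<phi> n r) \<le> e * a1"
      unfolding norm_mult norm_of_real
      using mult_mono[OF n2[OF n_ge(2)] norm_\<phi>_le_1[of n r]] e
      by (simp add: a1_def a2_def abs_minus_commute)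
    have b6: "norm (Y - s * of_real p * \<psi> n r2) \<le> e * a1"
      using n1[OF n_ge(1), of r2] unfolding Y_def a1_def r12(2)[symmetric] .
    have "norm (\<psi> n r2 - \<psi> n r) \<le> e * a1"
    proof -
      have "norm (\<psi> n (r2 + m) - \<psi> n r2) \<le> real m * (2 * sup_const * a n * a (n - sep))"
        using r12(4) by (intro \<psi>_lag) simp
      also have "\<dots> \<le> e * a1"
        by (rule return_bound) simp
      finally show ?thesis
        unfolding r12(3)[symmetric] by (simp add: norm_minus_commute)
    qed
    then have b7: "norm (s * of_real p * (\<psi> n r2 - \<psi> n r)) \<le> e * a1"
      unfolding norm_mult norm_s norm_of_real
      using mult_mono[of p 1 "norm (\<psi> n r2 - \<psi> n r)" "e * a1"] p_pos p_less_1 by simp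
    \<comment> \<open>In turn: visits dropped before time \<open>n + k\<close>, decorrelation of the
      two cylinders, drift of \<open>\<phi>\<close>, the ratio \<open>a2 / a1\<close> against
      \<open>p\<close>, renewal at time \<open>m\<close>, and the lag in
      \<open>\<psi>\<close>.\<close>
    have decomp: "(1 - s * of_real p) * \<psi> n r - of_real ((1 - p) * a1) * \<phi> n r =
        (I1 - I2) + (J1 - of_real a1 * \<phi> n r1) + (of_real a2 * \<phi> n r1 - J2)
        + of_real (a1 - a2) * (\<phi> n r1 - \<phi> n r) + of_real (p * a1 - a2) * \<phi> n r
        + (Y - s * of_real p * \<psi> n r2) + s * of_real p * (\<psi> n r2 - \<psi> n r)"
      unfolding split_\<psi> split_I2 by (simp add: algebra_simps)
    have "norm ((1 - s * of_real p) * \<psi> n r - of_real ((1 - p) * a1) * \<phi> n r) \<le>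
        e * a1 + e * a1 + e * a1 + e * a1 + e * a1 + e * a1 + e * a1"
      unfolding decomp by (intro norm_triangle_mono b1 b2 b3 b4 b5 b6 b7)
    also have "\<dots> \<le> \<epsilon> * a1"
      using \<epsilon> a12 by (simp add: e_def)
    finally show "norm ((1 - s * of_real p) * \<psi> n r - of_real ((1 - p) * a n) * \<phi> n r) \<le> \<epsilon> * a n"
      by (simp add: a1_def)
  qed
qed

lemma norm_exp_minus_1_minus_le:
  fixes z :: complex
  shows "norm (exp z - 1 - z) \<le> exp (norm z) * (norm z)\<^sup>2"
  using Taylor_exp_field[of z 1] by (simp add: power2_eq_square numeral_2_eq_2 algebra_simps)

text \<open>The powers of \<open>w\<close> solve the exact recursion, and the one-step deviations of
  \<open>\<phi>\<close> from it add up because \<open>norm w \<le> 1\<close>. Up to time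
  \<open>q\<close> only a crude deviation of order \<open>a n\<close> is available, whence
  \<open>min r q\<close>; from then on \<open>approx\<close> applies.\<close>

lemma \<phi>_error:
  assumes approx: "\<And>r. r \<ge> q \<Longrightarrow>
      norm ((1 - s * of_real p) * \<psi> n r - of_real ((1 - p) * a n) * \<phi> n r) \<le> \<epsilon> * a n"
  shows "norm (\<phi> n r - exp (- (of_real (a n) * \<kappa>)) ^ r) \<le>
      real (min r q) * ((2 + norm \<kappa>) * a n)
      + real r * ((2 * \<epsilon> / (1 - p) + exp (norm \<kappa>) * (norm \<kappa>)\<^sup>2 * a n) * a n)"
proof (induction r)
  case 0
  show ?case by (simp add: \<phi>_def)
next
  case (Suc r)
  define w where "w = exp (- (of_real (a n) * \<kappa>))"
  define E1 E2 where "E1 = (2 + norm \<kappa>) * a n"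
    and "E2 = (2 * \<epsilon> / (1 - p) + exp (norm \<kappa>) * (norm \<kappa>)\<^sup>2 * a n) * a n"
  have a1: "a n \<le> 1" by simp
  have w1: "norm w \<le> 1"
    using Re_\<kappa>_nonneg by (simp add: w_def)
  have "norm (w - 1 - (- (of_real (a n) * \<kappa>))) \<le> exp (norm (of_real (a n) * \<kappa>)) * (norm (of_real (a n) * \<kappa>))\<^sup>2"
    unfolding w_def using norm_exp_minus_1_minus_le[of "- (of_real (a n) * \<kappa>)"] by simp
  also have "\<dots> \<le> exp (norm \<kappa>) * (norm (of_real (a n) * \<kappa>))\<^sup>2"
    using mult_right_mono[OF a1, of "norm \<kappa>"] by (intro mult_right_mono) (auto simp: norm_mult)
  also have "\<dots> = exp (norm \<kappa>) * (norm \<kappa>)\<^sup>2 * a n * a n"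
    by (simp add: norm_mult power2_eq_square)
  also have "w - 1 - (- (of_real (a n) * \<kappa>)) = - (1 - of_real (a n) * \<kappa> - w)"
    by simp
  finally have wexp: "norm (1 - of_real (a n) * \<kappa> - w) \<le> exp (norm \<kappa>) * (norm \<kappa>)\<^sup>2 * a n * a n"
    unfolding norm_minus_cancel .
  have \<phi>1: "norm (\<phi> n r) \<le> 1"
    by (rule norm_\<phi>_le_1)
  have step: "\<phi> n (Suc r) = \<phi> n r - (1 - s) * \<psi> n r"
    using \<phi>_diff[of n r] by (simp add: algebra_simps)
  have E2_nonneg: "0 \<le> exp (norm \<kappa>) * (norm \<kappa>)\<^sup>2 * a n * a n"
    by simp
  have err: "norm (\<phi> n (Suc r) - w * \<phi> n r) \<le> (if r < q then E1 else 0) + E2" if \<epsilon>: "\<epsilon> \<ge> 0"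
  proof (cases "r < q")
    case True
    have eq: "\<phi> n (Suc r) - w * \<phi> n r = (1 - of_real (a n) * \<kappa> - w) * \<phi> n r + of_real (a n) * \<kappa> * \<phi> n r - (1 - s) * \<psi> n r"
      unfolding step by (simp add: algebra_simps)
    have "norm (\<phi> n (Suc r) - w * \<phi> n r) \<le> norm ((1 - of_real (a n) * \<kappa> - w) * \<phi> n r) + norm (of_real (a n) * \<kappa> * \<phi> n r) + norm ((1 - s) * \<psi> n r)"
      unfolding eq by (intro norm_triangle_le_diff add_mono norm_triangle_ineq order_refl)
    also have "\<dots> \<le> exp (norm \<kappa>) * (norm \<kappa>)\<^sup>2 * a n * a n * 1 + a n * norm \<kappa> * 1 + 2 * a n"
      unfolding norm_mult norm_of_real
      by (intro add_mono mult_mono wexp \<phi>1 norm_1_minus_s norm_\<psi>) auto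
    also have "\<dots> \<le> E1 + E2"
      using \<epsilon> p_less_1 by (simp add: E1_def E2_def algebra_simps)
    finally show ?thesis using True by simp
  next
    case False
    define R where "R = (1 - s * of_real p) * \<psi> n r - of_real ((1 - p) * a n) * \<phi> n r"
    have R: "norm R \<le> \<epsilon> * a n"
      unfolding R_def using False by (intro approx) simp
    \<comment> \<open>Solving for \<open>\<psi> n r\<close> turns the decrement
      \<open>(1 - s) * \<psi> n r\<close> into \<open>a n * \<kappa> * \<phi> n r\<close> plus a
      small remainder.\<close>
    have "(1 - s) / (1 - s * of_real p) * R = (1 - s) * \<psi> n r - of_real (a n) * \<kappa> * \<phi> n r"
      unfolding R_def \<kappa>_def using sp_neq_1 by (simp add: field_simps)
    then have eq: "\<phi> n (Suc r) - w * \<phi> n r = (1 - of_real (a n) * \<kappa> - w) * \<phi> n r - (1 - s) / (1 - s * of_real p) * R"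
      unfolding step by (simp add: algebra_simps)
    have "norm (\<phi> n (Suc r) - w * \<phi> n r) \<le> norm ((1 - of_real (a n) * \<kappa> - w) * \<phi> n r) + norm ((1 - s) / (1 - s * of_real p) * R)"
      unfolding eq by (rule norm_triangle_ineq4)
    also have "\<dots> \<le> exp (norm \<kappa>) * (norm \<kappa>)\<^sup>2 * a n * a n * 1 + 2 / (1 - p) * (\<epsilon> * a n)"
      unfolding norm_mult norm_divide using p_less_1 norm_1_minus_sp
      by (intro add_mono mult_mono wexp \<phi>1 frac_le R norm_1_minus_s) auto
    also have "\<dots> = E2"
      by (simp add: E2_def algebra_simps)
    finally show ?thesis using False by simp
  qed
  have \<epsilon>: "\<epsilon> \<ge> 0"
    using order_trans[OF norm_ge_zero approx[of q]] a_pos[of n] by (simp add: zero_le_mult_iff)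
  have "norm (\<phi> n (Suc r) - w ^ Suc r) = norm ((\<phi> n (Suc r) - w * \<phi> n r) + w * (\<phi> n r - w ^ r))"
    by (simp add: algebra_simps)
  also have "\<dots> \<le> norm (\<phi> n (Suc r) - w * \<phi> n r) + norm w * norm (\<phi> n r - w ^ r)"
    using norm_triangle_ineq[of "\<phi> n (Suc r) - w * \<phi> n r" "w * (\<phi> n r - w ^ r)"] by (simp add: norm_mult)
  also have "\<dots> \<le> ((if r < q then E1 else 0) + E2) + 1 * (real (min r q) * E1 + real r * E2)"
    using Suc unfolding w_def[symmetric] E1_def[symmetric] E2_def[symmetric]
    by (intro add_mono mult_mono err \<epsilon> w1) auto
  also have "\<dots> = real (min (Suc r) q) * E1 + real (Suc r) * E2"
    by (auto simp: min_def algebra_simps less_Suc_eq_le not_less le_antisym)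
  finally show ?case
    unfolding w_def E1_def E2_def .
qed

text \<open>The sum in \<open>visits\<close> includes both time 0 and the integer part of
  \<open>t / a n\<close>, hence \<open>Suc\<close>; the surplus over \<open>t\<close> is at most
  \<open>a n\<close>.\<close>

lemma a_times_number_tendsto:
  assumes t: "t > 0"
  shows "(\<lambda>n. a n * real (Suc (nat \<lfloor>t / a n\<rfloor>))) \<longlonglongrightarrow> t"
proof (rule tendsto_sandwich[where f = "\<lambda>_. t" and h = "\<lambda>n. t + a n"])
  have floor: "real (nat \<lfloor>t / a n\<rfloor>) = of_int \<lfloor>t / a n\<rfloor>" for n
    using t a_pos[of n] by simp
  have "t \<le> a n * real (Suc (nat \<lfloor>t / a n\<rfloor>))" for n
  proof -
    have "t / a n \<le> real (Suc (nat \<lfloor>t / a n\<rfloor>))"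
      unfolding of_nat_Suc floor by linarith
    then show ?thesis
      using a_pos[of n] by (simp add: divide_le_eq mult.commute)
  qed
  then show "eventually (\<lambda>n. t \<le> a n * real (Suc (nat \<lfloor>t / a n\<rfloor>))) sequentially"
    by simp
  have "a n * real (Suc (nat \<lfloor>t / a n\<rfloor>)) \<le> t + a n" for n
  proof -
    have "real (Suc (nat \<lfloor>t / a n\<rfloor>)) \<le> t / a n + 1"
      unfolding of_nat_Suc floor by linarith
    then have "a n * real (Suc (nat \<lfloor>t / a n\<rfloor>)) \<le> a n * (t / a n + 1)"
      by (intro mult_left_mono) auto
    also have "\<dots> = t + a n"
      using a_pos[of n] by (simp add: field_simps)
    finally show ?thesis .
  qed
  then show "eventually (\<lambda>n. a n * real (Suc (nat \<lfloor>t / a n\<rfloor>)) \<le> t + a n) sequentially"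
    by simp
  show "(\<lambda>n. t + a n) \<longlonglongrightarrow> t"
    using tendsto_add[OF tendsto_const a_tendsto_0, of t] by simp
qed simp

theorem \<phi>_tendsto:
  assumes t: "t > 0"
  shows "(\<lambda>n. \<phi> n (Suc (nat \<lfloor>t / a n\<rfloor>))) \<longlonglongrightarrow> exp (- (of_real t * \<kappa>))"
proof -
  define R where "R n = Suc (nat \<lfloor>t / a n\<rfloor>)" for n
  define w where "w n = exp (- (of_real (a n) * \<kappa>))" for n
  have aR: "(\<lambda>n. a n * real (R n)) \<longlonglongrightarrow> t"
    unfolding R_def by (rule a_times_number_tendsto[OF t])
  have wR: "w n ^ R n = exp (- (of_real (a n * real (R n)) * \<kappa>))" for n
    unfolding w_def exp_of_nat_mult[symmetric] by (simp add: mult_ac)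
  have lim: "(\<lambda>n. w n ^ R n) \<longlonglongrightarrow> exp (- (of_real t * \<kappa>))"
    unfolding wR by (intro tendsto_exp tendsto_minus tendsto_mult tendsto_of_real tendsto_const aR)
  have "(\<lambda>n. \<phi> n (R n) - w n ^ R n) \<longlonglongrightarrow> 0"
  proof (rule LIMSEQ_I)
    fix \<epsilon> :: real assume \<epsilon>: "\<epsilon> > 0"
    \<comment> \<open>With \<open>a n * R n\<close> eventually below \<open>t + 1\<close>, the
      accumulated error \<open>(t + 1) * (2 * e / (1 - p))\<close> equals
      \<open>\<epsilon> / 4\<close>. The crude phase of length \<open>n + k\<close> and the Taylor
      remainder take two more quarters.\<close>
    define e where "e = \<epsilon> * (1 - p) / (8 * (t + 1))"
    have e: "e > 0"
      using \<epsilon> t p_less_1 by (simp add: e_def)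
    obtain k n0 where k: "\<And>n r. n \<ge> n0 \<Longrightarrow> r \<ge> n + k \<Longrightarrow>
      norm ((1 - s * of_real p) * \<psi> n r - of_real ((1 - p) * a n) * \<phi> n r) \<le> e * a n"
      using \<psi>_approx[OF e] by blast
    define D where "D = exp (norm \<kappa>) * (norm \<kappa>)\<^sup>2"
    obtain n1 where n1: "\<And>n. n \<ge> n1 \<Longrightarrow> (2 + norm \<kappa>) * real (n + k) * a n \<le> \<epsilon> / 4"
      using eventually_small[of "\<epsilon> / 4" "2 + norm \<kappa>" k] \<epsilon> unfolding eventually_sequentially by auto
    obtain n2 where n2: "\<And>n. n \<ge> n2 \<Longrightarrow> D * (t + 1) * a n \<le> \<epsilon> / 4"
      using eventually_small[of "\<epsilon> / 4" "D * (t + 1)" k] \<epsilon> unfolding eventually_sequentially by auto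
    obtain n3 where n3: "\<And>n. n \<ge> n3 \<Longrightarrow> a n * real (R n) < t + 1"
      using order_tendstoD(2)[OF aR, of "t + 1"] by (auto simp: eventually_sequentially)
    show "\<exists>no. \<forall>n\<ge>no. norm (\<phi> n (R n) - w n ^ R n - 0) < \<epsilon>"
    proof (intro exI allI impI)
      fix n assume n: "Max {n0, n1, n2, n3} \<le> n"
      then have n_ge: "n0 \<le> n" "n1 \<le> n" "n2 \<le> n" "n3 \<le> n" by auto
      have "norm (\<phi> n (R n) - w n ^ R n) \<le> real (min (R n) (n + k)) * ((2 + norm \<kappa>) * a n)
          + real (R n) * ((2 * e / (1 - p) + D * a n) * a n)"
        unfolding w_def D_def by (rule \<phi>_error[OF k[OF n_ge(1)]])
      also have "\<dots> \<le> real (n + k) * ((2 + norm \<kappa>) * a n) + (t + 1) * (2 * e / (1 - p) + D * a n)"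
      proof (intro add_mono mult_right_mono)
        have "0 \<le> 2 * e / (1 - p) + D * a n"
          using e p_less_1 by (simp add: D_def)
        then have "(2 * e / (1 - p) + D * a n) * (a n * real (R n)) \<le> (2 * e / (1 - p) + D * a n) * (t + 1)"
          using n3[OF n_ge(4)] by (intro mult_left_mono) auto
        then show "real (R n) * ((2 * e / (1 - p) + D * a n) * a n) \<le> (t + 1) * (2 * e / (1 - p) + D * a n)"
          by (simp only: mult_ac)
      qed auto
      also have "\<dots> = (2 + norm \<kappa>) * real (n + k) * a n + (t + 1) * (2 * e / (1 - p)) + D * (t + 1) * a n"
        by (simp only: distrib_left[of "t + 1"] mult_ac add.assoc)
      also have "(t + 1) * (2 * e / (1 - p)) = \<epsilon> / 4"
      proof -
        have "b * (2 * (\<epsilon> * c / (8 * b)) / c) = \<epsilon> / 4" if "b \<noteq> 0" "c \<noteq> 0" for b c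
          using that by simp
        from this[of "t + 1" "1 - p"] show ?thesis
          using t p_less_1 by (simp only: e_def)
      qed
      also have "(2 + norm \<kappa>) * real (n + k) * a n + \<epsilon> / 4 + D * (t + 1) * a n \<le> \<epsilon> / 4 + \<epsilon> / 4 + \<epsilon> / 4"
        by (intro add_mono n1 n2 n_ge order_refl)
      also have "\<dots> < \<epsilon>"
        using \<epsilon> by simp
      finally show "norm (\<phi> n (R n) - w n ^ R n - 0) < \<epsilon>"
        by simp
    qed
  qed
  from tendsto_add[OF this lim] show ?thesis
    by (simp add: R_def)
qed

end

subsection \<open>The characteristic function of the Polya-Aeppli distribution\<close>

lemma integrable_pmf_bounded:
  fixes h :: "'a \<Rightarrow> 'b::{banach, second_countable_topology}"
  assumes "\<And>y. norm (h y) \<le> C"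
  shows "integrable (measure_pmf P) h"
  by (rule measure_pmf.integrable_const_bound[of _ C]) (use assms in auto)

lemma integral_bind_pmf_complex:
  fixes h :: "'b \<Rightarrow> complex"
  assumes C: "\<And>y. norm (h y) \<le> C"
  shows "(\<integral>y. h y \<partial>measure_pmf (bind_pmf P N)) = (\<integral>x. (\<integral>y. h y \<partial>measure_pmf (N x)) \<partial>measure_pmf P)"
proof -
  have real: "(\<integral>y. f y \<partial>measure_pmf (bind_pmf P N)) = (\<integral>x. (\<integral>y. f y \<partial>measure_pmf (N x)) \<partial>measure_pmf P)"
    if "\<And>y. \<bar>f y\<bar> \<le> C" for f :: "'b \<Rightarrow> real"
    unfolding measure_pmf_bind
    by (rule integral_bind[where B = C and B' = 1 and K = "count_space UNIV"])
       (use that measurable_measure_pmf[of N] in \<open>auto simp: measure_pmf.emeasure_space_1\<close>)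
  have i: "integrable (measure_pmf Q) h" for Q
    by (rule integrable_pmf_bounded[OF C])
  have "norm (\<integral>y. h y \<partial>measure_pmf (N x)) \<le> C" for x
  proof -
    have "norm (\<integral>y. h y \<partial>measure_pmf (N x)) \<le> (\<integral>y. norm (h y) \<partial>measure_pmf (N x))"
      by (rule integral_norm_bound)
    also have "\<dots> \<le> (\<integral>y. C \<partial>measure_pmf (N x))"
      using C by (intro integral_mono integrable_norm i) auto
    finally show ?thesis by simp
  qed
  then have i2: "integrable (measure_pmf P) (\<lambda>x. \<integral>y. h y \<partial>measure_pmf (N x))"
    by (rule integrable_pmf_bounded)
  have "\<bar>Re (h y)\<bar> \<le> C" "\<bar>Im (h y)\<bar> \<le> C" for y
    using abs_Re_le_cmod[of "h y"] abs_Im_le_cmod[of "h y"] C[of y] by linarith+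
  then have "(\<integral>y. Re (h y) \<partial>measure_pmf (bind_pmf P N)) = (\<integral>x. (\<integral>y. Re (h y) \<partial>measure_pmf (N x)) \<partial>measure_pmf P)"
    "(\<integral>y. Im (h y) \<partial>measure_pmf (bind_pmf P N)) = (\<integral>x. (\<integral>y. Im (h y) \<partial>measure_pmf (N x)) \<partial>measure_pmf P)"
    by (intro real; simp)+
  then show ?thesis
    using i i2 by (intro complex_eqI) (simp_all flip: integral_Re integral_Im)
qed

text \<open>Reads an expectation as a series, so that generating functions can be identified by
  uniqueness of sums.\<close>

lemma sums_integral_nat_pmf:
  fixes h :: "nat \<Rightarrow> complex"
  assumes "\<And>k. norm (h k) \<le> C"
  shows "(\<lambda>k. of_real (pmf P k) * h k) sums (\<integral>k. h k \<partial>measure_pmf P)"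
proof -
  have "integrable (measure_pmf P) h"
    by (rule integrable_pmf_bounded[OF assms])
  then have "integrable (count_space UNIV) (\<lambda>k. pmf P k *\<^sub>R h k)"
    unfolding measure_pmf_eq_density by (subst (asm) integrable_density) auto
  from sums_integral_count_space_nat[OF this] show ?thesis
    unfolding measure_pmf_eq_density by (subst integral_density) (auto simp: scaleR_conv_of_real)
qed

lemma integral_replicate_pmf_power:
  fixes J :: "nat pmf" and s :: complex
  assumes s: "norm s \<le> 1"
  shows "(\<integral>xs. s ^ sum_list xs \<partial>measure_pmf (replicate_pmf n J)) = (\<integral>k. s ^ k \<partial>measure_pmf J) ^ n"
proof (induction n)
  case (Suc n)
  have bound: "norm (s ^ k) \<le> 1" for k
    using s by (simp add: norm_power power_le_one)
  have "(\<integral>xs. s ^ sum_list xs \<partial>measure_pmf (replicate_pmf (Suc n) J))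
      = (\<integral>k. (\<integral>xs. s ^ k * s ^ sum_list xs \<partial>measure_pmf (replicate_pmf n J)) \<partial>measure_pmf J)"
    using bound by (simp add: integral_bind_pmf_complex[of _ 1] power_add)
  then show ?case
    by (simp add: Suc)
qed simp

text \<open>The generating function of a compound Poisson law is \<open>exp (r * (G - 1))\<close>,
  where \<open>G\<close> is that of the jump law, here a shifted geometric law.\<close>

lemma integral_power_polya_aeppli:
  fixes s :: complex
  assumes t: "t > 0" and p: "0 \<le> p" "p < 1" and s: "norm s = 1"
  shows "(\<integral>k. s ^ k \<partial>measure_pmf (polya_aeppli_pmf t p))
    = exp (- (of_real t * ((1 - s) * (1 - of_real p) / (1 - s * of_real p))))"
proof -
  define r where "r = t * (1 - p)"
  have r: "r > 0"
    using t p by (simp add: r_def)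
  have bound: "norm (s ^ k) \<le> 1" for k
    using s by (simp add: norm_power)
  have ps: "norm (of_real p * s) < 1"
    using p s by (simp add: norm_mult)
  then have nz: "1 - s * of_real p \<noteq> 0"
    by (auto simp: mult.commute)
  define G where "G = of_real (1 - p) * s / (1 - s * of_real p)"
  have "(\<lambda>k. of_real (1 - p) * s * (of_real p * s) ^ k) sums (of_real (1 - p) * s * (1 / (1 - of_real p * s)))"
    using ps by (intro sums_mult geometric_sums)
  also have "of_real (1 - p) * s * (1 / (1 - of_real p * s)) = G"
    by (simp add: G_def mult.commute)
  also have "(\<lambda>k. of_real (1 - p) * s * (of_real p * s) ^ k) = (\<lambda>k. of_real (pmf (geometric_pmf (1 - p)) k) * s ^ Suc k)"
    using p by (simp add: fun_eq_iff power_mult_distrib mult_ac)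
  finally have "(\<lambda>k. of_real (pmf (geometric_pmf (1 - p)) k) * s ^ Suc k) sums G" .
  moreover have "(\<lambda>k. of_real (pmf (geometric_pmf (1 - p)) k) * s ^ Suc k) sums
      (\<integral>k. s ^ Suc k \<partial>measure_pmf (geometric_pmf (1 - p)))"
    by (rule sums_integral_nat_pmf[of _ 1]) (rule bound)
  ultimately have "(\<integral>k. s ^ Suc k \<partial>measure_pmf (geometric_pmf (1 - p))) = G"
    using sums_unique2 by blast
  then have J: "(\<integral>k. s ^ k \<partial>measure_pmf (map_pmf Suc (geometric_pmf (1 - p)))) = G"
    by simp
  \<comment> \<open>Bounded powers of \<open>G\<close> are required to expand the Poisson
    expectation as a series.\<close>
  have "norm G \<le> (\<integral>k. norm (s ^ k) \<partial>measure_pmf (map_pmf Suc (geometric_pmf (1 - p))))"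
    unfolding J[symmetric] by (rule integral_norm_bound)
  then have G1: "norm G \<le> 1"
    using s by (simp add: norm_power norm_mult)
  have "(\<integral>k. s ^ k \<partial>measure_pmf (polya_aeppli_pmf t p)) = (\<integral>n. G ^ n \<partial>measure_pmf (poisson_pmf r))"
    unfolding polya_aeppli_pmf_def compound_poisson_pmf_def r_def[symmetric]
    using bound s by (subst integral_bind_pmf_complex[of _ 1])
      (simp_all add: integral_replicate_pmf_power J[simplified] del: integral_map_pmf, simp_all add: integral_replicate_pmf_power J[simplified])
  moreover have "(\<lambda>n. of_real (pmf (poisson_pmf r) n) * G ^ n) sums (\<integral>n. G ^ n \<partial>measure_pmf (poisson_pmf r))"
    using G1 by (intro sums_integral_nat_pmf[of _ 1]) (simp add: norm_power power_le_one)
  moreover have "(\<lambda>n. of_real (pmf (poisson_pmf r) n) * G ^ n) sums (of_real (exp (- r)) * exp (of_real r * G))"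
  proof -
    have "(\<lambda>n. of_real (exp (- r)) * ((of_real r * G) ^ n /\<^sub>R fact n)) sums (of_real (exp (- r)) * exp (of_real r * G))"
      by (intro sums_mult exp_converges)
    also have "(\<lambda>n. of_real (exp (- r)) * ((of_real r * G) ^ n /\<^sub>R fact n)) = (\<lambda>n. of_real (pmf (poisson_pmf r) n) * G ^ n)"
      using r by (simp add: fun_eq_iff power_mult_distrib scaleR_conv_of_real divide_inverse mult_ac)
    finally show ?thesis .
  qed
  ultimately have "(\<integral>k. s ^ k \<partial>measure_pmf (polya_aeppli_pmf t p)) = of_real (exp (- r)) * exp (of_real r * G)"
    using sums_unique2 by metis
  also have "\<dots> = exp (of_real r * (G - 1))"
    by (simp add: right_diff_distrib exp_diff exp_minus exp_of_real divide_inverse mult.commute)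
  also have "G - 1 = - ((1 - s) / (1 - s * of_real p))"
    using nz by (simp add: G_def field_simps)
  also have "of_real r * - ((1 - s) / (1 - s * of_real p)) = - (of_real t * ((1 - s) * (1 - of_real p) / (1 - s * of_real p)))"
    by (simp add: r_def mult_ac)
  finally show ?thesis .
qed

subsection \<open>Convergence of the number of visits\<close>

lemma (in g_measure_system) visits_measurable [measurable]:
  "visits B \<mu> y t n \<in> borel_measurable \<mu>"
  unfolding visits_def by measurable

lemma (in visit_char) iexp_visits:
  assumes "s = iexp \<theta>"
  shows "iexp (\<theta> * visits B \<mu> x t n y) = V n (Suc (nat \<lfloor>t / a n\<rfloor>)) y"
proof -
  have u: "iexp (\<theta> * indicator (cyl n x) z) = u n z" for z
    unfolding u_def by (simp add: assms indicator_def)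
  have "\<i> * of_real (\<theta> * visits B \<mu> x t n y)
      = (\<Sum>i<Suc (nat \<lfloor>t / a n\<rfloor>). \<i> * of_real (\<theta> * indicator (cyl n x) ((T ^^ i) y)))"
    unfolding visits_def atLeast0AtMost lessThan_Suc_atMost sum_distrib_left of_real_sum ..
  then show ?thesis
    by (simp only: exp_sum[OF finite_lessThan] u V_def)
qed

theorem (in periodic_g_system) visits_weak_conv:
  assumes t: "t > 0"
  shows "weak_conv_m (\<lambda>n. distr \<mu> borel (visits B \<mu> x t n))
           (distr (measure_pmf (polya_aeppli_pmf t p)) borel real)"
proof (rule levy_continuity)
  show "real_distribution (distr \<mu> borel (visits B \<mu> x t n))" for n
    by (rule real_distribution_distr) measurable
  show "real_distribution (distr (measure_pmf (polya_aeppli_pmf t p)) borel real)"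
    by (rule prob_space.real_distribution_distr[OF measure_pmf.prob_space_axioms]) simp
  fix \<theta> :: real
  interpret v: visit_char B g \<mu> \<delta> N x m "iexp \<theta>"
    by unfold_locales simp
  have "char (distr \<mu> borel (visits B \<mu> x t n)) \<theta> = v.\<phi> n (Suc (nat \<lfloor>t / a n\<rfloor>))" for n
    unfolding char_def v.\<phi>_def by (subst integral_distr) (simp_all only: v.iexp_visits visits_measurable, measurable)
  moreover have "char (distr (measure_pmf (polya_aeppli_pmf t p)) borel real) \<theta> = exp (- (of_real t * v.\<kappa>))"
  proof -
    have "iexp (\<theta> * real k) = iexp \<theta> ^ k" for k
      unfolding exp_of_nat_mult[symmetric] by (simp add: mult_ac)
    then have "char (distr (measure_pmf (polya_aeppli_pmf t p)) borel real) \<theta>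
        = (\<integral>k. iexp \<theta> ^ k \<partial>measure_pmf (polya_aeppli_pmf t p))"
      unfolding char_def by (subst integral_distr) simp_all
    also have "\<dots> = exp (- (of_real t * v.\<kappa>))"
      unfolding v.\<kappa>_def using p_pos p_less_1 by (intro integral_power_polya_aeppli t) auto
    finally show ?thesis .
  qed
  ultimately show "(\<lambda>n. char (distr \<mu> borel (visits B \<mu> x t n)) \<theta>) \<longlonglongrightarrow>
      char (distr (measure_pmf (polya_aeppli_pmf t p)) borel real) \<theta>"
    using v.\<phi>_tendsto[OF t] by simp
qed

theorem proposition9:
  fixes M m :: nat and B :: "nat mat" and g :: "(nat \<Rightarrow> nat) \<Rightarrow> real"
    and \<mu> :: "(nat \<Rightarrow> nat) measure" and x :: "nat \<Rightarrow> nat" and p :: real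
  assumes "B \<in> carrier_mat M M"
    and "\<forall>i<M. \<forall>j<M. B $$ (i, j) \<in> {0, 1}"
    and "irreducible_mat B" and "aperiodic_mat B"
    and "g_function B g" and "g_measure B g \<mu>"
    and "x \<in> subshift B" and "prime_period x m"
    and "p = lim (cylinder_ratio B \<mu> x m)"
  shows
    "((\<forall>n. measure \<mu> (cylinder B n x) > 0) \<and>
      (\<forall>i<m. (g \<longlongrightarrow> g ((left_shift ^^ i) x)) (at ((left_shift ^^ i) x) within subshift B)) \<longrightarrow>
        cylinder_ratio B \<mu> x m \<longlonglongrightarrow> p \<and> p = (\<Prod>i<m. g ((left_shift ^^ i) x))) \<and>
     (variation B g \<longlonglongrightarrow> 0 \<longrightarrow>
        (\<forall>y q. y \<in> subshift B \<and> prime_period y q \<and> (\<forall>n. measure \<mu> (cylinder B n y) > 0) \<longrightarrow>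
           convergent (cylinder_ratio B \<mu> y q))) \<and>
     (M \<ge> 2 \<and> summable (variation B g) \<and> (\<forall>y\<in>subshift B. g y > 0) \<longrightarrow>
        (\<forall>t>0. weak_conv_m (\<lambda>n. distr \<mu> borel (visits B \<mu> x t n))
           (distr (measure_pmf (polya_aeppli_pmf t p)) borel real)))"
proof (intro conjI impI allI)
  have sys: "g_measure_system B g \<mu>"
    using assms by unfold_locales
  have ratio: "cylinder_ratio B \<mu> y q \<longlonglongrightarrow> (\<Prod>i<q. g ((left_shift ^^ i) y))"
    if "y \<in> subshift B" "prime_period y q" "\<forall>n. measure \<mu> (cylinder B n y) > 0"
      "\<forall>i<q. (g \<longlongrightarrow> g ((left_shift ^^ i) y)) (at ((left_shift ^^ i) y) within subshift B)" for y q
    using that by (intro g_measure_system.cylinder_ratio_tendsto[OF sys]) (auto simp: prime_period_def)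
  have cont: "(g \<longlongrightarrow> g y) (at y within subshift B)" if "variation B g \<longlonglongrightarrow> 0" "y \<in> subshift B" for y
    using variation_null_imp_continuous[OF assms(5) that] .
  \<comment> \<open>\<open>lim\<close> determines \<open>p\<close> only once convergence is
    known.\<close>
  have lim_eq: "p = (\<Prod>i<m. g ((left_shift ^^ i) x))"
    if "cylinder_ratio B \<mu> x m \<longlonglongrightarrow> (\<Prod>i<m. g ((left_shift ^^ i) x))"
    using limI[OF that] assms(9) by simp
  {
    assume a: "(\<forall>n. measure \<mu> (cylinder B n x) > 0) \<and>
      (\<forall>i<m. (g \<longlongrightarrow> g ((left_shift ^^ i) x)) (at ((left_shift ^^ i) x) within subshift B))"
    have "cylinder_ratio B \<mu> x m \<longlonglongrightarrow> (\<Prod>i<m. g ((left_shift ^^ i) x))"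
      using a by (intro ratio assms) auto
    then show "cylinder_ratio B \<mu> x m \<longlonglongrightarrow> p" "p = (\<Prod>i<m. g ((left_shift ^^ i) x))"
      using lim_eq by simp_all
  next
    fix y q
    assume "variation B g \<longlonglongrightarrow> 0"
      and "y \<in> subshift B \<and> prime_period y q \<and> (\<forall>n. measure \<mu> (cylinder B n y) > 0)"
    then have "cylinder_ratio B \<mu> y q \<longlonglongrightarrow> (\<Prod>i<q. g ((left_shift ^^ i) y))"
      by (intro ratio) (auto intro: cont funpow_left_shift_in_subshift)
    then show "convergent (cylinder_ratio B \<mu> y q)"
      by (auto simp: convergent_def)
  next
    fix t :: real
    assume b: "M \<ge> 2 \<and> summable (variation B g) \<and> (\<forall>y\<in>subshift B. g y > 0)" and t: "t > 0"
    have null: "variation B g \<longlonglongrightarrow> 0"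
      using b by (intro summable_LIMSEQ_zero) simp
    have "continuous_on (subshift B) g"
      unfolding continuous_on_def using cont[OF null] by blast
    \<comment> \<open>The minimum of the continuous positive \<open>g\<close> on the compact
      subshift serves as \<delta>.\<close>
    then obtain y0 where y0: "y0 \<in> subshift B" "\<And>y. y \<in> subshift B \<Longrightarrow> g y0 \<le> g y"
      using continuous_attains_inf[OF compact_subshift, of B g] assms(7) by blast
    obtain N where N: "\<And>i j. i < M \<Longrightarrow> j < M \<Longrightarrow> (B ^\<^sub>m N) $$ (i, j) > 0"
      using primitive_mat[OF assms(1,3,4)] by blast
    have dim: "dim_row B = M"
      using assms(1) by simp
    have "periodic_g_system B g \<mu> (g y0) N x m"
    proof unfold_locales
      show "\<exists>y\<in>subshift B. y 0 = c \<and> (left_shift ^^ N) y = z" if "c < dim_row B" "z \<in> subshift B" for c z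
        using that dim by (intro connecting_point[OF assms(1,2)] N) (auto simp: subshift_def)
    qed (use assms b y0 dim in auto)
    then interpret P: periodic_g_system B g \<mu> "g y0" N x m .
    \<comment> \<open>Positive cylinder measures are here a consequence of
      \<open>g > 0\<close>.\<close>
    have "cylinder_ratio B \<mu> x m \<longlonglongrightarrow> (\<Prod>i<m. g ((left_shift ^^ i) x))"
      using P.a_pos by (intro ratio assms) (auto intro: cont[OF null] P.T_x_in_S)
    then have "p = P.p"
      using lim_eq by (simp add: P.p_def)
    then show "weak_conv_m (\<lambda>n. distr \<mu> borel (visits B \<mu> x t n))
           (distr (measure_pmf (polya_aeppli_pmf t p)) borel real)"
      using P.visits_weak_conv[OF t] by simp
  }
qed

end
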